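(* Let $L:\Omega\times\mathbb{R}\times\mathbb{R}^N\to\mathbb{R}$ be a Carathéodory function and let $u\in\mathcal A$. Assume that there exist two sequences $$(c_k^+)_{k\geq1},\ (c_k^-)_{k\geq1}\subset W^{1,p}(\Omega)\cap L^\infty(\Omega)$$ such that $$\operatorname{ess\,inf}_{\Omega}c_k^+\longrightarrow+\infty,\qquad\operatorname{ess\,sup}_{\Omega}c_k^-\longrightarrow-\infty,$$ and $$\int_{[u>c_k^+]}\overline L(x,c_k^+,\nabla c_k^+)\,dx\longrightarrow0,\qquad\int_{[u<c_k^-]}\overline L(x,c_k^-,\nabla c_k^-)\,dx\longrightarrow0$$ as $k\to+\infty$. Then $\mathcal L$ is $L^\infty(\Omega)$-regular at $u$. More specifically, the functions $u_k=\min(c_k^+,\max(u,c_k^-))$ converge in norm and in energy to $u$.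
   Context: Let $N\ge 1$, let $\Omega\subset\mathbb{R}^N$ be a bounded open set, $1\leq p\leq N$, and $\varphi\in W^{1,p}(\mathbb{R}^N)\cap L^\infty(\mathbb{R}^N)$. $W^{1,p}_0(\Omega)$ is the closure in $W^{1,p}(\Omega)$ of the $C^1$ functions with compact support in $\Omega$, and $W^{1,p}_\varphi(\Omega)=\varphi+W^{1,p}_0(\Omega)$. A function $L:\Omega\times\mathbb{R}\times\mathbb{R}^N\to\mathbb{R}$ is Carathéodory if $L(\cdot,t,\xi)$ is measurable for every $(t,\xi)$ and $L(x,\cdot,\cdot)$ is continuous for a.e. $x$. Set $\mathcal L(u)=\int_\Omega L(x,u(x),\nabla u(x))\,dx$, and let $\mathcal A=\{u\in W^{1,p}_\varphi(\Omega): L(x,u,\nabla u)\in L^1(\Omega)\}$. The functional $\mathcal L$ is said to be $L^\infty(\Omega)$-regular at $u\in\mathcal A$ if there exists a sequence $(u_k)_{k\ge1}\subset\mathcal A\cap L^\infty(\Omega)$ such that $u_k\to u$ in $W^{1,p}(\Omega)$ (convergence in norm) and $L(x,u_k,\nabla u_k)\to L(x,u,\nabla u)$ in $L^1(\Omega)$ (convergence in energy). Notation: $\overline L(x,t,\xi):=|L(x,t,\xi)|+|\xi|^p$; $[u>c]=\{x\in\Omega:u(x)>c(x)\}$ and $[u<c]=\{x\in\Omega:u(x)<c(x)\}$. *)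

theory Defs
  imports "HOL-Analysis.Analysis" "HOL-Probability.Essential_Supremum"
begin

text \<open>Elements of function spaces over \<open>\<Omega>\<close> are represented by total functions of which only the
  values on \<open>\<Omega>\<close> matter. The \<open>L\<^sup>p\<close> and Sobolev spaces below are sets of representatives, closed
  under changing a function on a null set.\<close>

definition Lp_space :: "'a::euclidean_space set \<Rightarrow> real \<Rightarrow> ('a \<Rightarrow> 'b::euclidean_space) set" where
  "Lp_space \<Omega> p = {f \<in> borel_measurable (lebesgue_on \<Omega>).
     integrable (lebesgue_on \<Omega>) (\<lambda>x. norm (f x) powr p)}"

definition Linfty :: "'a::euclidean_space set \<Rightarrow> ('a \<Rightarrow> real) set" where
  "Linfty \<Omega> = {f \<in> borel_measurable (lebesgue_on \<Omega>). \<exists>C. AE x in lebesgue_on \<Omega>. \<bar>f x\<bar> \<le> C}"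

text \<open>Dual to \<^const>\<open>esssup\<close>.\<close>

definition essinf :: "'a measure \<Rightarrow> ('a \<Rightarrow> ereal) \<Rightarrow> ereal" where
  "essinf M f = (if f \<in> borel_measurable M then Liminf (ae_filter M) f else bot)"

definition C1_compact :: "'a::euclidean_space set \<Rightarrow> ('a \<Rightarrow> real) set" where
  "C1_compact \<Omega> = {\<psi>. (\<exists>G. (\<forall>x. GDERIV \<psi> x :> G x) \<and> continuous_on UNIV G) \<and>
     compact (closure {x. \<psi> x \<noteq> 0}) \<and> closure {x. \<psi> x \<noteq> 0} \<subseteq> \<Omega>}"

definition locally_integrable ::
    "'a::euclidean_space set \<Rightarrow> ('a \<Rightarrow> 'b::euclidean_space) \<Rightarrow> bool" where
  "locally_integrable \<Omega> f \<longleftrightarrow> (\<forall>K. compact K \<and> K \<subseteq> \<Omega> \<longrightarrow> integrable (lebesgue_on K) f)"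

text \<open>First-order weak derivatives are tested against \<open>C\<^sup>1\<close> functions with compact support
  (as in Gilbarg--Trudinger, Section 7.3). All partial derivatives are collected in one
  vector-valued identity.\<close>

definition has_weak_gradient ::
    "'a::euclidean_space set \<Rightarrow> ('a \<Rightarrow> real) \<Rightarrow> ('a \<Rightarrow> 'a) \<Rightarrow> bool" where
  "has_weak_gradient \<Omega> u g \<longleftrightarrow> locally_integrable \<Omega> u \<and> locally_integrable \<Omega> g \<and>
     (\<forall>\<psi>\<in>C1_compact \<Omega>. \<forall>G. (\<forall>x. GDERIV \<psi> x :> G x) \<longrightarrow>
        (LINT x|lebesgue_on \<Omega>. u x *\<^sub>R G x) = - (LINT x|lebesgue_on \<Omega>. \<psi> x *\<^sub>R g x))"

text \<open>The weak gradient is unique only up to null sets; an arbitrary representative is chosen.\<close>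

definition weak_gradient :: "'a::euclidean_space set \<Rightarrow> ('a \<Rightarrow> real) \<Rightarrow> 'a \<Rightarrow> 'a" where
  "weak_gradient \<Omega> u = (SOME g. has_weak_gradient \<Omega> u g)"

definition W1p :: "'a::euclidean_space set \<Rightarrow> real \<Rightarrow> ('a \<Rightarrow> real) set" where
  "W1p \<Omega> p = {u \<in> Lp_space \<Omega> p. \<exists>g \<in> Lp_space \<Omega> p. has_weak_gradient \<Omega> u g}"

text \<open>Meaningful for elements of \<^const>\<open>W1p\<close> only.\<close>

definition W1p_norm :: "'a::euclidean_space set \<Rightarrow> real \<Rightarrow> ('a \<Rightarrow> real) \<Rightarrow> real" where
  "W1p_norm \<Omega> p u =
     ((LINT x|lebesgue_on \<Omega>. \<bar>u x\<bar> powr p) +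
      (LINT x|lebesgue_on \<Omega>. norm (weak_gradient \<Omega> u x) powr p)) powr (1 / p)"

definition W1p_tendsto ::
    "'a::euclidean_space set \<Rightarrow> real \<Rightarrow> (nat \<Rightarrow> 'a \<Rightarrow> real) \<Rightarrow> ('a \<Rightarrow> real) \<Rightarrow> bool" where
  "W1p_tendsto \<Omega> p v u \<longleftrightarrow> (\<forall>k. v k \<in> W1p \<Omega> p) \<and> u \<in> W1p \<Omega> p \<and>
     (\<lambda>k. W1p_norm \<Omega> p (\<lambda>x. v k x - u x)) \<longlonglongrightarrow> 0"

definition W1p_zero :: "'a::euclidean_space set \<Rightarrow> real \<Rightarrow> ('a \<Rightarrow> real) set" where
  "W1p_zero \<Omega> p = {w \<in> W1p \<Omega> p.
     \<forall>\<epsilon>>0. \<exists>\<psi>\<in>C1_compact \<Omega>. W1p_norm \<Omega> p (\<lambda>x. w x - \<psi> x) < \<epsilon>}"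

definition W1p_bdry ::
    "'a::euclidean_space set \<Rightarrow> real \<Rightarrow> ('a \<Rightarrow> real) \<Rightarrow> ('a \<Rightarrow> real) set" where
  "W1p_bdry \<Omega> p \<phi> = {\<lambda>x. \<phi> x + w x | w. w \<in> W1p_zero \<Omega> p}"

definition caratheodory ::
    "'a::euclidean_space set \<Rightarrow> ('a \<Rightarrow> real \<Rightarrow> 'a \<Rightarrow> real) \<Rightarrow> bool" where
  "caratheodory \<Omega> L \<longleftrightarrow> (\<forall>t \<xi>. (\<lambda>x. L x t \<xi>) \<in> borel_measurable (lebesgue_on \<Omega>)) \<and>
     (AE x in lebesgue_on \<Omega>. continuous_on UNIV (\<lambda>(t, \<xi>). L x t \<xi>))"

definition lagrangian_along :: "'a::euclidean_space set \<Rightarrow> ('a \<Rightarrow> real \<Rightarrow> 'a \<Rightarrow> real) \<Rightarrow>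
    ('a \<Rightarrow> real) \<Rightarrow> 'a \<Rightarrow> real" where
  "lagrangian_along \<Omega> L u x = L x (u x) (weak_gradient \<Omega> u x)"

definition L_bar :: "real \<Rightarrow> ('a::euclidean_space \<Rightarrow> real \<Rightarrow> 'a \<Rightarrow> real) \<Rightarrow>
    'a \<Rightarrow> real \<Rightarrow> 'a \<Rightarrow> real" where
  "L_bar p L x t \<xi> = \<bar>L x t \<xi>\<bar> + norm \<xi> powr p"

definition admissible :: "'a::euclidean_space set \<Rightarrow> real \<Rightarrow> ('a \<Rightarrow> real) \<Rightarrow>
    ('a \<Rightarrow> real \<Rightarrow> 'a \<Rightarrow> real) \<Rightarrow> ('a \<Rightarrow> real) set" where
  "admissible \<Omega> p \<phi> L =
     {u \<in> W1p_bdry \<Omega> p \<phi>. integrable (lebesgue_on \<Omega>) (lagrangian_along \<Omega> L u)}"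

text \<open>Convergence in \<open>L\<^sup>1(\<Omega>)\<close> of \<open>L(x, v\<^sub>k, \<nabla>v\<^sub>k)\<close> to \<open>L(x, u, \<nabla>u)\<close>. Finitely many terms may fail
  to be integrable; for those the Bochner integral has a default value.\<close>

definition energy_tendsto :: "'a::euclidean_space set \<Rightarrow> ('a \<Rightarrow> real \<Rightarrow> 'a \<Rightarrow> real) \<Rightarrow>
    (nat \<Rightarrow> 'a \<Rightarrow> real) \<Rightarrow> ('a \<Rightarrow> real) \<Rightarrow> bool" where
  "energy_tendsto \<Omega> L v u \<longleftrightarrow>
     (\<forall>\<^sub>F k in sequentially. integrable (lebesgue_on \<Omega>) (lagrangian_along \<Omega> L (v k))) \<and>
     integrable (lebesgue_on \<Omega>) (lagrangian_along \<Omega> L u) \<and>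
     (\<lambda>k. LINT x|lebesgue_on \<Omega>. \<bar>lagrangian_along \<Omega> L (v k) x - lagrangian_along \<Omega> L u x\<bar>)
       \<longlonglongrightarrow> 0"

definition Linfty_regular :: "'a::euclidean_space set \<Rightarrow> real \<Rightarrow> ('a \<Rightarrow> real) \<Rightarrow>
    ('a \<Rightarrow> real \<Rightarrow> 'a \<Rightarrow> real) \<Rightarrow> ('a \<Rightarrow> real) \<Rightarrow> bool" where
  "Linfty_regular \<Omega> p \<phi> L u \<longleftrightarrow>
     (\<exists>v. (\<forall>k. v k \<in> admissible \<Omega> p \<phi> L \<inter> Linfty \<Omega>) \<and>
        W1p_tendsto \<Omega> p v u \<and> energy_tendsto \<Omega> L v u)"

end

theory Submission
  imports Defs "HOL-Probability.Probability_Measure"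
begin

text \<open>On \<open>[u > c\<^sub>k\<^sup>+]\<close> the truncation \<open>u\<^sub>k\<close> and its gradient coincide with \<open>c\<^sub>k\<^sup>+\<close> and its gradient, on
  \<open>[u < c\<^sub>k\<^sup>-]\<close> with \<open>c\<^sub>k\<^sup>-\<close> and its gradient, and elsewhere with \<open>u\<close> and its gradient. These two sets
  eventually avoid almost every point, so what \<open>u\<close> contributes on them tends to \<open>0\<close> by dominated
  convergence, while what the \<open>c\<^sub>k\<^sup>\<plusminus>\<close> contribute tends to \<open>0\<close> by hypothesis.

  That \<open>u\<^sub>k\<close> keeps the boundary values once \<open>c\<^sub>k\<^sup>- \<le> \<phi> \<le> c\<^sub>k\<^sup>+\<close> comes from
  \<open>u\<^sub>k - \<phi> = min (c\<^sub>k\<^sup>+ - \<phi>) (max (u - \<phi>) (c\<^sub>k\<^sup>- - \<phi>))\<close> and the stability of \<open>W\<^sub>0\<^sup>1\<^sup>,\<^sup>p\<close> under \<open>w \<mapsto> min w a\<close>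
  with \<open>a \<ge> 0\<close>: if \<open>\<psi>\<close> is a test function close to \<open>w\<close>, then \<open>min \<psi> a\<close> has compact support and is
  therefore a limit of its mollifications. Mollification also gives the uniqueness of weak
  gradients and the chain rule, from which \<open>\<nabla>max(u,0) = 1\<^bsub>[u>0]\<^esub> \<nabla>u\<close> follows by approximating the positive
  part by \<open>C\<^sup>1\<close> functions.\<close>

text \<open>Two obstacles shape the details. A weak gradient is an arbitrary representative, so
  estimates carry explicit gradients and return to \<open>weak_gradient\<close> through a.e.
  uniqueness. And the gradient of \<open>min w a\<close> jumps across the boundary of the set
  \<open>a < w\<close>: if test functions \<psi>_n tend to w a.e., the sets
  \<open>a < \<psi>_n\<close> settle pointwise only where \<open>w \<noteq> a\<close>. The limit
  survives because a.e. on \<open>w = a\<close> the gradients of w and a coincide, which itself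
  follows from the positive part formula applied to a function and to its negative.

  No limit is ever taken inside L: the truncated integrand equals that of u off the truncation sets
  and is bounded in absolute value on them. Continuity of L enters through the measurability of its
  compositions. One integrable majorant controls the errors in function, gradient and energy
  together.

  Since only the smallness of p-th powers matters, triangle inequalities appear with a constant
  \<open>2 powr p\<close>.\<close>

section \<open>Inequalities for p-th powers\<close>

lemma powr_add_le:
  fixes a b p :: real
  assumes "0 \<le> a" "0 \<le> b" "0 \<le> p"
  shows "(a + b) powr p \<le> 2 powr p * (a powr p + b powr p)"
proof -
  have "(a + b) powr p \<le> (2 * max a b) powr p"
    using assms by (intro powr_mono2) auto
  also have "\<dots> = 2 powr p * max a b powr p"
    using assms by (simp add: powr_mult)
  also have "\<dots> \<le> 2 powr p * (a powr p + b powr p)"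
    by (intro mult_left_mono) (auto simp: max_def)
  finally show ?thesis .
qed

text \<open>Takes the place of Minkowski's inequality: the estimates below concern p-th powers and
  only their smallness, so the constant is harmless. It comes from
  \<open>a + b \<le> 2 * max a b\<close>.\<close>

lemma norm_diff_powr_le:
  fixes a b :: "'b::real_normed_vector" and p :: real
  assumes "0 \<le> p"
  shows "norm (a - b) powr p \<le> 2 powr p * (norm a powr p + norm b powr p)"
proof -
  have "norm (a - b) powr p \<le> (norm a + norm b) powr p"
    using assms by (intro powr_mono2 norm_triangle_ineq4) auto
  also have "\<dots> \<le> 2 powr p * (norm a powr p + norm b powr p)"
    using assms by (intro powr_add_le) auto
  finally show ?thesis .
qed

text \<open>Convexity of \<open>x powr p\<close> on the open half-line, where it is differentiable.
  The endpoint \<open>a = 0\<close> reduces to \<open>(1 - p) * m powr p \<le> 0\<close> and is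
  checked separately.\<close>

lemma powr_tangent_le:
  fixes a m p :: real
  assumes "0 \<le> a" "0 < m" "1 \<le> p"
  shows "m powr p + p * m powr (p - 1) * (a - m) \<le> a powr p"
proof (cases "a = 0")
  case True
  have "m powr (p - 1) * m = m powr p"
    using assms by (simp add: powr_mult_base mult.commute)
  then have "m powr p + p * m powr (p - 1) * (a - m) = (1 - p) * m powr p"
    using True by (simp add: algebra_simps)
  also have "\<dots> \<le> 0"
    using assms by (simp add: mult_nonpos_nonneg)
  finally show ?thesis
    using assms True by simp
next
  case False
  have "((\<lambda>x. x powr p) has_real_derivative p * m powr (p - 1)) (at m within {0<..})"
    using has_field_derivative_at_within[OF has_real_derivative_powr[OF \<open>0 < m\<close>]] .
  moreover have "m \<in> interior {0<..}" "a \<in> {0<..}"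
    using assms False by (simp_all add: interior_open)
  ultimately have "p * m powr (p - 1) * (a - m) \<le> a powr p - m powr p"
    using convex_on_imp_above_tangent[OF powr_convex[OF \<open>1 \<le> p\<close>] connected_Ioi] by blast
  then show ?thesis by simp
qed

text \<open>Jensen's inequality: integrate the tangent at the mean, whose linear term averages to 0.
  The right-hand side is an extended integral, so an infinite value is allowed.\<close>

lemma (in prob_space) powr_expectation_le:
  fixes h :: "'a \<Rightarrow> real"
  assumes [measurable]: "h \<in> borel_measurable M" and "\<And>x. 0 \<le> h x" and "1 \<le> p"
  shows "ennreal (expectation h powr p) \<le> (\<integral>\<^sup>+x. ennreal (h x powr p) \<partial>M)"
proof (cases "(\<integral>\<^sup>+x. ennreal (h x powr p) \<partial>M) = \<infinity> \<or> expectation h \<le> 0")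
  case True
  moreover have "expectation h \<ge> 0"
    using assms by simp
  ultimately show ?thesis
    using assms by auto
next
  case False
  then have int: "integrable M (\<lambda>x. h x powr p)"
    by (intro integrableI_nonneg) (auto simp: top.not_eq_extremum)
  let ?m = "expectation h"
  \<comment> \<open>In this case the expectation is positive, whereas a non-integrable function
    would have the default integral 0.\<close>
  have "integrable M h"
    using False not_integrable_integral_eq by force
  have "?m powr p = expectation (\<lambda>x. ?m powr p + p * ?m powr (p - 1) * (h x - ?m))"
    using \<open>integrable M h\<close> by (simp add: prob_space)
  also have "\<dots> \<le> expectation (\<lambda>x. h x powr p)"
    using \<open>integrable M h\<close> int False assms by (intro integral_mono powr_tangent_le) auto
  finally show ?thesis
    using int by (simp add: nn_integral_eq_integral ennreal_leI)
qed

section \<open>Continuity of translations in L^1 and L^p\<close>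

lemma integrable_lborel_translation:
  fixes f :: "'a::euclidean_space \<Rightarrow> 'b::{banach, second_countable_topology}"
  assumes "integrable lborel f"
  shows "integrable lborel (\<lambda>x. f (x + c))" "integrable lborel (\<lambda>x. f (x - c))"
    "(LINT x|lborel. f (x + c)) = (LINT x|lborel. f x)" "(LINT x|lborel. f (x - c)) = (LINT x|lborel. f x)"
proof -
  have *: "integrable lborel (\<lambda>x. f (d + x)) \<and> (LINT x|lborel. f (d + x)) = (LINT x|lborel. f x)" for d
    using assms integrable_distr_eq[of "(+) d" lborel borel f] integral_distr[of "(+) d" lborel borel f]
    by (simp add: lborel_distr_plus)
  show "integrable lborel (\<lambda>x. f (x + c))" "(LINT x|lborel. f (x + c)) = (LINT x|lborel. f x)"
    using *[of c] by (auto simp: add.commute)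
  show "integrable lborel (\<lambda>x. f (x - c))" "(LINT x|lborel. f (x - c)) = (LINT x|lborel. f x)"
    using *[of "- c"] by (auto simp: add.commute)
qed

definition L1_translation_continuous :: "('a::euclidean_space \<Rightarrow> 'b::euclidean_space) \<Rightarrow> bool" where
  "L1_translation_continuous f \<longleftrightarrow>
     (\<forall>Y. Y \<longlonglongrightarrow> 0 \<longrightarrow> (\<lambda>n. LINT x|lborel. norm (f (x - Y n) - f x)) \<longlonglongrightarrow> 0)"

text \<open>The argument is Scheffe's. A point of the open set \<open>U\<close> stays in
  \<open>U\<close> under small shifts, so the positive part of the difference tends to 0 pointwise
  and is dominated by the indicator. Translation invariance makes the difference itself integrate to
  0, whence its L^1 norm is twice the integral of that positive part.\<close>

lemma L1_translation_continuous_open: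
  fixes U :: "'a::euclidean_space set"
  assumes "open U" "emeasure lborel U < \<infinity>"
  shows "L1_translation_continuous (indicat_real U)"
  unfolding L1_translation_continuous_def
proof (intro allI impI)
  fix Y :: "nat \<Rightarrow> 'a" assume Y: "Y \<longlonglongrightarrow> 0"
  let ?I = "indicat_real U"
  have [measurable]: "U \<in> sets borel"
    using assms by simp
  have int: "integrable lborel ?I"
    using assms by (simp add: integrable_indicator_iff)
  have lim: "(\<lambda>n. LINT x|lborel. max 0 (?I x - ?I (x - Y n))) \<longlonglongrightarrow> (LINT x|(lborel :: 'a measure). 0)"
  proof (rule integral_dominated_convergence[where w = ?I])
    show "AE x in lborel. (\<lambda>n. max 0 (?I x - ?I (x - Y n))) \<longlonglongrightarrow> 0"
    proof (rule AE_I2)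
      fix x
      show "(\<lambda>n. max 0 (?I x - ?I (x - Y n))) \<longlonglongrightarrow> 0"
      proof (cases "x \<in> U")
        case True
        have "(\<lambda>n. x - Y n) \<longlonglongrightarrow> x - 0"
          by (intro tendsto_intros Y)
        then have "\<forall>\<^sub>F n in sequentially. x - Y n \<in> U"
          using True assms topological_tendstoD by fastforce
        then have "\<forall>\<^sub>F n in sequentially. max 0 (?I x - ?I (x - Y n)) = 0"
          by eventually_elim auto
        then show ?thesis
          by (rule tendsto_eventually)
      qed (simp add: max_absorb1)
    qed
    show "AE x in lborel. norm (max 0 (?I x - ?I (x - Y n))) \<le> ?I x" for n
      by (auto simp: indicator_def)
  qed (use int in auto)
  have "(LINT x|lborel. norm (?I (x - Y n) - ?I x)) = 2 * (LINT x|lborel. max 0 (?I x - ?I (x - Y n)))" for n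
  proof -
    note T = integrable_lborel_translation[OF int, where c = "Y n"]
    have "(LINT x|lborel. norm (?I (x - Y n) - ?I x)) =
        (LINT x|lborel. 2 * max 0 (?I x - ?I (x - Y n)) + (?I (x - Y n) - ?I x))"
      by (intro Bochner_Integration.integral_cong) (auto simp: indicator_def)
    also have "\<dots> = (LINT x|lborel. 2 * max 0 (?I x - ?I (x - Y n))) + ((LINT x|lborel. ?I (x - Y n)) - (LINT x|lborel. ?I x))"
      using T int by (subst Bochner_Integration.integral_add) auto
    also have "\<dots> = 2 * (LINT x|lborel. max 0 (?I x - ?I (x - Y n)))"
      using T(4) by simp
    finally show ?thesis .
  qed
  then show "(\<lambda>n. LINT x|lborel. norm (?I (x - Y n) - ?I x)) \<longlonglongrightarrow> 0"
    using tendsto_mult_left[OF lim, of 2] by simp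
qed

text \<open>An \<open>r / 3\<close> argument: by translation invariance the shifted copy of
  \<open>f - g\<close> is as small as the unshifted one.\<close>

lemma L1_translation_continuous_approx:
  fixes f :: "'a::euclidean_space \<Rightarrow> 'b::euclidean_space"
  assumes f: "integrable lborel f"
    and approx: "\<And>e. e > 0 \<Longrightarrow> \<exists>g. integrable lborel g \<and> L1_translation_continuous g \<and>
                     (LINT x|lborel. norm (f x - g x)) < e"
  shows "L1_translation_continuous f"
  unfolding L1_translation_continuous_def
proof (intro allI impI)
  fix Y :: "nat \<Rightarrow> 'a" assume Y: "Y \<longlonglongrightarrow> 0"
  show "(\<lambda>n. LINT x|lborel. norm (f (x - Y n) - f x)) \<longlonglongrightarrow> 0"
  proof (rule LIMSEQ_I)
    fix r :: real assume "0 < r"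
    then obtain g where g: "integrable lborel g" "L1_translation_continuous g"
      and gr: "(LINT x|lborel. norm (f x - g x)) < r / 3"
      using approx[of "r / 3"] by auto
    have "(\<lambda>n. LINT x|lborel. norm (g (x - Y n) - g x)) \<longlonglongrightarrow> 0"
      using g Y by (auto simp: L1_translation_continuous_def)
    then obtain N where N: "\<And>n. n \<ge> N \<Longrightarrow> (LINT x|lborel. norm (g (x - Y n) - g x)) < r / 3"
      using \<open>0 < r\<close> LIMSEQ_D[of _ 0 "r / 3"] by fastforce
    have "(LINT x|lborel. norm (f (x - Y n) - f x)) < r" if "n \<ge> N" for n
    proof -
      have d: "integrable lborel (\<lambda>x. norm (f x - g x))"
        using f g by simp
      note T = integrable_lborel_translation[where c = "Y n"]
      have "(LINT x|lborel. norm (f (x - Y n) - f x)) \<le>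
        (LINT x|lborel. norm (f (x - Y n) - g (x - Y n)) + norm (g (x - Y n) - g x) + norm (f x - g x))"
      proof (rule integral_mono)
        show "norm (f (x - Y n) - f x) \<le>
            norm (f (x - Y n) - g (x - Y n)) + norm (g (x - Y n) - g x) + norm (f x - g x)" for x
          using norm_triangle_ineq4[of "f (x - Y n) - g (x - Y n) + (g (x - Y n) - g x)" "f x - g x"]
            norm_triangle_ineq[of "f (x - Y n) - g (x - Y n)" "g (x - Y n) - g x"]
          by (simp add: algebra_simps)
      qed (use T(2)[OF f] T(2)[OF g(1)] f g in auto)
      also have "\<dots> = (LINT x|lborel. norm (f (x - Y n) - g (x - Y n))) +
          (LINT x|lborel. norm (g (x - Y n) - g x)) + (LINT x|lborel. norm (f x - g x))"
        using T(2)[OF f] T(2)[OF g(1)] f g by simp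
      also have "\<dots> < r"
        using T(4)[OF d] gr N[OF that] by simp
      finally show ?thesis .
    qed
    then show "\<exists>no. \<forall>n\<ge>no. norm ((LINT x|lborel. norm (f (x - Y n) - f x)) - 0) < r"
      by auto
  qed
qed

text \<open>Outer regularity replaces \<open>A\<close> by an open superset, whose measure is finite
  because that of \<open>A\<close> is.\<close>

lemma L1_translation_continuous_indicator:
  fixes A :: "'a::euclidean_space set"
  assumes A: "A \<in> sets borel" "emeasure lborel A < \<infinity>"
  shows "L1_translation_continuous (indicat_real A)"
proof (rule L1_translation_continuous_approx)
  show intA: "integrable lborel (indicat_real A)"
    using A by (simp add: integrable_indicator_iff)
  fix e :: real assume "e > 0"
  have "A \<in> sets lebesgue"
    using A by (simp add: sets_completionI_sets)
  then obtain U where U: "open U" "A \<subseteq> U" "emeasure lebesgue (U - A) < ennreal e"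
    using sets_lebesgue_outer_open \<open>e > 0\<close> by metis
  have [measurable]: "U \<in> sets borel" "A \<in> sets borel"
    using U A by auto
  have UA: "emeasure lborel (U - A) < ennreal e"
    using U by (simp add: emeasure_completion)
  have "U = A \<union> (U - A)"
    using U by auto
  then have "emeasure lborel U \<le> emeasure lborel A + emeasure lborel (U - A)"
    by (metis A(1) \<open>U \<in> sets borel\<close> emeasure_subadditive sets.Diff sets_lborel)
  also have "\<dots> < \<infinity>"
    using A UA by (auto simp: ennreal_add_eq_top less_top order_less_trans[OF UA])
  finally have fin: "emeasure lborel U < \<infinity>" .
  have "(LINT x|lborel. norm (indicat_real A x - indicat_real U x)) = (LINT x|lborel. indicat_real (U - A) x)"
    using U by (intro Bochner_Integration.integral_cong) (auto simp: indicator_def)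
  also have "\<dots> < e"
  proof -
    have "emeasure lborel (U - A) = ennreal (measure lborel (U - A))"
      using UA by (intro emeasure_eq_ennreal_measure) auto
    then show ?thesis
      using UA by (simp add: ennreal_less_iff)
  qed
  finally show "\<exists>g. integrable lborel g \<and> L1_translation_continuous g \<and>
      (LINT x|lborel. norm (indicat_real A x - g x)) < e"
    using L1_translation_continuous_open[OF U(1) fin] fin
    by (intro exI[of _ "indicat_real U"]) (auto simp: integrable_indicator_iff)
qed

lemma L1_translation_continuous:
  fixes f :: "'a::euclidean_space \<Rightarrow> 'b::euclidean_space"
  assumes "integrable lborel f"
  shows "L1_translation_continuous f"
  using assms
proof (induction rule: integrable_induct)
  case (base A c)
  then have [measurable]: "A \<in> sets borel" by simp
  have "(LINT x|lborel. norm (indicat_real A (x - y) *\<^sub>R c - indicat_real A x *\<^sub>R c))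
      = (LINT x|lborel. norm (indicat_real A (x - y) - indicat_real A x)) * norm c" for y
    by (simp flip: scaleR_diff_left)
  then show ?case
    using L1_translation_continuous_indicator[of A] base
    by (auto simp: L1_translation_continuous_def intro!: tendsto_mult_left_zero)
next
  case (add f g)
  show ?case
    unfolding L1_translation_continuous_def
  proof (intro allI impI)
    fix Y :: "nat \<Rightarrow> 'a" assume Y: "Y \<longlonglongrightarrow> 0"
    note T = integrable_lborel_translation(2)[OF add(1)] integrable_lborel_translation(2)[OF add(2)]
    have lim: "(\<lambda>n. (LINT x|lborel. norm (f (x - Y n) - f x)) + (LINT x|lborel. norm (g (x - Y n) - g x))) \<longlonglongrightarrow> 0 + 0"
      using add Y by (intro tendsto_add) (auto simp: L1_translation_continuous_def)
    have "(LINT x|lborel. norm (f (x - Y n) + g (x - Y n) - (f x + g x))) \<le>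
       (LINT x|lborel. norm (f (x - Y n) - f x)) + (LINT x|lborel. norm (g (x - Y n) - g x))" for n
    proof -
      have "(LINT x|lborel. norm (f (x - Y n) + g (x - Y n) - (f x + g x))) \<le>
          (LINT x|lborel. norm (f (x - Y n) - f x) + norm (g (x - Y n) - g x))"
        using T add by (intro integral_mono norm_diff_triangle_ineq) auto
      then show ?thesis
        using T add by simp
    qed
    then show "(\<lambda>n. LINT x|lborel. norm (f (x - Y n) + g (x - Y n) - (f x + g x))) \<longlonglongrightarrow> 0"
      by (intro tendsto_sandwich[OF _ _ tendsto_const lim[simplified]]) auto
  qed
next
  case (lim f s)
  show ?case
  proof (rule L1_translation_continuous_approx[OF lim(4)])
    fix e :: real assume "e > 0"
    have "(\<lambda>n. LINT x|lborel. norm (f x - s n x)) \<longlonglongrightarrow> (LINT x|(lborel :: 'a measure). 0)"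
    proof (rule integral_dominated_convergence[where w = "\<lambda>x. 3 * norm (f x)"])
      show "AE x in lborel. (\<lambda>n. norm (f x - s n x)) \<longlonglongrightarrow> 0"
      proof (rule AE_I2)
        fix x :: 'a
        have "(\<lambda>n. norm (f x - s n x)) \<longlonglongrightarrow> norm (f x - f x)"
          using lim(2) by (intro tendsto_intros) auto
        then show "(\<lambda>n. norm (f x - s n x)) \<longlonglongrightarrow> 0" by simp
      qed
      show "AE x in lborel. norm (norm (f x - s n x)) \<le> 3 * norm (f x)" for n
      proof (rule AE_I2)
        fix x :: 'a
        show "norm (norm (f x - s n x)) \<le> 3 * norm (f x)"
          using lim(3)[of x n] norm_triangle_ineq4[of "f x" "s n x"] by simp
      qed
    qed (use lim(1,4) in auto)
    then obtain n where "(LINT x|lborel. norm (f x - s n x)) < e"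
      using \<open>e > 0\<close> by (force dest!: LIMSEQ_D[where r = e])
    then show "\<exists>g. integrable lborel g \<and> L1_translation_continuous g \<and> (LINT x|lborel. norm (f x - g x)) < e"
      using lim by blast
  qed
qed

lemma powr_le_mult_of_le:
  fixes a M p :: real
  assumes "0 \<le> a" "a \<le> M" "1 \<le> p"
  shows "a powr p \<le> M powr (p - 1) * a"
proof -
  have "a powr p = a powr (p - 1) * a"
    using powr_mult_base[of a "p - 1"] assms by (simp add: mult.commute)
  also have "\<dots> \<le> M powr (p - 1) * a"
    using assms by (intro mult_right_mono powr_mono2) auto
  finally show ?thesis .
qed

lemma integrable_dominated:
  fixes f :: "'a \<Rightarrow> 'b::euclidean_space" and g :: "'a \<Rightarrow> real"
  assumes "integrable M g" "f \<in> borel_measurable M" "\<And>x. x \<in> space M \<Longrightarrow> norm (f x) \<le> g x"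
  shows "integrable M f"
proof (rule Bochner_Integration.integrable_bound[OF assms(1,2)])
  show "AE x in M. norm (f x) \<le> norm (g x)"
    using order_trans[OF assms(3) abs_ge_self] by (intro AE_I2) simp
qed

lemma integrable_scaleR_bounded:
  fixes f :: "'a \<Rightarrow> real" and g :: "'a \<Rightarrow> 'b::euclidean_space"
  assumes f: "integrable M f" and g: "g \<in> borel_measurable M"
    and B: "\<And>x. x \<in> space M \<Longrightarrow> norm (g x) \<le> B"
  shows "integrable M (\<lambda>x. f x *\<^sub>R g x)"
proof (rule integrable_dominated)
  show "integrable M (\<lambda>x. \<bar>f x\<bar> * B)"
    using f by simp
qed (use f g B in \<open>auto intro!: mult_left_mono\<close>)

lemma integrable_bounded_scaleR:
  fixes f :: "'a \<Rightarrow> 'b::euclidean_space" and g :: "'a \<Rightarrow> real"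
  assumes f: "integrable M f" and g: "g \<in> borel_measurable M"
    and B: "\<And>x. x \<in> space M \<Longrightarrow> \<bar>g x\<bar> \<le> B"
  shows "integrable M (\<lambda>x. g x *\<^sub>R f x)"
proof (rule integrable_dominated)
  show "integrable M (\<lambda>x. B * norm (f x))"
    using f by simp
qed (use f g B in \<open>auto intro!: mult_right_mono\<close>)

lemma integrable_lborel_bounded_support:
  fixes f :: "'a::euclidean_space \<Rightarrow> 'b::euclidean_space"
  assumes "f \<in> borel_measurable borel" "\<And>x. norm (f x) \<le> B" "\<And>x. r < norm x \<Longrightarrow> f x = 0"
  shows "integrable lborel f"
proof (rule integrable_dominated)
  show "integrable lborel (\<lambda>x::'a. B * indicat_real (cball 0 r) x)"
    using emeasure_lborel_cball_finite by (intro integrable_mult_right) (auto simp: integrable_indicator_iff)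
qed (use assms in \<open>auto simp: indicator_def not_le\<close>)

lemma integrable_norm_diff_powr:
  fixes f g :: "'a \<Rightarrow> 'b::euclidean_space" and p :: real
  assumes [measurable]: "f \<in> borel_measurable M" "g \<in> borel_measurable M"
    and "integrable M (\<lambda>x. norm (f x) powr p)" "integrable M (\<lambda>x. norm (g x) powr p)" "0 \<le> p"
  shows "integrable M (\<lambda>x. norm (f x - g x) powr p)"
proof (rule integrable_dominated)
  show "integrable M (\<lambda>x. 2 powr p * (norm (f x) powr p + norm (g x) powr p))"
    using assms by simp
qed (use assms norm_diff_powr_le[of p] in auto)

text \<open>Truncating the values of \<open>f\<close> reduces the claim to L^1: for a function
  bounded by \<open>M\<close>, the p-th power of a difference is at most
  \<open>(2 * M) powr (p - 1)\<close> times the difference itself.\<close>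

lemma Lp_translation_continuous:
  fixes f :: "'a::euclidean_space \<Rightarrow> 'b::euclidean_space"
  assumes f: "integrable lborel f" "integrable lborel (\<lambda>x. norm (f x) powr p)" and p: "1 \<le> p"
    and Y: "Y \<longlonglongrightarrow> 0"
  shows "(\<lambda>n. LINT x|lborel. norm (f (x - Y n) - f x) powr p) \<longlonglongrightarrow> 0"
proof (rule LIMSEQ_I)
  fix r :: real assume "0 < r"
  have [measurable]: "f \<in> borel_measurable borel"
    using f by auto
  define g where "g M x = (if norm (f x) \<le> real M then f x else 0)" for M x
  have [measurable]: "g M \<in> borel_measurable borel" for M
    unfolding g_def by measurable
  have gp: "integrable lborel (\<lambda>x. norm (g M x) powr p)" for M
    by (rule Bochner_Integration.integrable_bound[OF f(2)]) (auto simp: g_def)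
  have g1: "integrable lborel (g M)" for M
    by (rule Bochner_Integration.integrable_bound[OF f(1)]) (auto simp: g_def)
  have "(\<lambda>M. LINT x|lborel. norm (f x - g M x) powr p) \<longlonglongrightarrow> (LINT x|(lborel :: 'a measure). 0)"
  proof (rule integral_dominated_convergence[OF _ _ f(2)])
    show "AE x in lborel. (\<lambda>M. norm (f x - g M x) powr p) \<longlonglongrightarrow> 0"
    proof (rule AE_I2)
      fix x
      have "\<forall>\<^sub>F M in sequentially. norm (f x) \<le> real M"
        using filterlim_real_sequentially unfolding filterlim_at_top by blast
      then have "\<forall>\<^sub>F M in sequentially. norm (f x - g M x) powr p = 0"
        by eventually_elim (simp add: g_def)
      then show "(\<lambda>M. norm (f x - g M x) powr p) \<longlonglongrightarrow> 0"
        by (rule tendsto_eventually)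
    qed
  qed (auto simp: g_def)
  \<comment> \<open>The factor is that of the final estimate: \<open>norm_diff_powr_le\<close> is
    used twice in succession, and \<open>f - g M\<close> occurs both shifted and unshifted.\<close>
  from order_tendstoD(2)[OF tendsto_mult_left[OF this, of "2 powr p * (2 powr p * 2)"], of "r / 2"]
  have "\<forall>\<^sub>F M in sequentially. 2 powr p * (2 powr p * (2 * (LINT x|lborel. norm (f x - g M x) powr p))) < r / 2"
    using \<open>0 < r\<close> by (simp add: mult.assoc)
  then obtain M where M: "2 powr p * (2 powr p * (2 * (LINT x|lborel. norm (f x - g M x) powr p))) < r / 2"
    using eventually_happens[of _ sequentially] by auto
  define K where "K = (2 * real M) powr (p - 1)"
  have "(\<lambda>n. LINT x|lborel. norm (g M (x - Y n) - g M x)) \<longlonglongrightarrow> 0"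
    using L1_translation_continuous[OF g1[of M]] Y by (auto simp: L1_translation_continuous_def)
  from order_tendstoD(2)[OF tendsto_mult_left[OF this, of "2 powr p * K"], of "r / 2"]
  have "\<forall>\<^sub>F n in sequentially. 2 powr p * (K * (LINT x|lborel. norm (g M (x - Y n) - g M x))) < r / 2"
    using \<open>0 < r\<close> by (simp add: mult.assoc)
  then obtain N where N: "\<And>n. n \<ge> N \<Longrightarrow> 2 powr p * (K * (LINT x|lborel. norm (g M (x - Y n) - g M x))) < r / 2"
    by (auto simp: eventually_sequentially)
  have "(LINT x|lborel. norm (f (x - Y n) - f x) powr p) < r" if "n \<ge> N" for n
  proof -
    let ?y = "Y n"
    let ?e = "\<lambda>x. norm (f x - g M x) powr p"
    have e: "integrable lborel ?e"
      using f gp p by (intro integrable_norm_diff_powr) auto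
    have e': "integrable lborel (\<lambda>x. ?e (x - ?y))"
      by (rule integrable_lborel_translation(2)[OF e])
    have g': "integrable lborel (\<lambda>x. norm (g M (x - ?y) - g M x))"
      using g1[of M] integrable_lborel_translation(2)[OF g1[of M], of ?y] by simp
    have int: "integrable lborel (\<lambda>x. norm (f (x - ?y) - f x) powr p)"
      using integrable_lborel_translation(2)[OF f(2), of ?y] f p
      by (intro integrable_norm_diff_powr) auto
    have "norm (f (x - ?y) - f x) powr p \<le>
        2 powr p * (2 powr p * (?e (x - ?y) + ?e x) + K * norm (g M (x - ?y) - g M x))" for x
    proof -
      let ?A = "(f (x - ?y) - g M (x - ?y)) - (f x - g M x)" and ?B = "g M (x - ?y) - g M x"
      have "norm (f (x - ?y) - f x) powr p = norm (?A - (- ?B)) powr p"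
        by simp
      also have "\<dots> \<le> 2 powr p * (norm ?A powr p + norm (- ?B) powr p)"
        using p by (intro norm_diff_powr_le) auto
      also have "\<dots> \<le> 2 powr p * (2 powr p * (?e (x - ?y) + ?e x) + K * norm ?B)"
      proof (intro mult_left_mono add_mono)
        show "norm ?A powr p \<le> 2 powr p * (?e (x - ?y) + ?e x)"
          using p by (intro norm_diff_powr_le) auto
        have gM: "norm (g M z) \<le> real M" for z
          by (simp add: g_def)
        have "norm ?B \<le> 2 * real M"
          using norm_triangle_ineq4[of "g M (x - ?y)" "g M x"] gM[of "x - ?y"] gM[of x] by linarith
        then show "norm (- ?B) powr p \<le> K * norm ?B"
          using p powr_le_mult_of_le[of "norm ?B" "2 * real M" p] by (simp add: K_def norm_minus_commute)
      qed auto
      finally show ?thesis .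
    qed
    then have "(LINT x|lborel. norm (f (x - ?y) - f x) powr p) \<le>
        (LINT x|lborel. 2 powr p * (2 powr p * (?e (x - ?y) + ?e x) + K * norm (g M (x - ?y) - g M x)))"
      using e e' g' int by (intro integral_mono) auto
    also have "\<dots> = 2 powr p * (2 powr p * ((LINT x|lborel. ?e (x - ?y)) + (LINT x|lborel. ?e x))
        + K * (LINT x|lborel. norm (g M (x - ?y) - g M x)))"
      using e e' g' by simp
    also have "(LINT x|lborel. ?e (x - ?y)) = (LINT x|lborel. ?e x)"
      by (rule integrable_lborel_translation(4)[OF e])
    also have "2 powr p * (2 powr p * ((LINT x|lborel. ?e x) + (LINT x|lborel. ?e x))
        + K * (LINT x|lborel. norm (g M (x - ?y) - g M x))) < r"
      using M N[OF that] by (simp add: algebra_simps)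
    finally show ?thesis .
  qed
  then show "\<exists>no. \<forall>n\<ge>no. norm ((LINT x|lborel. norm (f (x - Y n) - f x) powr p) - 0) < r"
    by auto
qed

text \<open>The map \<open>y \<mapsto> x - y\<close> is affine with factor -1 and preserves Lebesgue
  measure.\<close>

lemma
  fixes f :: "'a::euclidean_space \<Rightarrow> 'b::{banach, second_countable_topology}"
  assumes [measurable]: "f \<in> borel_measurable borel"
  shows integrable_lborel_reflect: "integrable lborel (\<lambda>y. f (x - y)) \<longleftrightarrow> integrable lborel f"
    and lborel_integral_reflect: "(LINT y|lborel. f (x - y)) = (LINT y|lborel. f y)"
proof -
  have *: "distr lborel borel (\<lambda>y. x + (-1) *\<^sub>R y) = (lborel :: 'a measure)"
    by (subst (2) lborel_affine[of "-1" x]) (auto simp: density_1)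
  show "integrable lborel (\<lambda>y. f (x - y)) \<longleftrightarrow> integrable lborel f"
    using integrable_distr_eq[of "\<lambda>y. x + (-1) *\<^sub>R y" lborel borel f] unfolding * by simp
  show "(LINT y|lborel. f (x - y)) = (LINT y|lborel. f y)"
    using integral_distr[of "\<lambda>y. x + (-1) *\<^sub>R y" lborel borel f] unfolding * by simp
qed

lemma lebesgue_measurable_borel_representative:
  fixes f :: "'a::euclidean_space \<Rightarrow> 'b::euclidean_space"
  assumes f: "f \<in> borel_measurable lebesgue"
  obtains f' where "f' \<in> borel_measurable borel" "AE x in lebesgue. f x = f' x"
proof -
  have "\<exists>h\<in>borel_measurable lborel. AE x in lborel. f x \<bullet> b = h x" for b
    using f by (intro completion_ex_borel_measurable_real) auto
  then obtain h where h: "\<And>b. h b \<in> borel_measurable borel" "\<And>b. AE x in lborel. f x \<bullet> b = h b x"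
    by (metis measurable_lborel2)
  show thesis
  proof
    show "(\<lambda>x. \<Sum>b\<in>Basis. h b x *\<^sub>R b) \<in> borel_measurable borel"
      using h by measurable
    have "AE x in lborel. \<forall>b\<in>Basis. f x \<bullet> b = h b x"
      using h by (intro AE_finite_allI) auto
    then have "AE x in lborel. f x = (\<Sum>b\<in>Basis. h b x *\<^sub>R b)"
      by eventually_elim (metis (no_types, lifting) euclidean_representation sum.cong)
    then show "AE x in lebesgue. f x = (\<Sum>b\<in>Basis. h b x *\<^sub>R b)"
      by (rule AE_completion)
  qed
qed

section \<open>Mollification\<close>

text \<open>Only \<open>C\<^sup>1\<close>, which is all that \<^const>\<open>C1_compact\<close> asks of a test function; its gradient is Lipschitz,
  so that the first-order Taylor remainder is quadratic uniformly in the base point.\<close>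

definition bump :: "real \<Rightarrow> 'a::euclidean_space \<Rightarrow> real" where
  "bump d x = (max 0 (d\<^sup>2 - x \<bullet> x))\<^sup>2"

definition bump_grad :: "real \<Rightarrow> 'a::euclidean_space \<Rightarrow> 'a" where
  "bump_grad d x = (- 4 * max 0 (d\<^sup>2 - x \<bullet> x)) *\<^sub>R x"

text \<open>The derivative \<open>2 * max 0 t\<close> is 2-Lipschitz, so the second-order remainder
  is at most \<open>b^2\<close>. This serves both the mollifier and the smoothed positive
  part.\<close>

lemma max_0_power2_taylor:
  fixes a b :: real
  shows "\<bar>(max 0 (a + b))\<^sup>2 - (max 0 a)\<^sup>2 - 2 * max 0 a * b\<bar> \<le> b\<^sup>2"
proof (cases "0 \<le> a")
  case True
  show ?thesis
  proof (cases "0 \<le> a + b")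
    case True
    then show ?thesis using \<open>0 \<le> a\<close> by (simp add: power2_eq_square algebra_simps)
  next
    case False
    then have *: "0 \<le> a * (- b - a)" "0 \<le> (a + b)\<^sup>2" "0 \<le> a * a" "0 \<le> b * b"
      using \<open>0 \<le> a\<close> by (auto intro!: mult_nonneg_nonneg)
    from * have "a * a \<le> - (a * b)" "- (a * a) - 2 * (a * b) \<le> b * b"
      unfolding power2_eq_square by (simp_all add: algebra_simps)
    then have "\<bar>- a\<^sup>2 - 2 * a * b\<bar> \<le> b\<^sup>2"
      using *(3,4) unfolding power2_eq_square mult.assoc by linarith
    then show ?thesis using False \<open>0 \<le> a\<close>
      by simp
  qed
next
  case False
  then have "(max 0 (a + b))\<^sup>2 \<le> b\<^sup>2"
    by (cases "0 \<le> a + b") (auto intro!: power_mono)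
  then show ?thesis using False by simp
qed

lemma bump_eq_0: "d \<le> norm x \<Longrightarrow> 0 \<le> d \<Longrightarrow> bump d x = 0"
  and bump_grad_eq_0: "d \<le> norm x \<Longrightarrow> 0 \<le> d \<Longrightarrow> bump_grad d x = 0"
  using power_mono[of d "norm x" 2] by (auto simp: bump_def bump_grad_def dot_square_norm max_absorb1)

lemma bump_nonneg: "0 \<le> bump d x"
  by (simp add: bump_def)

lemma bump_le: "bump d x \<le> d ^ 4"
proof -
  have "(max 0 (d\<^sup>2 - x \<bullet> x))\<^sup>2 \<le> (d\<^sup>2)\<^sup>2"
    by (intro power_mono) auto
  then show ?thesis by (simp add: bump_def)
qed

lemma norm_bump_grad_le:
  assumes "0 \<le> d"
  shows "norm (bump_grad d x) \<le> 4 * d ^ 3"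
proof (cases "d \<le> norm x")
  case True
  then show ?thesis using assms by (simp add: bump_grad_eq_0)
next
  case False
  have "norm (bump_grad d x) = 4 * max 0 (d\<^sup>2 - x \<bullet> x) * norm x"
    by (simp add: bump_grad_def)
  also have "\<dots> \<le> 4 * d\<^sup>2 * d"
    using False by (intro mult_mono) auto
  finally show ?thesis by (simp add: power2_eq_square power3_eq_cube)
qed

lemma continuous_on_bump: "continuous_on S (bump d)"
  unfolding bump_def by (intro continuous_intros)

lemma continuous_on_bump_grad: "continuous_on S (bump_grad d)"
  unfolding bump_grad_def by (intro continuous_intros)

lemma bump_measurable [measurable]:
  "bump d \<in> borel_measurable borel" "bump_grad d \<in> borel_measurable borel"
  by (intro borel_measurable_continuous_onI continuous_on_bump continuous_on_bump_grad)+

text \<open>Let \<open>a\<close> and \<open>a + b\<close> be the arguments of the positive part at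
  \<open>z\<close> and \<open>z + h\<close>. Then \<open>h \<bullet> bump_grad d z\<close> is
  \<open>2 * max 0 a * b\<close> plus \<open>2 * max 0 a * (norm h)^2\<close>. The second term, with
  \<open>max 0 a \<le> d^2\<close>, yields \<open>2 * d^2\<close>; the remainder \<open>b^2\<close>,
  with \<open>\<bar>b\<bar> \<le> (2 * d + 3) * norm h\<close>, yields the rest of the
  constant.\<close>

lemma bump_taylor:
  assumes "0 \<le> d" "norm h \<le> 1"
  shows "\<bar>bump d (z + h) - bump d z - h \<bullet> bump_grad d z\<bar> \<le> (2 * d\<^sup>2 + (2 * d + 3)\<^sup>2) * (norm h)\<^sup>2"
\<comment> \<open>Beyond radius \<open>d + 1\<close> a step of length at most 1 does not reach the
  region where the bump is nonzero; inside, \<open>norm z\<close> is bounded, so the constant does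
  not depend on \<open>z\<close>.\<close>
proof (cases "norm z \<le> d + 1")
  case False
  have "norm z \<le> norm (z + h) + norm h"
    using norm_triangle_ineq4[of "z + h" h] by simp
  then show ?thesis
    using False assms by (simp add: bump_eq_0 bump_grad_eq_0)
next
  case True
  define a b where "a = d\<^sup>2 - z \<bullet> z" and "b = - 2 * (z \<bullet> h) - h \<bullet> h"
  have ab: "d\<^sup>2 - (z + h) \<bullet> (z + h) = a + b"
    by (simp add: a_def b_def inner_add inner_commute)
  have hb: "h \<bullet> bump_grad d z = 2 * max 0 a * b + 2 * max 0 a * (norm h)\<^sup>2"
    by (simp add: bump_grad_def a_def b_def inner_commute algebra_simps dot_square_norm)
  have "\<bar>z \<bullet> h\<bar> \<le> (d + 1) * norm h"
    using Cauchy_Schwarz_ineq2[of z h] True mult_right_mono[of "norm z" "d + 1" "norm h"] by simp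
  moreover have "(norm h)\<^sup>2 \<le> norm h"
    using assms by (simp add: power2_eq_square mult_left_le)
  ultimately have "\<bar>b\<bar> \<le> (2 * d + 3) * norm h"
    using norm_ge_zero[of h] zero_le_power2[of "norm h"]
    unfolding b_def dot_square_norm distrib_right by linarith
  then have "b\<^sup>2 \<le> ((2 * d + 3) * norm h)\<^sup>2"
    using abs_le_square_iff assms by fastforce
  then have "b\<^sup>2 \<le> (2 * d + 3)\<^sup>2 * (norm h)\<^sup>2"
    by (simp add: power_mult_distrib)
  moreover have "2 * max 0 a * (norm h)\<^sup>2 \<le> 2 * d\<^sup>2 * (norm h)\<^sup>2"
    by (intro mult_right_mono) (auto simp: a_def)
  moreover have "0 \<le> 2 * max 0 a * (norm h)\<^sup>2"
    by simp
  moreover have "\<bar>bump d (z + h) - bump d z - 2 * max 0 a * b\<bar> \<le> b\<^sup>2"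
    using max_0_power2_taylor[of a b] by (simp add: bump_def ab flip: a_def)
  ultimately show ?thesis
    unfolding hb distrib_right[of _ _ "(norm h)\<^sup>2"] by linarith
qed

text \<open>A quadratic remainder with a uniform constant survives integration against an L^1
  function. This one criterion differentiates the mollifier, the mollified functions and
  \<open>(max 0 t)^2\<close>.\<close>

lemma GDERIV_of_quadratic_error:
  assumes "0 \<le> C" and "\<And>h. norm h \<le> 1 \<Longrightarrow> \<bar>f (x + h) - f x - h \<bullet> g\<bar> \<le> C * (norm h)\<^sup>2"
  shows "GDERIV f x :> g"
  unfolding gderiv_def has_derivative_at_alt
proof (intro conjI allI impI)
  show "bounded_linear (\<lambda>h. h \<bullet> g)"
    by (rule bounded_linear_inner_left)
  fix e :: real assume "0 < e"
  define d where "d = min 1 (e / (C + 1))"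
  have "0 < d"
    using \<open>0 < e\<close> assms by (simp add: d_def)
  moreover have "norm (f y - f x - (y - x) \<bullet> g) \<le> e * norm (y - x)" if y: "norm (y - x) < d" for y
  proof -
    have "C * norm (y - x) \<le> (C + 1) * (e / (C + 1))"
      using y assms by (intro mult_mono) (auto simp: d_def)
    also have "\<dots> = e"
      using assms by simp
    finally have Ce: "C * norm (y - x) \<le> e" .
    have "norm (f y - f x - (y - x) \<bullet> g) \<le> C * (norm (y - x))\<^sup>2"
      using assms(2)[of "y - x"] y by (simp add: d_def)
    also have "\<dots> = C * norm (y - x) * norm (y - x)"
      by (simp add: power2_eq_square)
    also have "\<dots> \<le> e * norm (y - x)"
      using Ce by (intro mult_right_mono) auto
    finally show ?thesis .
  qed
  ultimately show "\<exists>d>0. \<forall>y. norm (y - x) < d \<longrightarrow> norm (f y - f x - (y - x) \<bullet> g) \<le> e * norm (y - x)"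
    by blast
qed

lemma integrable_bump: "integrable lborel (bump d :: 'a::euclidean_space \<Rightarrow> real)"
proof (rule integrable_lborel_bounded_support)
  show "norm (bump d x) \<le> d ^ 4" for x :: 'a
    using bump_le[of d x] bump_nonneg[of d x] by simp
  show "bump d x = 0" if "\<bar>d\<bar> < norm x" for x :: 'a
    using bump_eq_0[of "\<bar>d\<bar>" x] that by (simp add: bump_def)
qed measurable

lemma integral_bump_pos:
  assumes "0 < d"
  shows "0 < (LINT x|lborel. bump d (x::'a::euclidean_space))"
proof -
  \<comment> \<open>On the ball of radius \<open>d / 2\<close> one has
    \<open>d^2 - x \<bullet> x \<ge> 3 / 4 * d^2\<close>, so half of \<open>d^2\<close> is a safe
    lower bound.\<close>
  have "measure lborel (ball (0::'a) (d/2)) * (d\<^sup>2 / 2)\<^sup>2 = (LINT x|lborel. indicator (ball (0::'a) (d/2)) x * (d\<^sup>2 / 2)\<^sup>2)"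
    by simp
  also have "\<dots> \<le> (LINT x|lborel. bump d (x::'a))"
  proof (rule integral_mono)
    show "integrable lborel (\<lambda>x. indicat_real (ball (0::'a) (d/2)) x * (d\<^sup>2 / 2)\<^sup>2)"
      using emeasure_lborel_ball_finite by (intro integrable_mult_left) (auto simp: integrable_indicator_iff)
    fix x :: 'a
    have "(d\<^sup>2 / 2)\<^sup>2 \<le> bump d x" if "norm x < d / 2"
    proof -
      have "(norm x)\<^sup>2 \<le> (d / 2)\<^sup>2"
        using that by (intro power_mono) auto
      then have "d\<^sup>2 / 2 \<le> d\<^sup>2 - x \<bullet> x"
        using zero_le_power2[of d] unfolding dot_square_norm power_divide power2_eq_square[of 2] by linarith
      then have "d\<^sup>2 / 2 \<le> max 0 (d\<^sup>2 - x \<bullet> x)"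
        unfolding le_max_iff_disj ..
      then show ?thesis
        unfolding bump_def by (intro power_mono) auto
    qed
    then show "indicat_real (ball (0::'a) (d/2)) x * (d\<^sup>2 / 2)\<^sup>2 \<le> bump d x"
      using bump_nonneg[of d x] by (auto simp: indicator_def)
  qed (rule integrable_bump)
  moreover have "0 < measure lborel (ball (0::'a) (d/2)) * (d\<^sup>2 / 2)\<^sup>2"
    using assms content_ball_pos[of "d/2" "0::'a"] by simp
  ultimately show ?thesis by linarith
qed

definition moll :: "real \<Rightarrow> 'a::euclidean_space \<Rightarrow> real" where
  "moll d x = bump d x / (LINT y|lborel. bump d (y::'a))"

definition moll_grad :: "real \<Rightarrow> 'a::euclidean_space \<Rightarrow> 'a" where
  "moll_grad d x = bump_grad d x /\<^sub>R (LINT y|lborel. bump d (y::'a))"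

text \<open>The integral is taken with respect to \<^term>\<open>lebesgue\<close>, so that \<open>f\<close> may be replaced by a Borel
  representative; Fubini is applied to the latter.\<close>

definition mollify ::
    "real \<Rightarrow> ('a::euclidean_space \<Rightarrow> 'b::euclidean_space) \<Rightarrow> 'a \<Rightarrow> 'b" where
  "mollify d f x = (LINT y|lebesgue. moll d (x - y) *\<^sub>R f y)"

lemma moll_eq_0: "d \<le> norm x \<Longrightarrow> 0 \<le> d \<Longrightarrow> moll d x = 0"
  and moll_grad_eq_0: "d \<le> norm x \<Longrightarrow> 0 \<le> d \<Longrightarrow> moll_grad d x = 0"
  by (simp_all add: moll_def moll_grad_def bump_eq_0 bump_grad_eq_0)

lemma moll_nonneg: "0 \<le> moll d x"
  unfolding moll_def by (intro divide_nonneg_nonneg Bochner_Integration.integral_nonneg bump_nonneg)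

lemma moll_bounded:
  assumes "0 < d"
  obtains C where "0 \<le> C" "\<And>x :: 'a::euclidean_space. moll d x \<le> C" "\<And>x :: 'a. norm (moll_grad d x) \<le> C"
proof
  let ?I = "LINT y|lborel. bump d (y::'a)"
  have I: "0 < ?I"
    using assms by (rule integral_bump_pos)
  show "0 \<le> max (d ^ 4 / ?I) (4 * d ^ 3 / ?I)"
    using I by (auto simp: le_max_iff_disj)
  show "moll d x \<le> max (d ^ 4 / ?I) (4 * d ^ 3 / ?I)" for x :: 'a
    using I bump_le[of d x] by (auto simp: moll_def le_max_iff_disj divide_right_mono)
  show "norm (moll_grad d x) \<le> max (d ^ 4 / ?I) (4 * d ^ 3 / ?I)" for x :: 'a
  proof -
    have "norm (moll_grad d x) = norm (bump_grad d x) / ?I"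
      using I by (simp add: moll_grad_def divide_inverse mult.commute)
    also have "\<dots> \<le> 4 * d ^ 3 / ?I"
      using I assms norm_bump_grad_le[of d x] by (intro divide_right_mono) auto
    finally show ?thesis by simp
  qed
qed

lemma continuous_on_moll_grad: "continuous_on S (moll_grad d)"
  unfolding moll_grad_def by (intro continuous_intros continuous_on_bump_grad)

lemma moll_measurable [measurable]:
  "moll d \<in> borel_measurable borel" "moll_grad d \<in> borel_measurable borel"
  unfolding moll_def moll_grad_def by measurable

lemma moll_shift_measurable [measurable]:
  "(\<lambda>y. moll d (x - y)) \<in> borel_measurable lebesgue" "(\<lambda>y. moll_grad d (x - y)) \<in> borel_measurable lebesgue"
  by (intro measurable_completion, measurable)+

lemma moll_taylor:
  assumes "0 < d"
  obtains C where "0 \<le> C"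
    "\<And>z h :: 'a::euclidean_space. norm h \<le> 1 \<Longrightarrow> \<bar>moll d (z + h) - moll d z - h \<bullet> moll_grad d z\<bar> \<le> C * (norm h)\<^sup>2"
proof
  let ?I = "LINT y|lborel. bump d (y::'a)" and ?C = "2 * d\<^sup>2 + (2 * d + 3)\<^sup>2"
  have I: "0 < ?I"
    using assms by (rule integral_bump_pos)
  show "0 \<le> ?C / ?I"
    using I by simp
  fix z h :: 'a assume "norm h \<le> 1"
  have "moll d (z + h) - moll d z - h \<bullet> moll_grad d z = (bump d (z + h) - bump d z - h \<bullet> bump_grad d z) / ?I"
    by (simp add: moll_def moll_grad_def divide_inverse algebra_simps)
  then have "\<bar>moll d (z + h) - moll d z - h \<bullet> moll_grad d z\<bar> = \<bar>bump d (z + h) - bump d z - h \<bullet> bump_grad d z\<bar> / ?I"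
    using I by (simp add: abs_divide)
  also have "\<dots> \<le> ?C * (norm h)\<^sup>2 / ?I"
    using I assms \<open>norm h \<le> 1\<close> by (intro divide_right_mono bump_taylor) auto
  finally show "\<bar>moll d (z + h) - moll d z - h \<bullet> moll_grad d z\<bar> \<le> ?C / ?I * (norm h)\<^sup>2"
    by simp
qed

lemma GDERIV_moll: "0 < d \<Longrightarrow> GDERIV (moll d) x :> moll_grad d x"
  using moll_taylor GDERIV_of_quadratic_error by metis

lemma integrable_moll: "integrable lborel (moll d)"
  unfolding moll_def by (intro integrable_divide_zero integrable_bump)

lemma integral_moll: "0 < d \<Longrightarrow> (LINT x|lborel. moll d (x::'a::euclidean_space)) = 1"
  using integral_bump_pos[of d, where 'a = 'a] by (simp add: moll_def)

lemma integrable_moll_scaleR: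
  fixes f :: "'a::euclidean_space \<Rightarrow> 'b::euclidean_space"
  assumes f: "integrable lebesgue f" and "0 < d"
  shows "integrable lebesgue (\<lambda>y. moll d (x - y) *\<^sub>R f y)"
proof -
  obtain C where C: "0 \<le> C" "\<And>x :: 'a. moll d x \<le> C"
    using moll_bounded \<open>0 < d\<close> by metis
  have "\<bar>moll d y\<bar> \<le> C" for y :: 'a
    using C(2)[of y] moll_nonneg[of d y] by simp
  then show ?thesis
    by (intro integrable_bounded_scaleR[where B = C] f) auto
qed

lemma integrable_moll_grad_scaleR:
  fixes f :: "'a::euclidean_space \<Rightarrow> real"
  assumes f: "integrable lebesgue f" and "0 < d"
  shows "integrable lebesgue (\<lambda>y. f y *\<^sub>R moll_grad d (x - y))"
proof -
  obtain C where C: "0 \<le> C" "\<And>x :: 'a. norm (moll_grad d x) \<le> C"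
    using moll_bounded \<open>0 < d\<close> by metis
  show ?thesis
    by (intro integrable_scaleR_bounded[where B = C] f) (auto simp: C)
qed

section \<open>Differentiating mollified functions\<close>

text \<open>Differentiation under the integral sign: the remainder of the mollifier is quadratic
  uniformly in \<open>x - y\<close>, so after integration it is at most \<open>C\<close> times the
  L^1 norm of \<open>f\<close> times \<open>(norm h)^2\<close>.\<close>

lemma GDERIV_mollify:
  fixes f :: "'a::euclidean_space \<Rightarrow> real"
  assumes f: "integrable lebesgue f" and d: "0 < d"
  shows "GDERIV (mollify d f) x :> (LINT y|lebesgue. f y *\<^sub>R moll_grad d (x - y))"
proof -
  obtain C where C: "0 \<le> C" "\<And>z h :: 'a. norm h \<le> 1 \<Longrightarrow>
      \<bar>moll d (z + h) - moll d z - h \<bullet> moll_grad d z\<bar> \<le> C * (norm h)\<^sup>2"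
    using moll_taylor d by metis
  note int = integrable_moll_scaleR[OF f d] integrable_moll_grad_scaleR[OF f d]
  show ?thesis
  proof (rule GDERIV_of_quadratic_error)
    show "0 \<le> C * (LINT y|lebesgue. \<bar>f y\<bar>)"
      using C by simp
    fix h :: 'a assume h: "norm h \<le> 1"
    let ?D = "\<lambda>y. (moll d (x - y + h) - moll d (x - y) - h \<bullet> moll_grad d (x - y)) * f y"
    have "?D = (\<lambda>y. moll d (x + h - y) *\<^sub>R f y - moll d (x - y) *\<^sub>R f y - h \<bullet> (f y *\<^sub>R moll_grad d (x - y)))"
      by (simp add: algebra_simps)
    moreover have "integrable lebesgue (\<lambda>y. h \<bullet> (f y *\<^sub>R moll_grad d (x - y)))"
      "h \<bullet> (LINT y|lebesgue. f y *\<^sub>R moll_grad d (x - y)) = (LINT y|lebesgue. h \<bullet> (f y *\<^sub>R moll_grad d (x - y)))"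
      using int(2)[of x] by (auto simp del: inner_scaleR_right)
    ultimately have "mollify d f (x + h) - mollify d f x - h \<bullet> (LINT y|lebesgue. f y *\<^sub>R moll_grad d (x - y)) = integral\<^sup>L lebesgue ?D"
        and "integrable lebesgue ?D"
      using int(1)[of "x + h"] int(1)[of x] by (simp_all add: mollify_def del: inner_scaleR_right real_scaleR_def)
    then have "\<bar>mollify d f (x + h) - mollify d f x - h \<bullet> (LINT y|lebesgue. f y *\<^sub>R moll_grad d (x - y))\<bar>
        \<le> (LINT y|lebesgue. \<bar>?D y\<bar>)"
      using integral_norm_bound[of lebesgue ?D] by simp
    also have "\<dots> \<le> (LINT y|lebesgue. C * (norm h)\<^sup>2 * \<bar>f y\<bar>)"
      using \<open>integrable lebesgue ?D\<close> f C(2)[OF h]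
      by (intro integral_mono integrable_abs) (auto simp: abs_mult intro!: mult_right_mono)
    finally show "\<bar>mollify d f (x + h) - mollify d f x - h \<bullet> (LINT y|lebesgue. f y *\<^sub>R moll_grad d (x - y))\<bar>
        \<le> C * (LINT y|lebesgue. \<bar>f y\<bar>) * (norm h)\<^sup>2"
      by (simp add: mult.assoc mult.commute[of "(norm h)\<^sup>2"])
  qed
qed

lemma continuous_on_mollify_gradient:
  fixes f :: "'a::euclidean_space \<Rightarrow> real"
  assumes f: "integrable lebesgue f" and d: "0 < d"
  shows "continuous_on UNIV (\<lambda>x. LINT y|lebesgue. f y *\<^sub>R moll_grad d (x - y))"
  unfolding continuous_on_eq_continuous_at[OF open_UNIV] continuous_at_sequentially o_def
proof (intro ballI allI impI)
  fix x :: 'a and X assume X: "X \<longlonglongrightarrow> x"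
  obtain C where C: "0 \<le> C" "\<And>x :: 'a. norm (moll_grad d x) \<le> C"
    using moll_bounded \<open>0 < d\<close> by metis
  have [measurable]: "f \<in> borel_measurable lebesgue"
    using f by auto
  show "(\<lambda>n. LINT y|lebesgue. f y *\<^sub>R moll_grad d (X n - y)) \<longlonglongrightarrow> (LINT y|lebesgue. f y *\<^sub>R moll_grad d (x - y))"
  proof (rule integral_dominated_convergence)
    show "integrable lebesgue (\<lambda>y. C * \<bar>f y\<bar>)"
      using f by simp
    show "AE y in lebesgue. (\<lambda>n. f y *\<^sub>R moll_grad d (X n - y)) \<longlonglongrightarrow> f y *\<^sub>R moll_grad d (x - y)"
      using continuous_on_moll_grad[of UNIV d] X
      by (intro AE_I2 tendsto_intros continuous_on_tendsto_compose[of UNIV "moll_grad d"]) auto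
    show "AE y in lebesgue. norm (f y *\<^sub>R moll_grad d (X n - y)) \<le> C * \<bar>f y\<bar>" for n
      using C by (intro AE_I2) (auto simp: mult.commute[of C] intro!: mult_left_mono)
  qed measurable
qed

section \<open>Convergence of mollifications in L^p\<close>

lemma nn_integral_moll: "0 < d \<Longrightarrow> (\<integral>\<^sup>+y. ennreal (moll d (y::'a::euclidean_space)) \<partial>lborel) = 1"
  using nn_integral_eq_integral[OF integrable_moll[of d, where 'a = 'a] AE_I2[OF moll_nonneg]] integral_moll[of d, where 'a = 'a]
  by simp

lemma prob_space_moll: "0 < d \<Longrightarrow> prob_space (density lborel (\<lambda>y::'a::euclidean_space. ennreal (moll d y)))"
  by (intro prob_spaceI) (simp add: emeasure_density nn_integral_moll)

text \<open>Substitute \<open>x - y\<close> for \<open>y\<close> and use that the mollifier has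
  integral 1: the error becomes an average of translation errors of \<open>f\<close>.\<close>

lemma mollify_minus_eq:
  fixes f :: "'a::euclidean_space \<Rightarrow> 'b::euclidean_space"
  assumes f: "integrable lborel f" and d: "0 < d"
  shows "integrable lborel (\<lambda>y. moll d y *\<^sub>R (f (x - y) - f x))"
    and "mollify d f x - f x = (LINT y|lborel. moll d y *\<^sub>R (f (x - y) - f x))"
proof -
  have [measurable]: "f \<in> borel_measurable borel"
    using f by auto
  have "integrable lebesgue f"
    using f by (simp add: integrable_completion)
  from integrable_moll_scaleR[OF this d]
  have "integrable lborel (\<lambda>y. moll d (x - y) *\<^sub>R f y)"
    by (subst (asm) integrable_completion) auto
  then have int: "integrable lborel (\<lambda>y. moll d y *\<^sub>R f (x - y))"
    using integrable_lborel_reflect[of "\<lambda>y. moll d y *\<^sub>R f (x - y)" x] by simp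
  have int2: "integrable lborel (\<lambda>y::'a. moll d y *\<^sub>R f x)"
    using integrable_moll by (intro integrable_scaleR_left)
  have "mollify d f x = (LINT y|lborel. moll d (x - y) *\<^sub>R f y)"
    unfolding mollify_def by (rule integral_completion) measurable
  also have "\<dots> = (LINT y|lborel. moll d y *\<^sub>R f (x - y))"
    using lborel_integral_reflect[of "\<lambda>y. moll d y *\<^sub>R f (x - y)" x] by simp
  finally have "mollify d f x = \<dots>" .
  moreover have "f x = (LINT y|lborel. moll d (y::'a) *\<^sub>R f x)"
    using integrable_moll[of d, where 'a = 'a] integral_moll[OF d, where 'a = 'a] by simp
  ultimately show "mollify d f x - f x = (LINT y|lborel. moll d y *\<^sub>R (f (x - y) - f x))"
    using int int2 by (simp add: scaleR_diff_right)
  show "integrable lborel (\<lambda>y. moll d y *\<^sub>R (f (x - y) - f x))"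
    using int int2 by (simp add: scaleR_diff_right)
qed

text \<open>Jensen's inequality for the probability measure with density
  \<open>moll d\<close>.\<close>

lemma norm_mollify_minus_powr_le:
  fixes f :: "'a::euclidean_space \<Rightarrow> 'b::euclidean_space"
  assumes f: "integrable lborel f" and d: "0 < d" and p: "1 \<le> p"
  shows "ennreal (norm (mollify d f x - f x) powr p) \<le>
    (\<integral>\<^sup>+y. ennreal (moll d y) * ennreal (norm (f (x - y) - f x) powr p) \<partial>lborel)"
proof -
  have [measurable]: "f \<in> borel_measurable borel"
    using f by auto
  let ?P = "density lborel (\<lambda>y::'a. ennreal (moll d y))"
  interpret P: prob_space ?P
    using d by (rule prob_space_moll)
  have "norm (mollify d f x - f x) \<le> (LINT y|lborel. norm (moll d y *\<^sub>R (f (x - y) - f x)))"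
    unfolding mollify_minus_eq(2)[OF f d] by (rule integral_norm_bound)
  also have "\<dots> = (LINT y|?P. norm (f (x - y) - f x))"
    by (subst integral_density) (auto simp: moll_nonneg)
  finally have "ennreal (norm (mollify d f x - f x) powr p) \<le> ennreal ((LINT y|?P. norm (f (x - y) - f x)) powr p)"
    using p by (intro ennreal_leI powr_mono2) auto
  also have "\<dots> \<le> (\<integral>\<^sup>+y. ennreal (norm (f (x - y) - f x) powr p) \<partial>?P)"
    using p by (intro P.powr_expectation_le) auto
  also have "\<dots> = (\<integral>\<^sup>+y. ennreal (moll d y) * ennreal (norm (f (x - y) - f x) powr p) \<partial>lborel)"
    by (subst nn_integral_density) auto
  finally show ?thesis .
qed

text \<open>After Jensen, Tonelli exchanges the integrals: the error is at most an average over
  \<open>y\<close> of translation errors, and only \<open>norm y < d\<close> carries weight. All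
  integrals are extended, so finiteness of the left-hand side can be deduced from a finite
  \<open>e\<close>.\<close>

lemma nn_integral_mollify_minus_le:
  fixes f :: "'a::euclidean_space \<Rightarrow> 'b::euclidean_space"
  assumes f: "integrable lborel f" and d: "0 < d" and p: "1 \<le> p"
    and e: "\<And>y. norm y < d \<Longrightarrow> (\<integral>\<^sup>+x. ennreal (norm (f (x - y) - f x) powr p) \<partial>lborel) \<le> e"
  shows "(\<integral>\<^sup>+x. ennreal (norm (mollify d f x - f x) powr p) \<partial>lborel) \<le> e"
proof -
  have [measurable]: "f \<in> borel_measurable borel"
    using f by auto
  have "(\<integral>\<^sup>+x. ennreal (norm (mollify d f x - f x) powr p) \<partial>lborel) \<le>
      (\<integral>\<^sup>+x. \<integral>\<^sup>+y. ennreal (moll d y) * ennreal (norm (f (x - y) - f x) powr p) \<partial>lborel \<partial>lborel)"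
    by (intro nn_integral_mono norm_mollify_minus_powr_le[OF f d p])
  also have "\<dots> = (\<integral>\<^sup>+y. \<integral>\<^sup>+x. ennreal (moll d y) * ennreal (norm (f (x - y) - f x) powr p) \<partial>lborel \<partial>lborel)"
    by (rule lborel_pair.Fubini'[symmetric]) measurable
  also have "\<dots> = (\<integral>\<^sup>+y. ennreal (moll d y) * (\<integral>\<^sup>+x. ennreal (norm (f (x - y) - f x) powr p) \<partial>lborel) \<partial>lborel)"
    by (intro nn_integral_cong nn_integral_cmult) measurable
  also have "\<dots> \<le> (\<integral>\<^sup>+y. ennreal (moll d (y::'a)) * e \<partial>lborel)"
  proof (rule nn_integral_mono)
    fix y :: 'a
    show "ennreal (moll d y) * (\<integral>\<^sup>+x. ennreal (norm (f (x - y) - f x) powr p) \<partial>lborel) \<le> ennreal (moll d y) * e"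
      using e[of y] d moll_eq_0[of d y] by (cases "norm y < d") (auto intro!: mult_left_mono)
  qed
  also have "\<dots> = (\<integral>\<^sup>+y. ennreal (moll d (y::'a)) \<partial>lborel) * e"
    by (rule nn_integral_multc) measurable
  also have "\<dots> = e"
    using d by (simp add: nn_integral_moll)
  finally show ?thesis .
qed

lemma mollify_measurable:
  fixes f :: "'a::euclidean_space \<Rightarrow> 'b::euclidean_space"
  assumes [measurable]: "f \<in> borel_measurable borel"
  shows "mollify d f \<in> borel_measurable borel"
proof -
  have "mollify d f = (\<lambda>x. LINT y|lborel. moll d (x - y) *\<^sub>R f y)"
    unfolding mollify_def by (intro ext integral_completion) measurable
  also have "\<dots> \<in> borel_measurable borel"
    by measurable
  finally show ?thesis .
qed

lemma mollify_tendsto_Lp_lborel: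
  fixes f :: "'a::euclidean_space \<Rightarrow> 'b::euclidean_space"
  assumes f: "integrable lborel f" "integrable lborel (\<lambda>x. norm (f x) powr p)" and p: "1 \<le> p"
    and D: "\<And>n. 0 < D n" "D \<longlonglongrightarrow> 0"
  shows "integrable lborel (\<lambda>x. norm (mollify (D n) f x - f x) powr p)"
    and "(\<lambda>n. LINT x|lborel. norm (mollify (D n) f x - f x) powr p) \<longlonglongrightarrow> 0"
proof -
  have [measurable]: "f \<in> borel_measurable borel"
    using f by auto
  then have [measurable]: "mollify d f \<in> borel_measurable borel" for d
    by (rule mollify_measurable)
  have intT: "integrable lborel (\<lambda>x. norm (f (x - y) - f x) powr p)" for y
    using integrable_lborel_translation(2)[OF f(2), of y] f p by (intro integrable_norm_diff_powr) auto
  define T where "T y = (LINT x|lborel. norm (f (x - y) - f x) powr p)" for y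
  have T: "(\<integral>\<^sup>+x. ennreal (norm (f (x - y) - f x) powr p) \<partial>lborel) = ennreal (T y)" for y
    unfolding T_def using intT by (intro nn_integral_eq_integral) auto
  \<comment> \<open>This bound, uniform in \<open>y\<close>, is what makes the mollification error
    integrable.\<close>
  have Tle: "T y \<le> 2 powr p * (2 * (LINT x|lborel. norm (f x) powr p))" for y
  proof -
    have "T y \<le> (LINT x|lborel. 2 powr p * (norm (f (x - y)) powr p + norm (f x) powr p))"
      unfolding T_def using intT f(2) p integrable_lborel_translation(2)[OF f(2), of y]
      by (intro integral_mono norm_diff_powr_le) auto
    also have "\<dots> = 2 powr p * (2 * (LINT x|lborel. norm (f x) powr p))"
      using f(2) integrable_lborel_translation(2,4)[OF f(2), of y] by simp
    finally show ?thesis .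
  qed
  have le: "(\<integral>\<^sup>+x. ennreal (norm (mollify (D n) f x - f x) powr p) \<partial>lborel) \<le> ennreal e"
    if "\<And>y. norm y < D n \<Longrightarrow> T y \<le> e" for n e
    using that f D p by (intro nn_integral_mollify_minus_le) (auto simp: T ennreal_leI)
  show int: "integrable lborel (\<lambda>x. norm (mollify (D n) f x - f x) powr p)" for n
    using order_le_less_trans[OF le[OF Tle] ennreal_less_top] by (intro integrableI_nonneg) auto
  \<comment> \<open>Continuity of translations in L^p; since \<open>T 0 = 0\<close>, it makes
    \<open>T\<close> small for all short shifts at once.\<close>
  have "isCont T 0"
    unfolding continuous_at_sequentially
  proof (intro allI impI)
    fix Y :: "nat \<Rightarrow> 'a" assume "Y \<longlonglongrightarrow> 0"
    then show "(T \<circ> Y) \<longlonglongrightarrow> T 0"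
      using Lp_translation_continuous[OF f p] by (simp add: T_def o_def)
  qed
  then have T0: "(T \<longlongrightarrow> 0) (nhds 0)"
    by (simp add: T_def isCont_def continuous_at tendsto_nhds_iff)
  show "(\<lambda>n. LINT x|lborel. norm (mollify (D n) f x - f x) powr p) \<longlonglongrightarrow> 0"
  proof (rule tendstoI)
    fix e :: real assume "0 < e"
    then have "\<forall>\<^sub>F y in nhds 0. T y < e / 2"
      using order_tendstoD(2)[OF T0, of "e / 2"] by simp
    then obtain d where d: "0 < d" "\<And>y. norm y < d \<Longrightarrow> T y < e / 2"
      by (auto simp: eventually_nhds_metric)
    have "\<forall>\<^sub>F n in sequentially. D n < d"
      using D(2) d(1) by (rule order_tendstoD)
    then show "\<forall>\<^sub>F n in sequentially. dist (LINT x|lborel. norm (mollify (D n) f x - f x) powr p) 0 < e"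
    proof eventually_elim
      case (elim n)
      have "ennreal (LINT x|lborel. norm (mollify (D n) f x - f x) powr p) \<le> ennreal (e / 2)"
      proof (subst nn_integral_eq_integral[symmetric])
        show "(\<integral>\<^sup>+x. ennreal (norm (mollify (D n) f x - f x) powr p) \<partial>lborel) \<le> ennreal (e / 2)"
        proof (rule le)
          fix y :: 'a assume "norm y < D n"
          then show "T y \<le> e / 2"
            using d(2)[of y] elim by simp
        qed
      qed (use int in auto)
      then have "(LINT x|lborel. norm (mollify (D n) f x - f x) powr p) \<le> e / 2"
        using \<open>0 < e\<close> by simp
      then show ?case
        using \<open>0 < e\<close> by (simp add: dist_real_def)
    qed
  qed
qed

text \<open>Pass to a Borel representative \<open>g\<close> of \<open>f\<close>: it has the same
  mollification at every point, since the defining integral ignores null sets.\<close>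

theorem mollify_tendsto_Lp:
  fixes f :: "'a::euclidean_space \<Rightarrow> 'b::euclidean_space"
  assumes f: "integrable lebesgue f" "integrable lebesgue (\<lambda>x. norm (f x) powr p)" and p: "1 \<le> p"
    and D: "\<And>n. 0 < D n" "D \<longlonglongrightarrow> 0"
  shows "\<And>n. mollify (D n) f \<in> borel_measurable lebesgue"
    and "\<And>n. integrable lebesgue (\<lambda>x. norm (mollify (D n) f x - f x) powr p)"
    and "(\<lambda>n. LINT x|lebesgue. norm (mollify (D n) f x - f x) powr p) \<longlonglongrightarrow> 0"
proof -
  have fm [measurable]: "f \<in> borel_measurable lebesgue"
    using f by auto
  then obtain g where g0 [measurable]: "g \<in> borel_measurable borel" and fg: "AE x in lebesgue. f x = g x"
    by (rule lebesgue_measurable_borel_representative)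
  have gm [measurable]: "g \<in> borel_measurable lebesgue"
    by (rule measurable_completion) measurable
  have "AE x in lebesgue. norm (f x) powr p = norm (g x) powr p"
    using fg by eventually_elim simp
  then have "integrable lebesgue g" "integrable lebesgue (\<lambda>x. norm (g x) powr p)"
    using f fg integrable_cong_AE[of f lebesgue g]
      integrable_cong_AE[of "\<lambda>x. norm (f x) powr p" lebesgue "\<lambda>x. norm (g x) powr p"]
    by auto
  then have g: "integrable lborel g" "integrable lborel (\<lambda>x. norm (g x) powr p)"
    using integrable_completion[of g lborel] integrable_completion[of "\<lambda>x. norm (g x) powr p" lborel] by simp_all
  have eq: "mollify d f = mollify d g" for d
    unfolding mollify_def using fg by (intro ext integral_cong_AE) auto
  have mm: "mollify d g \<in> borel_measurable lborel" for d
    using mollify_measurable[OF g0] by simp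
  then have mm' [measurable]: "mollify d g \<in> borel_measurable lebesgue" for d
    by (rule measurable_completion)
  then show "\<And>n. mollify (D n) f \<in> borel_measurable lebesgue"
    by (simp add: eq)
  have [measurable]: "(\<lambda>x. norm (mollify d g x - g x) powr p) \<in> borel_measurable lborel" for d
    using mm[of d] by measurable
  have *: "AE x in lebesgue. norm (mollify (D n) f x - f x) powr p = norm (mollify (D n) g x - g x) powr p" for n
    using fg by eventually_elim (simp add: eq)
  note L = mollify_tendsto_Lp_lborel[OF g p D]
  show "\<And>n. integrable lebesgue (\<lambda>x. norm (mollify (D n) f x - f x) powr p)"
    using L(1) by (subst integrable_cong_AE[OF _ _ *]) (auto simp: eq integrable_completion)
  have "(LINT x|lebesgue. norm (mollify (D n) f x - f x) powr p) = (LINT x|lborel. norm (mollify (D n) g x - g x) powr p)" for n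
    by (subst integral_cong_AE[OF _ _ *]) (auto simp: eq integral_completion)
  then show "(\<lambda>n. LINT x|lebesgue. norm (mollify (D n) f x - f x) powr p) \<longlonglongrightarrow> 0"
    using L(2) by simp
qed

section \<open>Weak gradients\<close>

lemma continuous_imp_measurable_lebesgue_on:
  fixes f :: "'a::euclidean_space \<Rightarrow> 'b::euclidean_space"
  assumes "continuous_on UNIV f"
  shows "f \<in> borel_measurable (lebesgue_on S)"
proof -
  have "f \<in> borel_measurable lborel"
    using assms by (simp add: borel_measurable_continuous_onI)
  then show ?thesis
    by (intro measurable_restrict_space1 measurable_completion)
qed

text \<open>Completeness of Lebesgue measure. It makes the arbitrarily chosen
  \<open>weak_gradient\<close> measurable as soon as some weak gradient is.\<close>

lemma measurable_lebesgue_on_AE: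
  fixes f g :: "'a::euclidean_space \<Rightarrow> 'b::euclidean_space"
  assumes S: "S \<in> sets lebesgue" and f: "f \<in> borel_measurable (lebesgue_on S)"
    and ae: "AE x in lebesgue_on S. f x = g x"
  shows "g \<in> borel_measurable (lebesgue_on S)"
proof -
  have "AE x in lebesgue. (if x \<in> S then f x else 0) = (if x \<in> S then g x else 0)"
    using ae S by (subst (asm) AE_restrict_space_iff) auto
  then show ?thesis
    using borel_measurable_AE[of "\<lambda>x. if x \<in> S then f x else 0" "\<lambda>x. if x \<in> S then g x else 0"] f
    by (simp add: borel_measurable_if[OF S])
qed

lemma integrable_lebesgue_on_AE:
  fixes f g :: "'a::euclidean_space \<Rightarrow> 'b::euclidean_space"
  assumes S: "S \<in> sets lebesgue" and f: "integrable (lebesgue_on S) f"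
    and ae: "AE x in lebesgue_on S. f x = g x"
  shows "integrable (lebesgue_on S) g"
  using f measurable_lebesgue_on_AE[OF S _ ae] ae by (intro integrable_cong_AE_imp[OF f]) auto

lemma AE_lebesgue_on_subset:
  assumes "AE x in lebesgue_on T. P x" "S \<subseteq> T" "S \<in> sets lebesgue" "T \<in> sets lebesgue"
  shows "AE x in lebesgue_on S. P x"
proof -
  have "AE x in lebesgue. x \<in> T \<longrightarrow> P x"
    using assms by (simp add: AE_restrict_space_iff)
  then have "AE x in lebesgue. x \<in> S \<longrightarrow> P x"
    by eventually_elim (use assms(2) in auto)
  then show ?thesis
    using assms by (simp add: AE_restrict_space_iff)
qed

lemma integrable_lebesgue_on_subset:
  fixes f :: "'a::euclidean_space \<Rightarrow> 'b::euclidean_space"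
  assumes "integrable (lebesgue_on T) f" "S \<subseteq> T" "S \<in> sets lebesgue" "T \<in> sets lebesgue"
  shows "integrable (lebesgue_on S) f"
proof -
  have "set_integrable lebesgue T f"
    using assms integrable_restrict_space[of T lebesgue f] by (simp add: set_integrable_def)
  then have "set_integrable lebesgue S f"
    using assms by (intro set_integrable_subset[of lebesgue T f S]) auto
  then show ?thesis
    using assms integrable_restrict_space[of S lebesgue f] by (simp add: set_integrable_def)
qed

lemma tendsto_integral_L1:
  fixes f :: "nat \<Rightarrow> 'a \<Rightarrow> 'b::euclidean_space"
  assumes f: "\<And>n. integrable M (f n)" "integrable M g"
    and le: "\<And>n x. x \<in> space M \<Longrightarrow> norm (f n x - g x) \<le> B * h n x"
    and h: "\<And>n. integrable M (h n)" "(\<lambda>n. integral\<^sup>L M (h n)) \<longlonglongrightarrow> 0"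
  shows "(\<lambda>n. integral\<^sup>L M (f n)) \<longlonglongrightarrow> integral\<^sup>L M g"
proof -
  have "norm (integral\<^sup>L M (f n) - integral\<^sup>L M g) \<le> B * integral\<^sup>L M (h n)" for n
  proof -
    have "norm (integral\<^sup>L M (f n) - integral\<^sup>L M g) = norm (LINT x|M. f n x - g x)"
      using f by simp
    also have "\<dots> \<le> (LINT x|M. norm (f n x - g x))"
      by (rule integral_norm_bound)
    also have "\<dots> \<le> (LINT x|M. B * h n x)"
      using f h le by (intro integral_mono) auto
    finally show ?thesis by simp
  qed
  then have "\<forall>\<^sub>F n in sequentially. norm (integral\<^sup>L M (f n) - integral\<^sup>L M g) \<le> B * integral\<^sup>L M (h n)"
    by simp
  moreover have "(\<lambda>n. B * integral\<^sup>L M (h n)) \<longlonglongrightarrow> 0"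
    using tendsto_mult_left[OF h(2), of B] by simp
  ultimately have "(\<lambda>n. integral\<^sup>L M (f n) - integral\<^sup>L M g) \<longlonglongrightarrow> 0"
    by (rule Lim_null_comparison)
  then show ?thesis
    by (rule LIM_zero_cancel)
qed

lemma GDERIV_unique:
  assumes "GDERIV f x :> G" "GDERIV f x :> G'"
  shows "G = G'"
proof -
  have "(\<lambda>h. h \<bullet> G) = (\<lambda>h. h \<bullet> G')"
    using assms unfolding gderiv_def by (rule has_derivative_unique)
  then have "(G - G') \<bullet> G = (G - G') \<bullet> G'"
    by (rule fun_cong)
  then have "(G - G') \<bullet> (G - G') = 0"
    by (simp add: inner_diff_right)
  then show ?thesis
    by simp
qed

lemma GDERIV_imp_continuous_on:
  assumes "\<And>x. GDERIV f x :> G x"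
  shows "continuous_on S f"
proof (rule continuous_at_imp_continuous_on, rule ballI)
  show "isCont f x" for x
    using assms[of x] unfolding gderiv_def by (rule has_derivative_continuous)
qed

lemma GDERIV_outside_support:
  assumes "GDERIV f x :> G" "x \<notin> closure {x. f x \<noteq> 0}"
  shows "G = 0"
proof -
  have "((\<lambda>x. 0) has_derivative (\<lambda>h. h \<bullet> G)) (at x)"
    using assms(1) unfolding gderiv_def
  proof (rule has_derivative_transform_within_open)
    show "open (- closure {x. f x \<noteq> 0})" "x \<in> - closure {x. f x \<noteq> 0}"
      using assms by auto
    show "f y = 0" if "y \<in> - closure {x. f x \<noteq> 0}" for y
      using that closure_subset[of "{x. f x \<noteq> 0}"] by auto
  qed
  then have "GDERIV (\<lambda>x. 0::real) x :> G"
    by (simp add: gderiv_def)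
  then show ?thesis
    using GDERIV_const GDERIV_unique by blast
qed

text \<open>Difference quotients of \<open>f\<close> along a coordinate direction integrate to 0 by
  translation invariance and converge to the partial derivative. They are dominated because
  \<open>f\<close> is Lipschitz with compact support. Integration by parts below rests on
  this.\<close>

lemma integral_gradient_eq_0:
  fixes f :: "'a::euclidean_space \<Rightarrow> real"
  assumes G: "\<And>x. GDERIV f x :> G x" "continuous_on UNIV G"
    and K: "compact K" "{x. f x \<noteq> 0} \<subseteq> K"
  shows "integrable lborel G" "(LINT x|lborel. G x) = 0"
proof -
  have f0: "f x = 0" if "x \<notin> K" for x
    using K(2) that by blast
  have cl: "closure {x. f x \<noteq> 0} \<subseteq> K"
    using K by (simp add: closure_minimal compact_imp_closed)
  then have G0: "G x = 0" if "x \<notin> K" for x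
    using that GDERIV_outside_support[OF G(1), of x] by auto
  have "bounded (G ` K)"
    using K G(2) by (intro compact_imp_bounded compact_continuous_image) (auto intro: continuous_on_subset)
  then obtain B where B: "0 < B" "\<And>x. x \<in> K \<Longrightarrow> norm (G x) \<le> B"
    by (auto simp: bounded_pos)
  then have B': "norm (G x) \<le> B" for x
    using G0[of x] by (cases "x \<in> K") auto
  obtain R where R: "\<And>x. x \<in> K \<Longrightarrow> norm x \<le> R"
    using compact_imp_bounded[OF K(1)] by (auto simp: bounded_iff)
  have [measurable]: "G \<in> borel_measurable borel" "f \<in> borel_measurable borel"
    using G GDERIV_imp_continuous_on[OF G(1)] by (auto intro: borel_measurable_continuous_onI)
  have intI: "integrable lborel (\<lambda>x::'a. C * indicat_real (cball 0 r) x)" for C r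
    using emeasure_lborel_cball_finite by (intro integrable_mult_right) (auto simp: integrable_indicator_iff)
  have far: "f x = 0" "G x = 0" if "R < norm x" for x
    using R[of x] f0[of x] G0[of x] that by auto
  show intG: "integrable lborel G"
    by (rule integrable_lborel_bounded_support[of _ B R]) (auto simp: B' far)
  have "bounded (f ` K)"
    using K GDERIV_imp_continuous_on[OF G(1)] by (intro compact_imp_bounded compact_continuous_image)
  then obtain C where C: "0 < C" "\<And>x. x \<in> K \<Longrightarrow> norm (f x) \<le> C"
    by (auto simp: bounded_pos)
  then have "norm (f x) \<le> C" for x
    using f0[of x] by (cases "x \<in> K") auto
  then have intf: "integrable lborel f"
    by (rule integrable_lborel_bounded_support[of _ C R, rotated]) (auto simp: far)
  have lip: "\<bar>f y - f x\<bar> \<le> B * norm (y - x)" for x y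
  proof -
    have "norm (f y - f x) \<le> B * norm (y - x)"
    proof (rule differentiable_bound[of UNIV])
      show "(f has_derivative (\<lambda>h. h \<bullet> G x)) (at x within UNIV)" for x
        using G(1)[of x] by (simp add: gderiv_def)
      show "onorm (\<lambda>h. h \<bullet> G x) \<le> B" for x
      proof (rule onorm_bound)
        show "norm (h \<bullet> G x) \<le> B * norm h" for h
          using Cauchy_Schwarz_ineq2[of h "G x"] B'[of x] mult_left_mono[of "norm (G x)" B "norm h"]
          by (simp add: mult.commute)
      qed (use B in simp)
    qed auto
    then show ?thesis by simp
  qed
  have "(LINT x|lborel. G x) \<bullet> b = 0" if b: "b \<in> Basis" for b
  proof -
    \<comment> \<open>Steps of length at most 1 confine all difference quotients to the ball of
      radius \<open>R + 1\<close>.\<close>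
    define t where "t = (\<lambda>n. inverse (real (Suc n)))"
    have t: "0 < t n" "t n \<le> 1" "t \<longlonglongrightarrow> 0" for n
      using LIMSEQ_inverse_real_of_nat by (simp_all add: t_def inverse_le_1_iff)
    let ?D = "\<lambda>n x. (f (x + t n *\<^sub>R b) - f x) / t n"
    have "(\<lambda>n. LINT x|lborel. ?D n x) \<longlonglongrightarrow> (LINT x|lborel. b \<bullet> G x)"
    proof (rule integral_dominated_convergence[OF _ _ intI[of B "R + 1"]])
      show "AE x in lborel. (\<lambda>n. ?D n x) \<longlonglongrightarrow> b \<bullet> G x"
      proof (rule AE_I2)
        fix x
        have "((\<lambda>s. x + s *\<^sub>R b) has_derivative (\<lambda>s. s *\<^sub>R b)) (at 0)"
          by (auto intro!: derivative_eq_intros)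
        then have "((\<lambda>s. f (x + s *\<^sub>R b)) has_derivative (\<lambda>s. (s *\<^sub>R b) \<bullet> G x)) (at 0)"
          by (rule has_derivative_compose) (use G(1)[of x] in \<open>simp add: gderiv_def\<close>)
        then have "((\<lambda>s. f (x + s *\<^sub>R b)) has_real_derivative (b \<bullet> G x)) (at 0)"
          by (simp add: has_field_derivative_def mult.commute[of _ "b \<bullet> G x"] mult_commute_abs)
        then have "((\<lambda>s. (f (x + s *\<^sub>R b) - f x) / s) \<longlongrightarrow> b \<bullet> G x) (at 0)"
          by (simp add: DERIV_def)
        moreover have "filterlim t (at 0) sequentially"
          using t(1,3) by (auto simp: filterlim_at less_imp_neq[THEN not_sym])
        ultimately show "(\<lambda>n. ?D n x) \<longlonglongrightarrow> b \<bullet> G x"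
          by (rule filterlim_compose)
      qed
      show "AE x in lborel. norm (?D n x) \<le> B * indicat_real (cball 0 (R + 1)) x" for n
      proof (rule AE_I2)
        fix x
        show "norm (?D n x) \<le> B * indicat_real (cball 0 (R + 1)) x"
        proof (cases "norm x \<le> R + 1")
          case True
          have "\<bar>f (x + t n *\<^sub>R b) - f x\<bar> \<le> B * t n"
            using lip[of "x + t n *\<^sub>R b" x] t(1)[of n] b by simp
          then show ?thesis
            using True t(1)[of n] by (simp add: divide_le_eq)
        next
          case False
          have "norm x \<le> norm (x + t n *\<^sub>R b) + norm (t n *\<^sub>R b)"
            using norm_triangle_ineq4[of "x + t n *\<^sub>R b" "t n *\<^sub>R b"] by simp
          then have "R < norm (x + t n *\<^sub>R b)" "R < norm x"
            using False t(1,2)[of n] b by auto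
          then show ?thesis
            using False far(1) by simp
        qed
      qed
    qed measurable
    moreover have "(LINT x|lborel. ?D n x) = 0" for n
      using integrable_lborel_translation(1,3)[OF intf, of "t n *\<^sub>R b"] intf by simp
    ultimately have "(\<lambda>n. 0 :: real) \<longlonglongrightarrow> (LINT x|lborel. b \<bullet> G x)"
      by (simp only:)
    then have "(LINT x|lborel. b \<bullet> G x) = 0"
      by (simp add: LIMSEQ_const_iff)
    then show ?thesis
      using intG by (simp add: inner_commute)
  qed
  then show "(LINT x|lborel. G x) = 0"
    by (simp add: euclidean_eq_iff[where 'a = 'a])
qed

text \<open>The localisation of \<^const>\<open>has_weak_gradient\<close> to a compact set: unlike the latter it is visibly
  stable under convergence in \<open>L\<^sup>1(K)\<close>.\<close>

definition weak_gradient_within ::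
    "'a::euclidean_space set \<Rightarrow> ('a \<Rightarrow> real) \<Rightarrow> ('a \<Rightarrow> 'a) \<Rightarrow> bool" where
  "weak_gradient_within K u g \<longleftrightarrow> integrable (lebesgue_on K) u \<and> integrable (lebesgue_on K) g \<and>
     (\<forall>\<psi> G. (\<forall>x. GDERIV \<psi> x :> G x) \<and> continuous_on UNIV G \<and> {x. \<psi> x \<noteq> 0} \<subseteq> K \<longrightarrow>
        (LINT x|lebesgue_on K. u x *\<^sub>R G x) = - (LINT x|lebesgue_on K. \<psi> x *\<^sub>R g x))"

lemma weak_gradient_withinD:
  assumes "weak_gradient_within K u g"
  shows "integrable (lebesgue_on K) u" "integrable (lebesgue_on K) g"
    "\<And>\<psi> G. (\<And>x. GDERIV \<psi> x :> G x) \<Longrightarrow> continuous_on UNIV G \<Longrightarrow> {x. \<psi> x \<noteq> 0} \<subseteq> K \<Longrightarrow>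
        (LINT x|lebesgue_on K. u x *\<^sub>R G x) = - (LINT x|lebesgue_on K. \<psi> x *\<^sub>R g x)"
  using assms unfolding weak_gradient_within_def by blast+

lemma compact_sets_lebesgue: "compact K \<Longrightarrow> K \<in> sets lebesgue"
  by (intro sets_completionI_sets) (simp add: borel_compact)

lemma open_sets_lebesgue: "open S \<Longrightarrow> S \<in> sets lebesgue"
  by (intro sets_completionI_sets) simp

text \<open>Off \<open>K\<close> the test function vanishes, and so does its gradient, because the
  complement of the closed support is open.\<close>

lemma C1_compact_integral_eq:
  fixes \<psi> :: "'a::euclidean_space \<Rightarrow> real"
  assumes "open \<Omega>" "compact K" "K \<subseteq> \<Omega>" "{x. \<psi> x \<noteq> 0} \<subseteq> K" "\<And>x. GDERIV \<psi> x :> G x"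
  shows "(LINT x|lebesgue_on \<Omega>. u x *\<^sub>R G x) = (LINT x|lebesgue_on K. u x *\<^sub>R G x)"
    and "(LINT x|lebesgue_on \<Omega>. \<psi> x *\<^sub>R g x) = (LINT x|lebesgue_on K. \<psi> x *\<^sub>R (g x::'a))"
proof -
  have sets: "K \<in> sets lebesgue" "\<Omega> \<in> sets lebesgue"
    using assms by (auto intro: compact_sets_lebesgue open_sets_lebesgue)
  have cl: "closure {x. \<psi> x \<noteq> 0} \<subseteq> K"
    using assms by (simp add: closure_minimal compact_imp_closed)
  have "G x = 0" if "x \<notin> K" for x
    using that cl GDERIV_outside_support[OF assms(5), of x] by auto
  then have 1: "(\<lambda>x. u x *\<^sub>R G x) = (\<lambda>x. if x \<in> K then u x *\<^sub>R G x else 0)"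
    by auto
  show "(LINT x|lebesgue_on \<Omega>. u x *\<^sub>R G x) = (LINT x|lebesgue_on K. u x *\<^sub>R G x)"
    using integral_restrict[OF assms(3) sets, of "\<lambda>x. u x *\<^sub>R G x"] unfolding 1[symmetric] .
  have 2: "(\<lambda>x. \<psi> x *\<^sub>R g x) = (\<lambda>x. if x \<in> K then \<psi> x *\<^sub>R g x else 0)"
    using assms(4) by (intro ext) auto
  show "(LINT x|lebesgue_on \<Omega>. \<psi> x *\<^sub>R g x) = (LINT x|lebesgue_on K. \<psi> x *\<^sub>R g x)"
    using integral_restrict[OF assms(3) sets, of "\<lambda>x. \<psi> x *\<^sub>R g x"] unfolding 2[symmetric] .
qed

lemma C1_compactI:
  assumes G: "\<And>x. GDERIV \<psi> x :> G x" "continuous_on UNIV G"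
    and K: "compact K" "{x. \<psi> x \<noteq> 0} \<subseteq> K" "K \<subseteq> \<Omega>"
  shows "\<psi> \<in> C1_compact \<Omega>"
proof -
  have cl: "closure {x. \<psi> x \<noteq> 0} \<subseteq> K"
    using K by (simp add: closure_minimal compact_imp_closed)
  have "compact (closure {x. \<psi> x \<noteq> 0})"
    using compact_Int_closed[OF K(1) closed_closure] cl by (metis Int_absorb1)
  moreover have "\<exists>G. (\<forall>x. GDERIV \<psi> x :> G x) \<and> continuous_on UNIV G"
    using G by (intro exI[of _ G]) simp
  ultimately show ?thesis
    using cl K(3) unfolding C1_compact_def by blast
qed

lemma has_weak_gradient_iff_within:
  assumes "open \<Omega>"
  shows "has_weak_gradient \<Omega> u g \<longleftrightarrow> (\<forall>K. compact K \<and> K \<subseteq> \<Omega> \<longrightarrow> weak_gradient_within K u g)"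
proof
  assume h: "has_weak_gradient \<Omega> u g"
  show "\<forall>K. compact K \<and> K \<subseteq> \<Omega> \<longrightarrow> weak_gradient_within K u g"
  proof (intro allI impI)
    fix K assume K: "compact K \<and> K \<subseteq> \<Omega>"
    show "weak_gradient_within K u g"
      unfolding weak_gradient_within_def
    proof (intro conjI allI impI)
      show "integrable (lebesgue_on K) u" "integrable (lebesgue_on K) g"
        using h K by (auto simp: has_weak_gradient_def locally_integrable_def)
      fix \<psi> G assume \<psi>: "(\<forall>x. GDERIV \<psi> x :> G x) \<and> continuous_on UNIV G \<and> {x. \<psi> x \<noteq> 0} \<subseteq> K"
      have "\<psi> \<in> C1_compact \<Omega>"
        using \<psi> K by (intro C1_compactI[of \<psi> G K]) auto
      then have "(LINT x|lebesgue_on \<Omega>. u x *\<^sub>R G x) = - (LINT x|lebesgue_on \<Omega>. \<psi> x *\<^sub>R g x)"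
        using h \<psi> by (auto simp: has_weak_gradient_def)
      then show "(LINT x|lebesgue_on K. u x *\<^sub>R G x) = - (LINT x|lebesgue_on K. \<psi> x *\<^sub>R g x)"
        using C1_compact_integral_eq[OF assms, of K \<psi> G] K \<psi> by simp
    qed
  qed
next
  assume h: "\<forall>K. compact K \<and> K \<subseteq> \<Omega> \<longrightarrow> weak_gradient_within K u g"
  show "has_weak_gradient \<Omega> u g"
    unfolding has_weak_gradient_def locally_integrable_def
  proof (intro conjI allI impI ballI)
    show "integrable (lebesgue_on K) u" "integrable (lebesgue_on K) g" if "compact K \<and> K \<subseteq> \<Omega>" for K
      using h that by (auto simp: weak_gradient_within_def)
    fix \<psi> G assume \<psi>: "\<psi> \<in> C1_compact \<Omega>" "\<forall>x. GDERIV \<psi> x :> G x"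
    define K where "K = closure {x. \<psi> x \<noteq> 0}"
    have K: "compact K" "K \<subseteq> \<Omega>" "{x. \<psi> x \<noteq> 0} \<subseteq> K"
      using \<psi> closure_subset[of "{x. \<psi> x \<noteq> 0}"] by (auto simp: C1_compact_def K_def)
    obtain G' where G': "\<And>x. GDERIV \<psi> x :> G' x" "continuous_on UNIV G'"
      using \<psi> by (auto simp: C1_compact_def)
    \<comment> \<open>\<open>has_weak_gradient\<close> quantifies over gradients \<open>G\<close>
      without asking for continuity, which the localised notion requires; uniqueness of the
      classical gradient supplies it.\<close>
    have "G = G'"
      using GDERIV_unique[OF _ G'(1)] \<psi> by auto
    then have "(LINT x|lebesgue_on K. u x *\<^sub>R G x) = - (LINT x|lebesgue_on K. \<psi> x *\<^sub>R g x)"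
      using h K G' by (intro weak_gradient_withinD(3)) auto
    then show "(LINT x|lebesgue_on \<Omega>. u x *\<^sub>R G x) = - (LINT x|lebesgue_on \<Omega>. \<psi> x *\<^sub>R g x)"
      using C1_compact_integral_eq[OF assms K(1,2,3), of G] \<psi> by simp
  qed
qed

lemma continuous_bounded_on_compact:
  fixes f :: "'a::euclidean_space \<Rightarrow> 'b::euclidean_space"
  assumes "compact K" "continuous_on UNIV f"
  obtains B where "0 \<le> B" "\<And>x. x \<in> K \<Longrightarrow> norm (f x) \<le> B"
proof -
  have "bounded (f ` K)"
    using assms by (intro compact_imp_bounded compact_continuous_image) (auto intro: continuous_on_subset)
  then show thesis
    using that by (auto simp: bounded_pos intro: less_imp_le)
qed

lemma finite_measure_lebesgue_on_compact: "compact K \<Longrightarrow> finite_measure (lebesgue_on K)"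
  by (intro finite_measure_lebesgue_on lmeasurable_compact)

lemma integrable_continuous_compact:
  fixes f :: "'a::euclidean_space \<Rightarrow> 'b::euclidean_space"
  assumes "compact K" "continuous_on UNIV f"
  shows "integrable (lebesgue_on K) f"
proof -
  interpret finite_measure "lebesgue_on K"
    using assms(1) by (rule finite_measure_lebesgue_on_compact)
  obtain B where "\<And>x. x \<in> K \<Longrightarrow> norm (f x) \<le> B"
    using continuous_bounded_on_compact assms by metis
  then show ?thesis
    using continuous_imp_measurable_lebesgue_on[OF assms(2)] by (intro integrable_const_bound[of _ B]) auto
qed

text \<open>A test function and its gradient are bounded on \<open>K\<close>, so both sides of the
  identity pass to the limit in L^1(K).\<close>

lemma weak_gradient_within_limit:
  assumes K: "compact K" and ug: "integrable (lebesgue_on K) u" "integrable (lebesgue_on K) g"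
    and UW: "\<And>n. weak_gradient_within K (U n) (W n)"
    and U: "(\<lambda>n. LINT x|lebesgue_on K. norm (U n x - u x)) \<longlonglongrightarrow> 0"
    and W: "(\<lambda>n. LINT x|lebesgue_on K. norm (W n x - g x)) \<longlonglongrightarrow> 0"
  shows "weak_gradient_within K u g"
  unfolding weak_gradient_within_def
proof (intro conjI allI impI ug)
  let ?M = "lebesgue_on K"
  fix \<psi> G assume \<psi>: "(\<forall>x. GDERIV \<psi> x :> G x) \<and> continuous_on UNIV G \<and> {x. \<psi> x \<noteq> 0} \<subseteq> K"
  have cont: "continuous_on UNIV \<psi>" "continuous_on UNIV G"
    using \<psi> GDERIV_imp_continuous_on[of \<psi> G] by auto
  note [measurable] = cont[THEN continuous_imp_measurable_lebesgue_on]
  note UW' = weak_gradient_withinD[OF UW]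
  obtain B where B: "\<And>x. x \<in> K \<Longrightarrow> norm (\<psi> x) \<le> B"
    using continuous_bounded_on_compact[OF K cont(1)] by metis
  obtain C where C: "\<And>x. x \<in> K \<Longrightarrow> norm (G x) \<le> C"
    using continuous_bounded_on_compact[OF K cont(2)] by metis
  have 1: "(\<lambda>n. LINT x|?M. U n x *\<^sub>R G x) \<longlonglongrightarrow> (LINT x|?M. u x *\<^sub>R G x)"
  proof (rule tendsto_integral_L1[OF _ _ _ _ U, of _ _ C])
    show "norm (U n x *\<^sub>R G x - u x *\<^sub>R G x) \<le> C * norm (U n x - u x)" if "x \<in> space ?M" for n x
      using C[of x] that by (simp flip: scaleR_diff_left add: mult.commute[of C] mult_left_mono)
  qed (use C UW' ug in \<open>auto intro!: integrable_scaleR_bounded[of _ _ _ C]\<close>)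
  have 2: "(\<lambda>n. LINT x|?M. \<psi> x *\<^sub>R W n x) \<longlonglongrightarrow> (LINT x|?M. \<psi> x *\<^sub>R g x)"
  proof (rule tendsto_integral_L1[OF _ _ _ _ W, of _ _ B])
    show "norm (\<psi> x *\<^sub>R W n x - \<psi> x *\<^sub>R g x) \<le> B * norm (W n x - g x)" if "x \<in> space ?M" for n x
      using B[of x] that by (simp flip: scaleR_diff_right add: mult_right_mono)
  qed (use B UW' ug in \<open>auto intro!: integrable_bounded_scaleR[of _ _ _ B]\<close>)
  have "(LINT x|?M. U n x *\<^sub>R G x) = - (LINT x|?M. \<psi> x *\<^sub>R W n x)" for n
    using UW'(3) \<psi> by blast
  with 1 have "(\<lambda>n. - (LINT x|?M. \<psi> x *\<^sub>R W n x)) \<longlonglongrightarrow> (LINT x|?M. u x *\<^sub>R G x)"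
    by simp
  moreover have "(\<lambda>n. - (LINT x|?M. \<psi> x *\<^sub>R W n x)) \<longlonglongrightarrow> - (LINT x|?M. \<psi> x *\<^sub>R g x)"
    using 2 by (rule tendsto_minus)
  ultimately show "(LINT x|?M. u x *\<^sub>R G x) = - (LINT x|?M. \<psi> x *\<^sub>R g x)"
    by (rule LIMSEQ_unique)
qed

text \<open>Integration by parts: \<open>U x *\<^sub>R G x + \<psi> x *\<^sub>R W x\<close> is the
  gradient of \<open>U x * \<psi> x\<close>, which vanishes off \<open>K\<close>, and therefore
  integrates to 0.\<close>

lemma weak_gradient_within_C1:
  assumes K: "compact K" and U: "\<And>x. GDERIV U x :> W x" "continuous_on UNIV W"
  shows "weak_gradient_within K U W"
  unfolding weak_gradient_within_def
proof (intro conjI allI impI)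
  let ?M = "lebesgue_on K"
  have contU: "continuous_on UNIV U"
    using U by (intro GDERIV_imp_continuous_on)
  show "integrable ?M U" "integrable ?M W"
    using K U contU by (auto intro: integrable_continuous_compact)
  fix \<psi> G assume \<psi>: "(\<forall>x. GDERIV \<psi> x :> G x) \<and> continuous_on UNIV G \<and> {x. \<psi> x \<noteq> 0} \<subseteq> K"
  have cont: "continuous_on UNIV \<psi>" "continuous_on UNIV G"
    using \<psi> GDERIV_imp_continuous_on[of \<psi> G] by auto
  let ?H = "\<lambda>x. U x *\<^sub>R G x + \<psi> x *\<^sub>R W x"
  have contH: "continuous_on UNIV ?H"
    using cont contU U by (intro continuous_intros)
  have DH: "GDERIV (\<lambda>x. U x * \<psi> x) x :> ?H x" for x
    using \<psi> U by (intro GDERIV_mult) auto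
  have supp: "{x. U x * \<psi> x \<noteq> 0} \<subseteq> K"
    using \<psi> by auto
  have "(LINT x|lborel. ?H x) = 0"
    by (rule integral_gradient_eq_0[OF DH contH K supp])
  then have "(LINT x|lebesgue. ?H x) = 0"
    using contH by (subst integral_completion) (auto intro: borel_measurable_continuous_onI)
  \<comment> \<open>The constant weight 1 brings the integral into the form in which it can be
    restricted from the whole space to \<open>K\<close>.\<close>
  then have "(LINT x|lebesgue_on UNIV. 1 *\<^sub>R ?H x) = 0"
    by (simp add: lebesgue_on_UNIV_eq)
  then have "(LINT x|?M. 1 *\<^sub>R ?H x) = 0"
    using C1_compact_integral_eq(1)[OF open_UNIV K _ supp DH, of "\<lambda>_. 1"] by simp
  moreover have "(LINT x|?M. ?H x) = (LINT x|?M. U x *\<^sub>R G x) + (LINT x|?M. \<psi> x *\<^sub>R W x)"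
    using K contU cont U
    by (intro Bochner_Integration.integral_add integrable_continuous_compact continuous_intros)
  ultimately show "(LINT x|?M. U x *\<^sub>R G x) = - (LINT x|?M. \<psi> x *\<^sub>R W x)"
    by (simp add: eq_neg_iff_add_eq_0)
qed

lemma has_weak_gradient_C1:
  assumes "open \<Omega>" "\<And>x. GDERIV U x :> W x" "continuous_on UNIV W"
  shows "has_weak_gradient \<Omega> U W"
  unfolding has_weak_gradient_iff_within[OF assms(1)]
proof (intro allI impI)
  fix K assume "compact K \<and> K \<subseteq> \<Omega>"
  then show "weak_gradient_within K U W"
    using assms(2,3) by (intro weak_gradient_within_C1) simp_all
qed

section \<open>Approximation by mollification and uniqueness of the weak gradient\<close>

text \<open>The neighbourhood is the sum of \<open>K\<close> and a small closed ball, compact as a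
  sum of compact sets.\<close>

lemma compact_neighbourhood:
  fixes K :: "'a::euclidean_space set"
  assumes "open \<Omega>" "compact K" "K \<subseteq> \<Omega>"
  obtains e K' where "0 < e" "compact K'" "K' \<subseteq> \<Omega>" "\<And>x. x \<in> K \<Longrightarrow> cball x e \<subseteq> K'"
proof -
  obtain r where r: "0 < r" "(\<Union>x\<in>K. ball x r) \<subseteq> \<Omega>"
    using compact_subset_open_imp_ball_epsilon_subset[OF assms(2,1,3)] by metis
  let ?K = "{x + y | x y. x \<in> K \<and> y \<in> cball 0 (r / 2)}"
  show thesis
  proof
    show "0 < r / 2"
      using r by simp
    show "compact ?K"
      using assms(2) by (intro compact_sums) auto
    show "?K \<subseteq> \<Omega>"
    proof
      fix z assume "z \<in> ?K"
      then obtain x y where xy: "z = x + y" "x \<in> K" "norm y \<le> r / 2"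
        by auto
      then have "z \<in> ball x r"
        using r(1) by (simp add: dist_norm)
      then show "z \<in> \<Omega>"
        using r(2) xy(2) by blast
    qed
    show "cball x (r / 2) \<subseteq> ?K" if "x \<in> K" for x
    proof
      fix z assume "z \<in> cball x (r / 2)"
      then have "z = x + (z - x)" "z - x \<in> cball 0 (r / 2)"
        by (auto simp: dist_norm norm_minus_commute)
      then show "z \<in> ?K"
        using that by blast
    qed
  qed
qed

lemma GDERIV_moll_reflect:
  fixes x y :: "'a::euclidean_space"
  assumes "0 < d"
  shows "GDERIV (\<lambda>y. moll d (x - y)) y :> - moll_grad d (x - y)"
proof -
  have "((\<lambda>y. x - y) has_derivative (\<lambda>h. - h)) (at y)"
    by (auto intro!: derivative_eq_intros)
  moreover have "(moll d has_derivative (\<lambda>h. h \<bullet> moll_grad d (x - y))) (at (x - y))"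
    using GDERIV_moll[OF assms] by (simp add: gderiv_def)
  ultimately have "((\<lambda>y. moll d (x - y)) has_derivative (\<lambda>h. (- h) \<bullet> moll_grad d (x - y))) (at y)"
    by (rule has_derivative_compose)
  then show ?thesis
    by (simp add: gderiv_def)
qed

text \<open>The reflected mollifier \<open>\<lambda>y. moll d (x - y)\<close> is itself a test
  function, zero off \<open>cball x d\<close>; the minus sign of its gradient cancels the one in the
  weak identity.\<close>

lemma mollify_gradient_eq:
  assumes wg: "weak_gradient_within K u g" and K: "compact K" and d: "0 < d" "cball x d \<subseteq> K"
  shows "(LINT y|lebesgue. (if y \<in> K then u y else 0) *\<^sub>R moll_grad d (x - y)) =
    mollify d (\<lambda>y. if y \<in> K then g y else 0) x"
proof -
  have "(LINT y|lebesgue_on K. u y *\<^sub>R (- moll_grad d (x - y))) = - (LINT y|lebesgue_on K. moll d (x - y) *\<^sub>R g y)"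
  proof (rule weak_gradient_withinD(3)[OF wg])
    show "GDERIV (\<lambda>y. moll d (x - y)) y :> - moll_grad d (x - y)" for y
      using d(1) by (rule GDERIV_moll_reflect)
    show "continuous_on UNIV (\<lambda>y. - moll_grad d (x - y))"
      by (intro continuous_intros continuous_on_compose2[OF continuous_on_moll_grad[of UNIV]]) auto
    have "moll d (x - y) = 0" if "y \<notin> cball x d" for y
      using that d by (intro moll_eq_0) (auto simp: dist_norm)
    then show "{y. moll d (x - y) \<noteq> 0} \<subseteq> K"
      using d(2) by blast
  qed
  then have "(LINT y|lebesgue_on K. u y *\<^sub>R moll_grad d (x - y)) = (LINT y|lebesgue_on K. moll d (x - y) *\<^sub>R g y)"
    by simp
  moreover have "(\<lambda>y. (if y \<in> K then u y else 0) *\<^sub>R moll_grad d (x - y)) = (\<lambda>y. if y \<in> K then u y *\<^sub>R moll_grad d (x - y) else 0)"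
    "(\<lambda>y. moll d (x - y) *\<^sub>R (if y \<in> K then g y else 0)) = (\<lambda>y. if y \<in> K then moll d (x - y) *\<^sub>R g y else 0)"
    by (intro ext; simp)+
  ultimately show ?thesis
    by (simp only: mollify_def Lebesgue_Measure.integral_restrict_UNIV[OF compact_sets_lebesgue[OF K]])
qed

lemma integral_mollify_minus_powr_tendsto_0:
  fixes f :: "'a::euclidean_space \<Rightarrow> 'b::euclidean_space"
  assumes f: "integrable lebesgue f" "integrable lebesgue (\<lambda>x. norm (f x) powr p)" and p: "1 \<le> p"
    and D: "\<And>n. 0 < D n" "D \<longlonglongrightarrow> 0" and K: "K \<in> sets lebesgue"
    and eq: "\<And>x n. x \<in> K \<Longrightarrow> U n x = mollify (D n) f x" "\<And>x. x \<in> K \<Longrightarrow> u x = f x"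
  shows "(\<lambda>n. LINT x|lebesgue_on K. norm (U n x - u x) powr p) \<longlonglongrightarrow> 0"
proof -
  note M = mollify_tendsto_Lp(2,3)[OF f p D]
  have "(LINT x|lebesgue_on K. norm (U n x - u x) powr p) \<le> (LINT x|lebesgue. norm (mollify (D n) f x - f x) powr p)" for n
  proof -
    have "(LINT x|lebesgue_on K. norm (U n x - u x) powr p) = (LINT x|lebesgue_on K. norm (mollify (D n) f x - f x) powr p)"
      by (intro Bochner_Integration.integral_cong) (auto simp: eq)
    also have "\<dots> \<le> (LINT x|lebesgue_on UNIV. norm (mollify (D n) f x - f x) powr p)"
      using M(1)[of n] K by (intro integral_mono_lebesgue_on_AE) (auto simp: lebesgue_on_UNIV_eq)
    finally show ?thesis
      by (simp add: lebesgue_on_UNIV_eq)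
  qed
  then show ?thesis
    by (intro tendsto_sandwich[OF _ _ tendsto_const M(2)]) auto
qed

lemma integral_mollify_minus_tendsto_0:
  fixes f :: "'a::euclidean_space \<Rightarrow> 'b::euclidean_space"
  assumes f: "integrable lebesgue f" and D: "\<And>n. 0 < D n" "D \<longlonglongrightarrow> 0" and K: "K \<in> sets lebesgue"
    and eq: "\<And>x n. x \<in> K \<Longrightarrow> U n x = mollify (D n) f x" "\<And>x. x \<in> K \<Longrightarrow> u x = f x"
  shows "(\<lambda>n. LINT x|lebesgue_on K. norm (U n x - u x)) \<longlonglongrightarrow> 0"
  using integral_mollify_minus_powr_tendsto_0[OF f _ order_refl D K, of U u] f eq by simp

text \<open>\<open>U\<close> and \<open>W\<close> are chosen before \<open>g\<close>: they depend on
  \<open>u\<close> alone, and \<open>W\<close> converges to every weak gradient of \<open>u\<close>.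
  This order of quantifiers is what yields uniqueness.\<close>

lemma weak_gradient_approx:
  assumes \<Omega>: "open \<Omega>" and K: "compact K" "K \<subseteq> \<Omega>" and u: "locally_integrable \<Omega> u"
  obtains U W where "\<And>n x. GDERIV (U n) x :> W n x" "\<And>n. continuous_on UNIV (W n)"
    "(\<lambda>n. LINT x|lebesgue_on K. norm (U n x - u x)) \<longlonglongrightarrow> 0"
    "\<And>g. has_weak_gradient \<Omega> u g \<Longrightarrow> (\<lambda>n. LINT x|lebesgue_on K. norm (W n x - g x)) \<longlonglongrightarrow> 0"
proof -
  obtain e K' where e: "0 < e" and K': "compact K'" "K' \<subseteq> \<Omega>" "\<And>x. x \<in> K \<Longrightarrow> cball x e \<subseteq> K'"
    using compact_neighbourhood[OF \<Omega> K] by metis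
  have KK': "x \<in> K'" if "x \<in> K" for x
    using K'(3)[OF that] e by auto
  \<comment> \<open>Cutting off outside a larger compact set makes the function integrable on the
    whole space; at points of \<open>K\<close>, mollification with radius at most \<open>e\<close>
    does not see the cut.\<close>
  define f where "f y = (if y \<in> K' then u y else 0)" for y
  have f: "integrable lebesgue f"
    using u K' compact_sets_lebesgue[OF K'(1)] unfolding f_def locally_integrable_def
    by (subst Lebesgue_Measure.integrable_restrict_UNIV) auto
  define D where "D n = e * inverse (real (Suc n))" for n
  have D: "0 < D n" "D n \<le> e" for n
    using e by (auto simp: D_def inverse_le_1_iff mult_le_cancel_left1)
  have "D \<longlonglongrightarrow> e * 0"
    unfolding D_def by (intro tendsto_intros LIMSEQ_inverse_real_of_nat)
  then have D0: "D \<longlonglongrightarrow> 0"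
    by simp
  note Kl = compact_sets_lebesgue[OF K(1)]
  define W where "W n x = (LINT y|lebesgue. f y *\<^sub>R moll_grad (D n) (x - y))" for n x
  show thesis
  proof
    show "GDERIV (mollify (D n) f) x :> W n x" for n x
      unfolding W_def by (rule GDERIV_mollify[OF f D(1)])
    show "continuous_on UNIV (W n)" for n
      unfolding W_def by (rule continuous_on_mollify_gradient[OF f D(1)])
    show "(\<lambda>n. LINT x|lebesgue_on K. norm (mollify (D n) f x - u x)) \<longlonglongrightarrow> 0"
      by (rule integral_mollify_minus_tendsto_0[OF f D(1) D0 Kl]) (auto simp: f_def KK')
    fix g assume "has_weak_gradient \<Omega> u g"
    then have wg: "weak_gradient_within K' u g"
      using K' by (simp add: has_weak_gradient_iff_within[OF \<Omega>])
    have h: "integrable lebesgue (\<lambda>y. if y \<in> K' then g y else 0)"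
      using weak_gradient_withinD(2)[OF wg] compact_sets_lebesgue[OF K'(1)]
      by (subst Lebesgue_Measure.integrable_restrict_UNIV) auto
    show "(\<lambda>n. LINT x|lebesgue_on K. norm (W n x - g x)) \<longlonglongrightarrow> 0"
    proof (rule integral_mollify_minus_tendsto_0[OF h D(1) D0 Kl])
      fix x n assume "x \<in> K"
      then have "cball x (D n) \<subseteq> K'"
        using K'(3) D(2)[of n] subset_cball[of "D n" e x] by blast
      then show "W n x = mollify (D n) (\<lambda>y. if y \<in> K' then g y else 0) x"
        unfolding W_def f_def by (rule mollify_gradient_eq[OF wg K'(1) D(1)])
    qed (simp add: KK')
  qed
qed

lemma has_weak_gradient_locally_integrable:
  assumes "has_weak_gradient \<Omega> u g"
  shows "locally_integrable \<Omega> u" "locally_integrable \<Omega> g"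
  using assms by (auto simp: has_weak_gradient_def)

text \<open>On each compact subset both gradients are L^1 limits of the same sequence
  \<open>W\<close>, and countably many compact sets exhaust \<Omega>.\<close>

theorem has_weak_gradient_unique:
  fixes u :: "'a::euclidean_space \<Rightarrow> real"
  assumes \<Omega>: "open \<Omega>" and g: "has_weak_gradient \<Omega> u g" and h: "has_weak_gradient \<Omega> u h"
  shows "AE x in lebesgue_on \<Omega>. g x = h x"
proof -
  have *: "AE x in lebesgue_on K. g x = h x" if K: "compact K" "K \<subseteq> \<Omega>" for K
  proof -
    let ?M = "lebesgue_on K"
    obtain U W where UW: "\<And>n x. GDERIV (U n) x :> W n x" "\<And>n. continuous_on UNIV (W n)"
      "(\<lambda>n. LINT x|?M. norm (U n x - u x)) \<longlonglongrightarrow> 0"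
      "\<And>g. has_weak_gradient \<Omega> u g \<Longrightarrow> (\<lambda>n. LINT x|?M. norm (W n x - g x)) \<longlonglongrightarrow> 0"
      by (rule weak_gradient_approx[OF \<Omega> K has_weak_gradient_locally_integrable(1)[OF g]]) blast
    have int: "integrable ?M g" "integrable ?M h" "integrable ?M (W n)" for n
      using g h K UW(2) by (auto simp: has_weak_gradient_def locally_integrable_def intro: integrable_continuous_compact)
    have "(LINT x|?M. norm (g x - h x)) \<le>
        (LINT x|?M. norm (W n x - g x)) + (LINT x|?M. norm (W n x - h x))" for n
    proof -
      have "(LINT x|?M. norm (g x - h x)) \<le> (LINT x|?M. norm (W n x - g x) + norm (W n x - h x))"
      proof (rule integral_mono)
        show "norm (g x - h x) \<le> norm (W n x - g x) + norm (W n x - h x)" for x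
          using norm_triangle_ineq4[of "W n x - h x" "W n x - g x"] by (simp add: add.commute)
      qed (use int in auto)
      then show ?thesis
        using int by simp
    qed
    moreover have "(\<lambda>n. (LINT x|?M. norm (W n x - g x)) + (LINT x|?M. norm (W n x - h x))) \<longlonglongrightarrow> 0 + 0"
      by (intro tendsto_add UW(4) g h)
    ultimately have "(LINT x|?M. norm (g x - h x)) \<le> 0"
      by (intro tendsto_le[OF _ _ tendsto_const]) auto
    then have "(LINT x|?M. norm (g x - h x)) = 0"
      by (intro antisym) auto
    then have "AE x in ?M. norm (g x - h x) = 0"
      using int by (subst (asm) integral_nonneg_eq_0_iff_AE) auto
    then show ?thesis
      by simp
  qed
  obtain C :: "nat \<Rightarrow> 'a set" where C: "\<And>n. compact (C n)" "\<And>n. C n \<subseteq> \<Omega>" "\<Union>(range C) = \<Omega>"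
    using open_Union_compact_subsets[OF \<Omega>] by metis
  have "AE x in lebesgue. x \<in> C n \<longrightarrow> g x = h x" for n
    using *[OF C(1,2)[of n]] compact_sets_lebesgue[OF C(1)[of n]] by (simp add: AE_restrict_space_iff)
  then have "AE x in lebesgue. \<forall>n. x \<in> C n \<longrightarrow> g x = h x"
    by (subst AE_all_countable) auto
  then have "AE x in lebesgue. x \<in> \<Omega> \<longrightarrow> g x = h x"
    by eventually_elim (use C(3) in auto)
  then show ?thesis
    using open_sets_lebesgue[OF \<Omega>] by (simp add: AE_restrict_space_iff)
qed

lemma has_weak_gradient_AE_cong:
  assumes \<Omega>: "open \<Omega>" and u: "has_weak_gradient \<Omega> u g"
    and ae: "AE x in lebesgue_on \<Omega>. u x = v x" "AE x in lebesgue_on \<Omega>. g x = h x"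
  shows "has_weak_gradient \<Omega> v h"
  unfolding has_weak_gradient_iff_within[OF \<Omega>]
proof (intro allI impI)
  fix K assume K: "compact K \<and> K \<subseteq> \<Omega>"
  let ?M = "lebesgue_on K"
  have Kl: "K \<in> sets lebesgue"
    using K by (auto intro: compact_sets_lebesgue)
  have wg: "weak_gradient_within K u g"
    using u K by (simp add: has_weak_gradient_iff_within[OF \<Omega>])
  have ae': "AE x in ?M. u x = v x" "AE x in ?M. g x = h x"
    using AE_lebesgue_on_subset[OF ae(1)] AE_lebesgue_on_subset[OF ae(2)] K Kl open_sets_lebesgue[OF \<Omega>] by auto
  note D = weak_gradient_withinD[OF wg]
  have int: "integrable ?M v" "integrable ?M h"
    using integrable_lebesgue_on_AE[OF Kl D(1) ae'(1)] integrable_lebesgue_on_AE[OF Kl D(2) ae'(2)] by auto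
  then have [measurable]: "v \<in> borel_measurable ?M" "h \<in> borel_measurable ?M"
      "u \<in> borel_measurable ?M" "g \<in> borel_measurable ?M"
    using D(1,2) by auto
  show "weak_gradient_within K v h"
    unfolding weak_gradient_within_def
  proof (intro conjI allI impI int)
    fix \<psi> G assume \<psi>: "(\<forall>x. GDERIV \<psi> x :> G x) \<and> continuous_on UNIV G \<and> {x. \<psi> x \<noteq> 0} \<subseteq> K"
    have cont: "continuous_on UNIV \<psi>" "continuous_on UNIV G"
      using \<psi> GDERIV_imp_continuous_on[of \<psi> G] by auto
    note [measurable] = cont[THEN continuous_imp_measurable_lebesgue_on]
    have "(LINT x|?M. v x *\<^sub>R G x) = (LINT x|?M. u x *\<^sub>R G x)"
      using ae'(1) by (intro integral_cong_AE) auto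
    also have "\<dots> = - (LINT x|?M. \<psi> x *\<^sub>R g x)"
      using D(3) \<psi> by blast
    also have "(LINT x|?M. \<psi> x *\<^sub>R g x) = (LINT x|?M. \<psi> x *\<^sub>R h x)"
      using ae'(2) by (intro integral_cong_AE) auto
    finally show "(LINT x|?M. v x *\<^sub>R G x) = - (LINT x|?M. \<psi> x *\<^sub>R h x)" .
  qed
qed

section \<open>Calculus of weak gradients: linearity, chain rule, minimum and maximum\<close>

text \<open>A scalar on the second summand alone covers sums and differences at once.\<close>

lemma weak_gradient_within_lincomb:
  assumes K: "compact K" and u: "weak_gradient_within K u g" and v: "weak_gradient_within K v h"
  shows "weak_gradient_within K (\<lambda>x. u x + c * v x) (\<lambda>x. g x + c *\<^sub>R h x)"
  unfolding weak_gradient_within_def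
proof (intro conjI allI impI)
  let ?M = "lebesgue_on K"
  note D = weak_gradient_withinD[OF u] weak_gradient_withinD[OF v]
  show "integrable ?M (\<lambda>x. u x + c * v x)" "integrable ?M (\<lambda>x. g x + c *\<^sub>R h x)"
    using D(1,2,4,5) by auto
  fix \<psi> G assume \<psi>: "(\<forall>x. GDERIV \<psi> x :> G x) \<and> continuous_on UNIV G \<and> {x. \<psi> x \<noteq> 0} \<subseteq> K"
  have cont: "continuous_on UNIV \<psi>" "continuous_on UNIV G"
    using \<psi> GDERIV_imp_continuous_on[of \<psi> G] by auto
  obtain B where B: "\<And>x. x \<in> K \<Longrightarrow> norm (\<psi> x) \<le> B"
    using continuous_bounded_on_compact[OF K cont(1)] by metis
  obtain C where C: "\<And>x. x \<in> K \<Longrightarrow> norm (G x) \<le> C"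
    using continuous_bounded_on_compact[OF K cont(2)] by metis
  have int: "integrable ?M (\<lambda>x. u x *\<^sub>R G x)" "integrable ?M (\<lambda>x. v x *\<^sub>R G x)"
      "integrable ?M (\<lambda>x. \<psi> x *\<^sub>R g x)" "integrable ?M (\<lambda>x. \<psi> x *\<^sub>R h x)"
    using D(1,2,4,5) cont[THEN continuous_imp_measurable_lebesgue_on] B C
    by (auto intro: integrable_scaleR_bounded[of _ _ _ C] integrable_bounded_scaleR[of _ _ _ B])
  have "(LINT x|?M. (u x + c * v x) *\<^sub>R G x) = (LINT x|?M. u x *\<^sub>R G x + c *\<^sub>R (v x *\<^sub>R G x))"
    by (simp add: scaleR_add_left)
  also have "\<dots> = (LINT x|?M. u x *\<^sub>R G x) + c *\<^sub>R (LINT x|?M. v x *\<^sub>R G x)"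
    using Bochner_Integration.integral_add[OF int(1) integrable_scaleR_right[OF int(2), of c]]
    by (simp only: integral_scaleR_right)
  also have "(LINT x|?M. u x *\<^sub>R G x) = - (LINT x|?M. \<psi> x *\<^sub>R g x)"
    using D(3) \<psi> by blast
  also have "(LINT x|?M. v x *\<^sub>R G x) = - (LINT x|?M. \<psi> x *\<^sub>R h x)"
    using D(6) \<psi> by blast
  also have "- (LINT x|?M. \<psi> x *\<^sub>R g x) + c *\<^sub>R (- (LINT x|?M. \<psi> x *\<^sub>R h x)) =
      - ((LINT x|?M. \<psi> x *\<^sub>R g x) + (LINT x|?M. c *\<^sub>R (\<psi> x *\<^sub>R h x)))"
    by (simp only: integral_scaleR_right minus_add_distrib scaleR_minus_right)
  also have "(LINT x|?M. \<psi> x *\<^sub>R g x) + (LINT x|?M. c *\<^sub>R (\<psi> x *\<^sub>R h x)) =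
      (LINT x|?M. \<psi> x *\<^sub>R g x + c *\<^sub>R (\<psi> x *\<^sub>R h x))"
    by (rule Bochner_Integration.integral_add[OF int(3) integrable_scaleR_right[OF int(4)], symmetric])
  also have "\<dots> = (LINT x|?M. \<psi> x *\<^sub>R (g x + c *\<^sub>R h x))"
    by (simp add: scaleR_add_right mult.commute)
  finally show "(LINT x|?M. (u x + c * v x) *\<^sub>R G x) = - (LINT x|?M. \<psi> x *\<^sub>R (g x + c *\<^sub>R h x))" .
qed

lemma
  assumes \<Omega>: "open \<Omega>" and u: "has_weak_gradient \<Omega> u g" and v: "has_weak_gradient \<Omega> v h"
  shows has_weak_gradient_add: "has_weak_gradient \<Omega> (\<lambda>x. u x + v x) (\<lambda>x. g x + h x)"
    and has_weak_gradient_diff: "has_weak_gradient \<Omega> (\<lambda>x. u x - v x) (\<lambda>x. g x - h x)"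
proof -
  have *: "weak_gradient_within K (\<lambda>x. u x + c * v x) (\<lambda>x. g x + c *\<^sub>R h x)"
    if "compact K \<and> K \<subseteq> \<Omega>" for K c
    using u v that by (auto simp: has_weak_gradient_iff_within[OF \<Omega>] intro: weak_gradient_within_lincomb)
  show "has_weak_gradient \<Omega> (\<lambda>x. u x + v x) (\<lambda>x. g x + h x)"
    "has_weak_gradient \<Omega> (\<lambda>x. u x - v x) (\<lambda>x. g x - h x)"
    unfolding has_weak_gradient_iff_within[OF \<Omega>]
    using *[of _ 1] *[of _ "-1"] by simp_all
qed

lemma has_weak_gradient_minus:
  assumes \<Omega>: "open \<Omega>" and u: "has_weak_gradient \<Omega> u g"
  shows "has_weak_gradient \<Omega> (\<lambda>x. - u x) (\<lambda>x. - g x)"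
  using has_weak_gradient_diff[OF \<Omega> has_weak_gradient_C1[OF \<Omega> GDERIV_const[of 0] continuous_on_const] u] by simp

lemma tendsto_L1_add_bound:
  fixes f :: "nat \<Rightarrow> 'a \<Rightarrow> 'b::euclidean_space"
  assumes le: "\<And>n x. x \<in> space M \<Longrightarrow> norm (f n x) \<le> h n x" and f: "\<And>n. f n \<in> borel_measurable M"
    and h: "\<And>n. integrable M (h n)" "(\<lambda>n. integral\<^sup>L M (h n)) \<longlonglongrightarrow> 0"
  shows "(\<lambda>n. LINT x|M. norm (f n x)) \<longlonglongrightarrow> 0"
proof -
  have "(LINT x|M. norm (f n x)) \<le> integral\<^sup>L M (h n)" for n
  proof (rule integral_mono)
    show "integrable M (\<lambda>x. norm (f n x))"
      using le f by (intro integrable_dominated[OF h(1)[of n]]) auto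
  qed (use h le in auto)
  then show ?thesis
    by (intro tendsto_sandwich[OF _ _ tendsto_const h(2)]) auto
qed

text \<open>Apply the classical chain rule to C^1 approximations \<open>U n\<close>. As
  \<open>F'\<close> is only continuous, L^1 convergence of \<open>U n\<close> is upgraded to a.e.
  convergence along a subsequence; the bound on \<open>F'\<close> then allows dominated
  convergence.\<close>

theorem has_weak_gradient_compose:
  fixes u :: "'a::euclidean_space \<Rightarrow> real"
  assumes \<Omega>: "open \<Omega>" and u: "has_weak_gradient \<Omega> u g"
    and F: "\<And>t. (F has_real_derivative F' t) (at t)" "continuous_on UNIV F'" "\<And>t. \<bar>F' t\<bar> \<le> B"
  shows "has_weak_gradient \<Omega> (\<lambda>x. F (u x)) (\<lambda>x. F' (u x) *\<^sub>R g x)"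
  unfolding has_weak_gradient_iff_within[OF \<Omega>]
proof (intro allI impI)
  fix K assume "compact K \<and> K \<subseteq> \<Omega>"
  then have K: "compact K" "K \<subseteq> \<Omega>"
    by auto
  let ?M = "lebesgue_on K"
  interpret finite_measure ?M
    using K(1) by (rule finite_measure_lebesgue_on_compact)
  obtain U0 W0 where UW0: "\<And>n x. GDERIV (U0 n) x :> W0 n x" "\<And>n. continuous_on UNIV (W0 n)"
      "(\<lambda>n. LINT x|?M. norm (U0 n x - u x)) \<longlonglongrightarrow> 0"
      "\<And>g. has_weak_gradient \<Omega> u g \<Longrightarrow> (\<lambda>n. LINT x|?M. norm (W0 n x - g x)) \<longlonglongrightarrow> 0"
    by (rule weak_gradient_approx[OF \<Omega> K has_weak_gradient_locally_integrable(1)[OF u]]) blast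
  have ug: "integrable ?M u" "integrable ?M g"
    using u K by (auto simp: has_weak_gradient_def locally_integrable_def)
  have int0: "integrable ?M (U0 n)" "integrable ?M (W0 n)" for n
    using weak_gradient_withinD(1,2)[OF weak_gradient_within_C1[OF K(1) UW0(1,2)]] by auto
  obtain r :: "nat \<Rightarrow> nat" where r: "strict_mono r" "AE x in ?M. (\<lambda>n. U0 (r n) x - u x) \<longlonglongrightarrow> 0"
    using tendsto_L1_AE_subseq[of ?M "\<lambda>n x. U0 n x - u x"] int0 ug UW0(3) by auto
  define U W where "U n = U0 (r n)" and "W n = W0 (r n)" for n
  have UW: "\<And>n x. GDERIV (U n) x :> W n x" "\<And>n. continuous_on UNIV (W n)"
    using UW0 by (auto simp: U_def W_def)
  have int: "integrable ?M (U n)" "integrable ?M (W n)" for n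
    using int0 by (auto simp: U_def W_def)
  have limU: "(\<lambda>n. LINT x|?M. norm (U n x - u x)) \<longlonglongrightarrow> 0"
    using LIMSEQ_subseq_LIMSEQ[OF UW0(3) r(1)] by (simp add: o_def U_def)
  have limW: "(\<lambda>n. LINT x|?M. norm (W n x - g x)) \<longlonglongrightarrow> 0"
    using LIMSEQ_subseq_LIMSEQ[OF UW0(4)[OF u] r(1)] by (simp add: o_def W_def)
  have aeU: "AE x in ?M. (\<lambda>n. U n x) \<longlonglongrightarrow> u x"
    using r(2) by eventually_elim (auto simp: U_def intro: LIM_zero_cancel)
  have contF: "continuous_on UNIV F"
    using F(1) by (intro continuous_at_imp_continuous_on ballI) (rule DERIV_isCont)
  have B: "0 \<le> B"
    using F(3)[of 0] by simp
  have lip: "\<bar>F s - F t\<bar> \<le> B * \<bar>s - t\<bar>" for s t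
  proof -
    have "norm (F s - F t) \<le> B * norm (s - t)"
      using F(1,3) by (intro field_differentiable_bound[of UNIV F F']) auto
    then show ?thesis by simp
  qed
  have [measurable]: "F \<in> borel_measurable borel" "F' \<in> borel_measurable borel"
    using contF F(2) by (auto intro: borel_measurable_continuous_onI)
  have [measurable]: "u \<in> borel_measurable ?M" "g \<in> borel_measurable ?M"
      "\<And>n. U n \<in> borel_measurable ?M" "\<And>n. W n \<in> borel_measurable ?M"
    using int ug by auto
  have F'g: "integrable ?M (\<lambda>x. F' (v x) *\<^sub>R h x)" if "integrable ?M h" "v \<in> borel_measurable ?M"
    for v and h :: "'a \<Rightarrow> 'a"
    using that F(3) by (intro integrable_bounded_scaleR[where B = B]) auto
  show "weak_gradient_within K (\<lambda>x. F (u x)) (\<lambda>x. F' (u x) *\<^sub>R g x)"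
  proof (rule weak_gradient_within_limit[OF K(1)])
    show "integrable ?M (\<lambda>x. F (u x))"
    proof (rule integrable_dominated)
      show "integrable ?M (\<lambda>x. \<bar>F 0\<bar> + B * \<bar>u x\<bar>)"
        using ug by simp
      show "norm (F (u x)) \<le> \<bar>F 0\<bar> + B * \<bar>u x\<bar>" for x
        using lip[of "u x" 0] by auto
    qed measurable
    show "integrable ?M (\<lambda>x. F' (u x) *\<^sub>R g x)"
      using ug by (intro F'g) auto
    show "weak_gradient_within K (\<lambda>x. F (U n x)) (\<lambda>x. F' (U n x) *\<^sub>R W n x)" for n
    proof (rule weak_gradient_within_C1[OF K(1)])
      show "GDERIV (\<lambda>x. F (U n x)) x :> F' (U n x) *\<^sub>R W n x" for x
        using UW(1) F(1) by (rule GDERIV_DERIV_compose)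
      show "continuous_on UNIV (\<lambda>x. F' (U n x) *\<^sub>R W n x)"
        using UW GDERIV_imp_continuous_on[OF UW(1)[of n]] F(2)
        by (intro continuous_intros continuous_on_compose2[of UNIV F' UNIV "U n"]) auto
    qed
    show "(\<lambda>n. LINT x|?M. norm (F (U n x) - F (u x))) \<longlonglongrightarrow> 0"
    proof (rule tendsto_L1_add_bound)
      show "norm (F (U n x) - F (u x)) \<le> B * norm (U n x - u x)" for n x
        using lip by simp
      show "integrable ?M (\<lambda>x. B * norm (U n x - u x))" for n
        using int ug by simp
      show "(\<lambda>n. LINT x|?M. B * norm (U n x - u x)) \<longlonglongrightarrow> 0"
        using tendsto_mult_left[OF limU, of B] by simp
    qed measurable
    \<comment> \<open>The gradient error is \<open>F' (U n x) *\<^sub>R (W n x - g x)\<close> plus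
      this term, which is dominated by a multiple of the fixed function
      \<open>norm (g x)\<close>.\<close>
    let ?d = "\<lambda>n x. (F' (U n x) - F' (u x)) *\<^sub>R g x"
    have "(\<lambda>n. LINT x|?M. norm (?d n x)) \<longlonglongrightarrow> (LINT x|?M. 0)"
    proof (rule integral_dominated_convergence)
      show "integrable ?M (\<lambda>x. 2 * B * norm (g x))"
        using ug by simp
      show "AE x in ?M. (\<lambda>n. norm (?d n x)) \<longlonglongrightarrow> 0"
        using aeU
      proof eventually_elim
        case (elim x)
        have "(\<lambda>n. F' (U n x)) \<longlonglongrightarrow> F' (u x)"
          using continuous_on_tendsto_compose[OF F(2) elim] by simp
        then have "(\<lambda>n. norm (?d n x)) \<longlonglongrightarrow> norm ((F' (u x) - F' (u x)) *\<^sub>R g x)"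
          by (intro tendsto_intros)
        then show ?case by simp
      qed
      have "\<bar>F' s - F' t\<bar> \<le> 2 * B" for s t
        using F(3)[of s] F(3)[of t] by linarith
      then show "AE x in ?M. norm (norm (?d n x)) \<le> 2 * B * norm (g x)" for n
        by (intro AE_I2) (simp add: mult_right_mono)
    qed measurable
    then have lim: "(\<lambda>n. B * (LINT x|?M. norm (W n x - g x)) + (LINT x|?M. norm (?d n x))) \<longlonglongrightarrow> B * 0 + 0"
      by (intro tendsto_intros limW) simp
    have int2: "integrable ?M (\<lambda>x. ?d n x)" for n
      using F'g[OF ug(2), of "U n"] F'g[OF ug(2), of u] by (simp add: scaleR_diff_left)
    show "(\<lambda>n. LINT x|?M. norm (F' (U n x) *\<^sub>R W n x - F' (u x) *\<^sub>R g x)) \<longlonglongrightarrow> 0"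
    proof (rule tendsto_L1_add_bound)
      show "norm (F' (U n x) *\<^sub>R W n x - F' (u x) *\<^sub>R g x)
          \<le> B * norm (W n x - g x) + norm (?d n x)" for n x
      proof -
        have "F' (U n x) *\<^sub>R W n x - F' (u x) *\<^sub>R g x = F' (U n x) *\<^sub>R (W n x - g x) + ?d n x"
          by (simp add: algebra_simps)
        also have "norm \<dots> \<le> \<bar>F' (U n x)\<bar> * norm (W n x - g x) + norm (?d n x)"
          by (rule order_trans[OF norm_triangle_ineq]) simp
        also have "\<dots> \<le> B * norm (W n x - g x) + norm (?d n x)"
          using F(3) by (simp add: mult_right_mono)
        finally show ?thesis .
      qed
      show "integrable ?M (\<lambda>x. B * norm (W n x - g x) + norm (?d n x))" for n
        using int[of n] ug int2[of n] by (intro Bochner_Integration.integrable_add integrable_mult_right integrable_norm) auto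
      have "(LINT x|?M. B * norm (W n x - g x) + norm (?d n x)) =
          B * (LINT x|?M. norm (W n x - g x)) + (LINT x|?M. norm (?d n x))" for n
        using int[of n] ug int2[of n]
        by (subst Bochner_Integration.integral_add) (auto simp del: norm_scaleR intro!: integrable_norm)
      then show "(\<lambda>n. LINT x|?M. B * norm (W n x - g x) + norm (?d n x)) \<longlonglongrightarrow> 0"
        using lim by simp
    qed measurable
  qed
qed

text \<open>A \<open>C\<^sup>1\<close> approximation of the positive part whose derivative takes values in \<open>[0,1]\<close> and
  converges pointwise to the indicator of \<open>(0,\<infinity>)\<close> as \<open>e\<close> tends to \<open>0\<close>.\<close>

definition smooth_pos :: "real \<Rightarrow> real \<Rightarrow> real" where
  "smooth_pos e t = ((max 0 t)\<^sup>2 - (max 0 (t - e))\<^sup>2) / (2 * e)"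

definition smooth_pos' :: "real \<Rightarrow> real \<Rightarrow> real" where
  "smooth_pos' e t = (max 0 t - max 0 (t - e)) / e"

lemma DERIV_max_0_power2: "((\<lambda>t::real. (max 0 t)\<^sup>2) has_real_derivative 2 * max 0 t) (at t)"
proof -
  have "GDERIV (\<lambda>t::real. (max 0 t)\<^sup>2) t :> 2 * max 0 t"
    by (rule GDERIV_of_quadratic_error[where C = 1]) (use max_0_power2_taylor[of t] in \<open>auto simp: algebra_simps\<close>)
  then show ?thesis
    by simp
qed

lemma DERIV_smooth_pos: "e \<noteq> 0 \<Longrightarrow> (smooth_pos e has_real_derivative smooth_pos' e t) (at t)"
proof -
  assume "e \<noteq> 0"
  have "((\<lambda>t. t - e) has_real_derivative 1) (at t)"
    by (auto intro!: derivative_eq_intros)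
  then have "((\<lambda>t. (max 0 (t - e))\<^sup>2) has_real_derivative 2 * max 0 (t - e) * 1) (at t)"
    by (rule DERIV_chain2[OF DERIV_max_0_power2])
  then have "((\<lambda>t. ((max 0 t)\<^sup>2 - (max 0 (t - e))\<^sup>2) / (2 * e)) has_real_derivative
      (2 * max 0 t - 2 * max 0 (t - e) * 1) / (2 * e)) (at t)"
    by (intro DERIV_cdivide DERIV_diff DERIV_max_0_power2)
  then show ?thesis
    using \<open>e \<noteq> 0\<close> by (simp add: smooth_pos_def[abs_def] smooth_pos'_def diff_divide_distrib)
qed

lemma smooth_pos_bounds:
  assumes "0 < e"
  shows "0 \<le> smooth_pos' e t" "smooth_pos' e t \<le> 1" "\<bar>smooth_pos e t\<bar> \<le> \<bar>t\<bar>"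
    and "t \<le> 0 \<Longrightarrow> smooth_pos e t = 0" "t \<le> 0 \<Longrightarrow> smooth_pos' e t = 0"
    and "e \<le> t \<Longrightarrow> smooth_pos e t = t - e / 2" "e \<le> t \<Longrightarrow> smooth_pos' e t = 1"
proof -
  show b: "0 \<le> smooth_pos' e t" "smooth_pos' e t \<le> 1" for t
    using assms by (auto simp: smooth_pos'_def divide_le_eq)
  show z: "t \<le> 0 \<Longrightarrow> smooth_pos e t = 0" for t
    using assms by (simp add: smooth_pos_def)
  show "t \<le> 0 \<Longrightarrow> smooth_pos' e t = 0" "e \<le> t \<Longrightarrow> smooth_pos' e t = 1"
    using assms by (simp_all add: smooth_pos'_def)
  show "e \<le> t \<Longrightarrow> smooth_pos e t = t - e / 2"
    using assms by (simp add: smooth_pos_def power2_eq_square field_simps)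
  have "norm (smooth_pos e t - smooth_pos e 0) \<le> 1 * norm (t - 0)"
    using assms b DERIV_smooth_pos[of e] by (intro field_differentiable_bound[of UNIV _ "smooth_pos' e"]) auto
  then show "\<bar>smooth_pos e t\<bar> \<le> \<bar>t\<bar>"
    using z[of 0] by simp
qed

lemma smooth_pos_tendsto:
  assumes "\<And>n. 0 < e n" "e \<longlonglongrightarrow> 0"
  shows "(\<lambda>n. smooth_pos (e n) t) \<longlonglongrightarrow> max 0 t"
    and "(\<lambda>n. smooth_pos' (e n) t) \<longlonglongrightarrow> (if 0 < t then 1 else 0)"
proof -
  have "(\<lambda>n. smooth_pos (e n) t) \<longlonglongrightarrow> max 0 t \<and> (\<lambda>n. smooth_pos' (e n) t) \<longlonglongrightarrow> (if 0 < t then 1 else 0)"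
  proof (cases "0 < t")
    case True
    have ev: "\<forall>\<^sub>F n in sequentially. e n < t"
      using assms(2) True by (rule order_tendstoD)
    have "(\<lambda>n. t - e n / 2) \<longlonglongrightarrow> t - 0 / 2"
      by (intro tendsto_intros assms) auto
    moreover have "\<forall>\<^sub>F n in sequentially. t - e n / 2 = smooth_pos (e n) t"
      using ev by eventually_elim (simp add: smooth_pos_bounds assms)
    ultimately have "(\<lambda>n. smooth_pos (e n) t) \<longlonglongrightarrow> t"
      by (auto elim: Lim_transform_eventually)
    moreover have "\<forall>\<^sub>F n in sequentially. smooth_pos' (e n) t = 1"
      using ev by eventually_elim (simp add: smooth_pos_bounds assms)
    ultimately show ?thesis
      using True by (auto intro: tendsto_eventually)
  next
    case False
    then show ?thesis
      using assms by (simp add: smooth_pos_bounds)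
  qed
  then show "(\<lambda>n. smooth_pos (e n) t) \<longlonglongrightarrow> max 0 t"
    "(\<lambda>n. smooth_pos' (e n) t) \<longlonglongrightarrow> (if 0 < t then 1 else 0)"
    by auto
qed

text \<open>Let \<open>e\<close> tend to 0 in the chain rule for \<open>smooth_pos e\<close>. The
  derivatives vanish for \<open>t \<le> 0\<close>, with 0 included, so the limiting gradient is 0
  also where \<open>u x = 0\<close>.\<close>

theorem has_weak_gradient_pos_part:
  assumes \<Omega>: "open \<Omega>" and u: "has_weak_gradient \<Omega> u g"
  shows "has_weak_gradient \<Omega> (\<lambda>x. max 0 (u x)) (\<lambda>x. if 0 < u x then g x else 0)"
  unfolding has_weak_gradient_iff_within[OF \<Omega>]
proof (intro allI impI)
  fix K assume K: "compact K \<and> K \<subseteq> \<Omega>"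
  let ?M = "lebesgue_on K"
  have ug: "integrable ?M u" "integrable ?M g"
    using u K by (auto simp: has_weak_gradient_def locally_integrable_def)
  then have [measurable]: "u \<in> borel_measurable ?M" "g \<in> borel_measurable ?M"
    by auto
  define e where "e = (\<lambda>n. inverse (real (Suc n)))"
  have e: "0 < e n" "e \<longlonglongrightarrow> 0" for n
    using LIMSEQ_inverse_real_of_nat by (simp_all add: e_def)
  have cont: "continuous_on UNIV (smooth_pos' (e n))" "continuous_on UNIV (smooth_pos (e n))" for n
    unfolding smooth_pos'_def smooth_pos_def using e(1)[of n] by (auto intro!: continuous_intros)
  then have [measurable]: "smooth_pos (e n) \<in> borel_measurable borel" "smooth_pos' (e n) \<in> borel_measurable borel" for n
    by (auto intro: borel_measurable_continuous_onI)
  have wg: "weak_gradient_within K (\<lambda>x. smooth_pos (e n) (u x)) (\<lambda>x. smooth_pos' (e n) (u x) *\<^sub>R g x)" for n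
  proof -
    have "has_weak_gradient \<Omega> (\<lambda>x. smooth_pos (e n) (u x)) (\<lambda>x. smooth_pos' (e n) (u x) *\<^sub>R g x)"
    proof (rule has_weak_gradient_compose[OF \<Omega> u DERIV_smooth_pos cont(1), where B = 1])
      show "e n \<noteq> 0" "\<bar>smooth_pos' (e n) t\<bar> \<le> 1" for t
        using e(1)[of n] smooth_pos_bounds(1,2)[OF e(1)[of n], of t] by auto
    qed
    then show ?thesis
      using K by (simp add: has_weak_gradient_iff_within[OF \<Omega>])
  qed
  show "weak_gradient_within K (\<lambda>x. max 0 (u x)) (\<lambda>x. if 0 < u x then g x else 0)"
  proof (rule weak_gradient_within_limit[OF _ _ _ wg])
    show "compact K"
      using K by simp
    show "integrable ?M (\<lambda>x. max 0 (u x))"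
      using ug by simp
    show "integrable ?M (\<lambda>x. if 0 < u x then g x else 0)"
      by (rule Bochner_Integration.integrable_bound[OF ug(2)]) auto
    have "(\<lambda>n. LINT x|?M. norm (smooth_pos (e n) (u x) - max 0 (u x))) \<longlonglongrightarrow> (LINT x|?M. 0)"
    proof (rule integral_dominated_convergence)
      show "integrable ?M (\<lambda>x. 2 * \<bar>u x\<bar>)"
        using ug by simp
      show "AE x in ?M. (\<lambda>n. norm (smooth_pos (e n) (u x) - max 0 (u x))) \<longlonglongrightarrow> 0"
        using smooth_pos_tendsto(1)[OF e] by (intro AE_I2 tendsto_norm_zero LIM_zero)
      show "AE x in ?M. norm (norm (smooth_pos (e n) (u x) - max 0 (u x))) \<le> 2 * \<bar>u x\<bar>" for n
      proof (rule AE_I2)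
        fix x
        show "norm (norm (smooth_pos (e n) (u x) - max 0 (u x))) \<le> 2 * \<bar>u x\<bar>"
          using smooth_pos_bounds(3)[OF e(1), of n "u x"] by auto
      qed
    qed measurable
    then show "(\<lambda>n. LINT x|?M. norm (smooth_pos (e n) (u x) - max 0 (u x))) \<longlonglongrightarrow> 0"
      by simp
    have "(\<lambda>n. LINT x|?M. norm (smooth_pos' (e n) (u x) *\<^sub>R g x - (if 0 < u x then g x else 0))) \<longlonglongrightarrow> (LINT x|?M. 0)"
    proof (rule integral_dominated_convergence)
      show "integrable ?M (\<lambda>x. norm (g x))"
        using ug by simp
      show "AE x in ?M. (\<lambda>n. norm (smooth_pos' (e n) (u x) *\<^sub>R g x - (if 0 < u x then g x else 0))) \<longlonglongrightarrow> 0"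
      proof (rule AE_I2)
        fix x
        have "(\<lambda>n. smooth_pos' (e n) (u x) *\<^sub>R g x) \<longlonglongrightarrow> (if 0 < u x then 1 else 0) *\<^sub>R g x"
          by (intro tendsto_intros smooth_pos_tendsto(2)[OF e])
        then have "(\<lambda>n. smooth_pos' (e n) (u x) *\<^sub>R g x) \<longlonglongrightarrow> (if 0 < u x then g x else 0)"
          by (simp split: if_splits)
        then show "(\<lambda>n. norm (smooth_pos' (e n) (u x) *\<^sub>R g x - (if 0 < u x then g x else 0))) \<longlonglongrightarrow> 0"
          by (intro tendsto_norm_zero LIM_zero)
      qed
      show "AE x in ?M. norm (norm (smooth_pos' (e n) (u x) *\<^sub>R g x - (if 0 < u x then g x else 0))) \<le> norm (g x)" for n
      proof (rule AE_I2)
        fix x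
        note b = smooth_pos_bounds[OF e(1)[of n], of "u x"]
        show "norm (norm (smooth_pos' (e n) (u x) *\<^sub>R g x - (if 0 < u x then g x else 0))) \<le> norm (g x)"
        proof (cases "0 < u x")
          case True
          have "smooth_pos' (e n) (u x) *\<^sub>R g x - g x = (smooth_pos' (e n) (u x) - 1) *\<^sub>R g x"
            by (simp add: algebra_simps)
          then show ?thesis
            using True b(1,2) by (simp add: mult_left_le_one_le)
        next
          case False
          then show ?thesis
            using b(5) by simp
        qed
      qed
    qed measurable
    then show "(\<lambda>n. LINT x|?M. norm (smooth_pos' (e n) (u x) *\<^sub>R g x - (if 0 < u x then g x else 0))) \<longlonglongrightarrow> 0"
      by simp
  qed
qed

text \<open>In \<open>u = max 0 u - max 0 (- u)\<close> neither part contributes a gradient where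
  \<open>u\<close> is 0; uniqueness compares the resulting gradient with \<open>g\<close>.\<close>

lemma weak_gradient_eq_0_on_level_set:
  assumes \<Omega>: "open \<Omega>" and u: "has_weak_gradient \<Omega> u g"
  shows "AE x in lebesgue_on \<Omega>. u x = 0 \<longrightarrow> g x = 0"
proof -
  have "has_weak_gradient \<Omega> (\<lambda>x. max 0 (u x) - max 0 (- u x))
      (\<lambda>x. (if 0 < u x then g x else 0) - (if 0 < - u x then - g x else 0))"
    by (intro has_weak_gradient_diff has_weak_gradient_pos_part has_weak_gradient_minus[OF \<Omega> u] \<Omega> u)
  moreover have "(\<lambda>x. max 0 (u x) - max 0 (- u x)) = u"
    by (auto simp: max_def)
  ultimately have "AE x in lebesgue_on \<Omega>. g x = (if 0 < u x then g x else 0) - (if 0 < - u x then - g x else 0)"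
    using has_weak_gradient_unique[OF \<Omega> u] by simp
  then show ?thesis
    by eventually_elim auto
qed

lemma weak_gradient_eq_on_coincidence_set:
  assumes \<Omega>: "open \<Omega>" and u: "has_weak_gradient \<Omega> u g" and v: "has_weak_gradient \<Omega> v h"
  shows "AE x in lebesgue_on \<Omega>. u x = v x \<longrightarrow> g x = h x"
  using weak_gradient_eq_0_on_level_set[OF \<Omega> has_weak_gradient_diff[OF \<Omega> u v]] by simp

text \<open>Both reduce to the positive part of a difference, as in
  \<open>min u v = u - max 0 (u - v)\<close>. Ties are assigned to \<open>g\<close>, which a.e. is
  immaterial since the two gradients coincide there.\<close>

lemma
  assumes \<Omega>: "open \<Omega>" and u: "has_weak_gradient \<Omega> u g" and v: "has_weak_gradient \<Omega> v h"
  shows has_weak_gradient_min: "has_weak_gradient \<Omega> (\<lambda>x. min (u x) (v x)) (\<lambda>x. if v x < u x then h x else g x)"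
    and has_weak_gradient_max: "has_weak_gradient \<Omega> (\<lambda>x. max (u x) (v x)) (\<lambda>x. if u x < v x then h x else g x)"
proof -
  have "has_weak_gradient \<Omega> (\<lambda>x. u x - max 0 (u x - v x)) (\<lambda>x. g x - (if 0 < u x - v x then g x - h x else 0))"
    by (intro has_weak_gradient_diff has_weak_gradient_pos_part \<Omega> u v)
  moreover have "(\<lambda>x. u x - max 0 (u x - v x)) = (\<lambda>x. min (u x) (v x))"
    "(\<lambda>x. g x - (if 0 < u x - v x then g x - h x else 0)) = (\<lambda>x. if v x < u x then h x else g x)"
    by (auto simp: max_def min_def)
  ultimately show "has_weak_gradient \<Omega> (\<lambda>x. min (u x) (v x)) (\<lambda>x. if v x < u x then h x else g x)"
    by simp
  have "has_weak_gradient \<Omega> (\<lambda>x. u x + max 0 (v x - u x)) (\<lambda>x. g x + (if 0 < v x - u x then h x - g x else 0))"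
    by (intro has_weak_gradient_add has_weak_gradient_diff has_weak_gradient_pos_part \<Omega> u v)
  moreover have "(\<lambda>x. u x + max 0 (v x - u x)) = (\<lambda>x. max (u x) (v x))"
    "(\<lambda>x. g x + (if 0 < v x - u x then h x - g x else 0)) = (\<lambda>x. if u x < v x then h x else g x)"
    by (auto simp: max_def min_def)
  ultimately show "has_weak_gradient \<Omega> (\<lambda>x. max (u x) (v x)) (\<lambda>x. if u x < v x then h x else g x)"
    by simp
qed

section \<open>Sobolev functions\<close>

lemma Lp_spaceD:
  assumes "f \<in> Lp_space \<Omega> p"
  shows "f \<in> borel_measurable (lebesgue_on \<Omega>)" "integrable (lebesgue_on \<Omega>) (\<lambda>x. norm (f x) powr p)"
  using assms by (auto simp: Lp_space_def)

lemma Lp_space_bound: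
  fixes f :: "'a::euclidean_space \<Rightarrow> 'b::euclidean_space" and g :: "'a \<Rightarrow> 'c::euclidean_space"
  assumes f: "f \<in> borel_measurable (lebesgue_on \<Omega>)" and g: "g \<in> Lp_space \<Omega> p" and p: "0 \<le> p"
    and le: "AE x in lebesgue_on \<Omega>. norm (f x) \<le> norm (g x)"
  shows "f \<in> Lp_space \<Omega> p"
proof -
  have "integrable (lebesgue_on \<Omega>) (\<lambda>x. norm (f x) powr p)"
  proof (rule Bochner_Integration.integrable_bound[OF Lp_spaceD(2)[OF g]])
    show "AE x in lebesgue_on \<Omega>. norm (norm (f x) powr p) \<le> norm (norm (g x) powr p)"
      using le by eventually_elim (simp add: powr_mono2 p)
  qed (use f in measurable)
  then show ?thesis
    using f by (simp add: Lp_space_def)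
qed

lemma Lp_space_diff:
  assumes "f \<in> Lp_space \<Omega> p" "g \<in> Lp_space \<Omega> p" "0 \<le> p"
  shows "(\<lambda>x. f x - g x) \<in> Lp_space \<Omega> p"
  using assms integrable_norm_diff_powr[of f "lebesgue_on \<Omega>" g p] by (auto simp: Lp_space_def intro: borel_measurable_diff)

lemma Lp_space_minus: "f \<in> Lp_space \<Omega> p \<Longrightarrow> (\<lambda>x. - f x) \<in> Lp_space \<Omega> p"
  by (simp add: Lp_space_def)

lemma Lp_space_if:
  fixes f g :: "'a::euclidean_space \<Rightarrow> 'b::euclidean_space"
  assumes f: "f \<in> Lp_space \<Omega> p" and g: "g \<in> Lp_space \<Omega> p"
    and [measurable]: "Measurable.pred (lebesgue_on \<Omega>) P"
  shows "(\<lambda>x. if P x then f x else g x) \<in> Lp_space \<Omega> p"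
proof -
  note [measurable] = Lp_spaceD(1)[OF f] Lp_spaceD(1)[OF g]
  have "integrable (lebesgue_on \<Omega>) (\<lambda>x. norm (if P x then f x else g x) powr p)"
  proof (rule Bochner_Integration.integrable_bound)
    show "integrable (lebesgue_on \<Omega>) (\<lambda>x. norm (f x) powr p + norm (g x) powr p)"
      using Lp_spaceD(2)[OF f] Lp_spaceD(2)[OF g] by simp
  qed auto
  then show ?thesis
    by (simp add: Lp_space_def)
qed

lemma continuous_compact_support_Lp_space:
  fixes f :: "'a::euclidean_space \<Rightarrow> 'b::euclidean_space"
  assumes \<Omega>: "open \<Omega>" and K: "compact K" "K \<subseteq> \<Omega>" and f: "continuous_on UNIV f" "\<And>x. x \<notin> K \<Longrightarrow> f x = 0"
    and p: "0 < p"
  shows "f \<in> Lp_space \<Omega> p"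
proof -
  have [measurable]: "f \<in> borel_measurable (lebesgue_on S)" for S
    using f(1) by (rule continuous_imp_measurable_lebesgue_on)
  obtain B where B: "0 \<le> B" "\<And>x. x \<in> K \<Longrightarrow> norm (f x) \<le> B"
    using continuous_bounded_on_compact[OF K(1) f(1)] by metis
  interpret finite_measure "lebesgue_on K"
    using K(1) by (rule finite_measure_lebesgue_on_compact)
  have "integrable (lebesgue_on K) (\<lambda>x. norm (f x) powr p)"
    using B p by (intro integrable_const_bound[of _ "B powr p"]) (auto intro!: powr_mono2)
  then have "integrable lebesgue (\<lambda>x. if x \<in> K then norm (f x) powr p else 0)"
    by (subst Lebesgue_Measure.integrable_restrict_UNIV) (use K compact_sets_lebesgue in auto)
  moreover have "(\<lambda>x. if x \<in> K then norm (f x) powr p else 0) = (\<lambda>x. norm (f x) powr p)"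
    using f(2) p by (intro ext) auto
  ultimately have "integrable (lebesgue_on UNIV) (\<lambda>x. norm (f x) powr p)"
    by (simp add: lebesgue_on_UNIV_eq)
  then have "integrable (lebesgue_on \<Omega>) (\<lambda>x. norm (f x) powr p)"
    by (rule integrable_lebesgue_on_subset) (use open_sets_lebesgue[OF \<Omega>] in auto)
  then show ?thesis
    by (simp add: Lp_space_def)
qed

lemma has_weak_gradient_weak_gradient:
  "has_weak_gradient \<Omega> u g \<Longrightarrow> has_weak_gradient \<Omega> u (weak_gradient \<Omega> u)"
  unfolding weak_gradient_def by (rule someI[where P = "has_weak_gradient \<Omega> u"])

lemma weak_gradient_eq_AE:
  assumes "open \<Omega>" "has_weak_gradient \<Omega> u g"
  shows "AE x in lebesgue_on \<Omega>. weak_gradient \<Omega> u x = g x"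
  using has_weak_gradient_unique[OF assms(1) has_weak_gradient_weak_gradient[OF assms(2)] assms(2)] .

lemma weak_gradient_measurable:
  assumes \<Omega>: "open \<Omega>" and u: "has_weak_gradient \<Omega> u g" and g: "g \<in> borel_measurable (lebesgue_on \<Omega>)"
  shows "weak_gradient \<Omega> u \<in> borel_measurable (lebesgue_on \<Omega>)"
proof (rule measurable_lebesgue_on_AE[OF open_sets_lebesgue[OF \<Omega>] g])
  show "AE x in lebesgue_on \<Omega>. g x = weak_gradient \<Omega> u x"
    using weak_gradient_eq_AE[OF \<Omega> u] by eventually_elim simp
qed

lemma W1pI:
  "u \<in> Lp_space \<Omega> p \<Longrightarrow> g \<in> Lp_space \<Omega> p \<Longrightarrow> has_weak_gradient \<Omega> u g \<Longrightarrow> u \<in> W1p \<Omega> p"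
  by (auto simp: W1p_def)

lemma W1pD:
  assumes \<Omega>: "open \<Omega>" and u: "u \<in> W1p \<Omega> p" and p: "0 \<le> p"
  shows "u \<in> Lp_space \<Omega> p" "has_weak_gradient \<Omega> u (weak_gradient \<Omega> u)" "weak_gradient \<Omega> u \<in> Lp_space \<Omega> p"
proof -
  obtain g where g: "g \<in> Lp_space \<Omega> p" "has_weak_gradient \<Omega> u g"
    using u by (auto simp: W1p_def)
  show "u \<in> Lp_space \<Omega> p"
    using u by (simp add: W1p_def)
  show "has_weak_gradient \<Omega> u (weak_gradient \<Omega> u)"
    using g(2) by (rule has_weak_gradient_weak_gradient)
  have "AE x in lebesgue_on \<Omega>. norm (weak_gradient \<Omega> u x) \<le> norm (g x)"
    using weak_gradient_eq_AE[OF \<Omega> g(2)] by eventually_elim simp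
  then show "weak_gradient \<Omega> u \<in> Lp_space \<Omega> p"
    by (rule Lp_space_bound[OF weak_gradient_measurable[OF \<Omega> g(2) Lp_spaceD(1)[OF g(1)]] g(1) p])
qed

lemma
  assumes \<Omega>: "open \<Omega>" and p: "0 \<le> p" and u: "u \<in> W1p \<Omega> p" and v: "v \<in> W1p \<Omega> p"
  shows W1p_diff: "(\<lambda>x. u x - v x) \<in> W1p \<Omega> p"
    and W1p_add: "(\<lambda>x. u x + v x) \<in> W1p \<Omega> p"
    and W1p_min: "(\<lambda>x. min (u x) (v x)) \<in> W1p \<Omega> p"
    and W1p_max: "(\<lambda>x. max (u x) (v x)) \<in> W1p \<Omega> p"
proof -
  note U = W1pD[OF \<Omega> u p] and V = W1pD[OF \<Omega> v p]
  note [measurable] = Lp_spaceD(1)[OF U(1)] Lp_spaceD(1)[OF V(1)]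
  show "(\<lambda>x. u x - v x) \<in> W1p \<Omega> p"
    using U V p by (intro W1pI[OF _ _ has_weak_gradient_diff[OF \<Omega> U(2) V(2)]] Lp_space_diff) auto
  show "(\<lambda>x. u x + v x) \<in> W1p \<Omega> p"
    using U V p Lp_space_diff[OF U(1) Lp_space_minus[OF V(1)] p] Lp_space_diff[OF U(3) Lp_space_minus[OF V(3)] p]
    by (intro W1pI[OF _ _ has_weak_gradient_add[OF \<Omega> U(2) V(2)]]) auto
  have "(\<lambda>x. if v x < u x then v x else u x) \<in> Lp_space \<Omega> p"
    using U V by (intro Lp_space_if) auto
  moreover have "(\<lambda>x. if v x < u x then v x else u x) = (\<lambda>x. min (u x) (v x))"
    by (auto simp: min_def)
  ultimately show "(\<lambda>x. min (u x) (v x)) \<in> W1p \<Omega> p"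
    using U V by (intro W1pI[OF _ _ has_weak_gradient_min[OF \<Omega> U(2) V(2)]] Lp_space_if) auto
  have "(\<lambda>x. if u x < v x then v x else u x) \<in> Lp_space \<Omega> p"
    using U V by (intro Lp_space_if) auto
  moreover have "(\<lambda>x. if u x < v x then v x else u x) = (\<lambda>x. max (u x) (v x))"
    by (auto simp: max_def)
  ultimately show "(\<lambda>x. max (u x) (v x)) \<in> W1p \<Omega> p"
    using U V by (intro W1pI[OF _ _ has_weak_gradient_max[OF \<Omega> U(2) V(2)]] Lp_space_if) auto
qed

lemma W1p_minus:
  assumes \<Omega>: "open \<Omega>" and p: "0 \<le> p" and u: "u \<in> W1p \<Omega> p"
  shows "(\<lambda>x. - u x) \<in> W1p \<Omega> p"
  using W1pD[OF \<Omega> u p] by (intro W1pI[OF _ _ has_weak_gradient_minus[OF \<Omega>]] Lp_space_minus) auto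

lemma W1p_restrict:
  fixes u :: "'a::euclidean_space \<Rightarrow> real"
  assumes \<Omega>: "open \<Omega>" and p: "0 \<le> p" and u: "u \<in> W1p UNIV p"
  shows "u \<in> W1p \<Omega> p"
proof -
  note U = W1pD[OF open_UNIV u p]
  have restr: "f \<in> Lp_space \<Omega> p" if "f \<in> Lp_space UNIV p" for f :: "'a \<Rightarrow> 'b::euclidean_space"
    using Lp_spaceD[OF that] open_sets_lebesgue[OF \<Omega>]
      integrable_lebesgue_on_subset[of UNIV "\<lambda>x. norm (f x) powr p" \<Omega>]
    by (simp add: Lp_space_def lebesgue_on_UNIV_eq measurable_restrict_space1)
  \<comment> \<open>The local form restricts at once, a compact subset of \<Omega> being a compact
    subset of the whole space.\<close>
  have "has_weak_gradient \<Omega> u (weak_gradient UNIV u)"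
    using U(2) by (simp add: has_weak_gradient_iff_within[OF \<Omega>] has_weak_gradient_iff_within[OF open_UNIV])
  then show ?thesis
    using U by (intro W1pI restr)
qed

section \<open>The Sobolev norm and the closure of the test functions\<close>

lemma W1p_norm_eq:
  assumes \<Omega>: "open \<Omega>" and w: "has_weak_gradient \<Omega> w g" and g: "g \<in> borel_measurable (lebesgue_on \<Omega>)"
  shows "W1p_norm \<Omega> p w = ((LINT x|lebesgue_on \<Omega>. norm (w x) powr p) + (LINT x|lebesgue_on \<Omega>. norm (g x) powr p)) powr (1 / p)"
proof -
  have "AE x in lebesgue_on \<Omega>. norm (weak_gradient \<Omega> w x) powr p = norm (g x) powr p"
    using weak_gradient_eq_AE[OF \<Omega> w] by eventually_elim simp
  then have "(LINT x|lebesgue_on \<Omega>. norm (weak_gradient \<Omega> w x) powr p) = (LINT x|lebesgue_on \<Omega>. norm (g x) powr p)"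
    using g weak_gradient_measurable[OF \<Omega> w g] by (intro integral_cong_AE) auto
  then show ?thesis
    by (simp add: W1p_norm_def)
qed

lemma C1_compactD:
  assumes \<Omega>: "open \<Omega>" and \<psi>: "\<psi> \<in> C1_compact \<Omega>" and G: "\<And>x. GDERIV \<psi> x :> G x" and p: "0 < p"
  shows "continuous_on UNIV G" "has_weak_gradient \<Omega> \<psi> G" "\<psi> \<in> Lp_space \<Omega> p" "G \<in> Lp_space \<Omega> p"
proof -
  obtain G' where G': "\<And>x. GDERIV \<psi> x :> G' x" "continuous_on UNIV G'"
    using \<psi> by (auto simp: C1_compact_def)
  have "G = G'"
    using GDERIV_unique[OF G G'(1)] by auto
  then show cont: "continuous_on UNIV G"
    using G' by simp
  show "has_weak_gradient \<Omega> \<psi> G"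
    by (rule has_weak_gradient_C1[OF \<Omega> G cont])
  let ?K = "closure {x. \<psi> x \<noteq> 0}"
  have K: "compact ?K" "?K \<subseteq> \<Omega>"
    using \<psi> by (auto simp: C1_compact_def)
  show "\<psi> \<in> Lp_space \<Omega> p"
    using closure_subset[of "{x. \<psi> x \<noteq> 0}"]
    by (intro continuous_compact_support_Lp_space[OF \<Omega> K GDERIV_imp_continuous_on[OF G] _ p]) auto
  show "G \<in> Lp_space \<Omega> p"
    by (rule continuous_compact_support_Lp_space[OF \<Omega> K cont GDERIV_outside_support[OF G] p])
qed

text \<open>The \<open>p\<close>-th power of the norm of \<open>v - w\<close>, with the gradients given explicitly instead of by the
  choice in \<^const>\<open>weak_gradient\<close>.\<close>

definition W1p_modular :: "'a::euclidean_space set \<Rightarrow> real \<Rightarrow> ('a \<Rightarrow> real) \<Rightarrow> ('a \<Rightarrow> 'a) \<Rightarrow>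
    ('a \<Rightarrow> real) \<Rightarrow> ('a \<Rightarrow> 'a) \<Rightarrow> real" where
  "W1p_modular \<Omega> p v h w g =
     (LINT x|lebesgue_on \<Omega>. norm (v x - w x) powr p) + (LINT x|lebesgue_on \<Omega>. norm (h x - g x) powr p)"

lemma W1p_modular_nonneg: "0 \<le> W1p_modular \<Omega> p v h w g"
  by (simp add: W1p_modular_def)

lemma W1p_modular_triangle:
  assumes "u \<in> Lp_space \<Omega> p" "v \<in> Lp_space \<Omega> p" "w \<in> Lp_space \<Omega> p"
    and "f \<in> Lp_space \<Omega> p" "g \<in> Lp_space \<Omega> p" "h \<in> Lp_space \<Omega> p" and p: "0 \<le> p"
  shows "W1p_modular \<Omega> p u f w h \<le>
     2 powr p * (W1p_modular \<Omega> p u f v g + W1p_modular \<Omega> p v g w h)"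
proof -
  let ?M = "lebesgue_on \<Omega>"
  have *: "(LINT x|?M. norm (a x - c x) powr p) \<le>
      2 powr p * ((LINT x|?M. norm (a x - b x) powr p) + (LINT x|?M. norm (b x - c x) powr p))"
    if "a \<in> Lp_space \<Omega> p" "b \<in> Lp_space \<Omega> p" "c \<in> Lp_space \<Omega> p"
    for a b c :: "'a \<Rightarrow> 'b::euclidean_space"
  proof -
    note L = Lp_spaceD(2)[OF Lp_space_diff[OF that(1,3) p]] Lp_spaceD(2)[OF Lp_space_diff[OF that(1,2) p]]
      Lp_spaceD(2)[OF Lp_space_diff[OF that(2,3) p]]
    have "(LINT x|?M. norm (a x - c x) powr p) \<le>
        (LINT x|?M. 2 powr p * (norm (a x - b x) powr p + norm (b x - c x) powr p))"
    proof (rule integral_mono)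
      show "norm (a x - c x) powr p \<le> 2 powr p * (norm (a x - b x) powr p + norm (b x - c x) powr p)" for x
        using norm_diff_powr_le[OF p, of "a x - b x" "c x - b x"] by (simp add: norm_minus_commute)
    qed (use L in auto)
    then show ?thesis
      using L by simp
  qed
  show ?thesis
    using *[OF assms(1-3)] *[OF assms(4-6)] unfolding W1p_modular_def by (simp add: algebra_simps)
qed

text \<open>Frees membership from \<open>weak_gradient\<close>, which picks a representative anew
  for each difference \<open>w - \<psi>\<close>, and from the p-th root, which is monotone and does
  not affect smallness.\<close>

lemma W1p_zero_iff:
  assumes \<Omega>: "open \<Omega>" and p: "1 \<le> p" and w: "has_weak_gradient \<Omega> w g" "w \<in> Lp_space \<Omega> p" "g \<in> Lp_space \<Omega> p"
  shows "w \<in> W1p_zero \<Omega> p \<longleftrightarrow> (\<forall>\<epsilon>>0. \<exists>\<psi> G. \<psi> \<in> C1_compact \<Omega> \<and> (\<forall>x. GDERIV \<psi> x :> G x) \<and>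
     W1p_modular \<Omega> p w g \<psi> G < \<epsilon>)"
  (is "_ \<longleftrightarrow> ?R")
proof -
  have norm_eq: "W1p_norm \<Omega> p (\<lambda>x. w x - \<psi> x) = W1p_modular \<Omega> p w g \<psi> G powr (1 / p)"
    if "\<psi> \<in> C1_compact \<Omega>" "\<And>x. GDERIV \<psi> x :> G x" for \<psi> G
  proof -
    have "has_weak_gradient \<Omega> \<psi> G" "G \<in> Lp_space \<Omega> p"
      using C1_compactD[OF \<Omega> that, of p] p by auto
    then show ?thesis
      unfolding W1p_modular_def using w p
      by (intro W1p_norm_eq[OF \<Omega>] has_weak_gradient_diff[OF \<Omega>] Lp_spaceD(1)[OF Lp_space_diff]) auto
  qed
  have wW: "w \<in> W1p \<Omega> p"
    using w by (intro W1pI)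
  show ?thesis
  proof
    assume zero: "w \<in> W1p_zero \<Omega> p"
    show ?R
    proof (intro allI impI)
      fix \<epsilon> :: real assume "0 < \<epsilon>"
      then have "0 < \<epsilon> powr (1 / p)"
        by simp
      then obtain \<psi> where \<psi>: "\<psi> \<in> C1_compact \<Omega>" "W1p_norm \<Omega> p (\<lambda>x. w x - \<psi> x) < \<epsilon> powr (1 / p)"
        using zero unfolding W1p_zero_def by blast
      obtain G where G: "\<And>x. GDERIV \<psi> x :> G x"
        using \<psi>(1) by (auto simp: C1_compact_def)
      have "W1p_modular \<Omega> p w g \<psi> G powr (1 / p) < \<epsilon> powr (1 / p)"
        using \<psi>(2) norm_eq[OF \<psi>(1) G] by simp
      then have "W1p_modular \<Omega> p w g \<psi> G < \<epsilon>"
        using p \<open>0 < \<epsilon>\<close> powr_mono2[of "1 / p" \<epsilon> "W1p_modular \<Omega> p w g \<psi> G"]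
        by (force simp: not_less[symmetric])
      then show "\<exists>\<psi> G. \<psi> \<in> C1_compact \<Omega> \<and> (\<forall>x. GDERIV \<psi> x :> G x) \<and>
          W1p_modular \<Omega> p w g \<psi> G < \<epsilon>"
        using \<psi>(1) G by auto
    qed
  next
    assume *: ?R
    have "\<exists>\<psi>\<in>C1_compact \<Omega>. W1p_norm \<Omega> p (\<lambda>x. w x - \<psi> x) < \<epsilon>" if "0 < \<epsilon>" for \<epsilon>
    proof -
      have "0 < \<epsilon> powr p"
        using that by simp
      then obtain \<psi> G where \<psi>: "\<psi> \<in> C1_compact \<Omega>" "\<And>x. GDERIV \<psi> x :> G x"
        and lt: "W1p_modular \<Omega> p w g \<psi> G < \<epsilon> powr p"
        using * by blast
      have "W1p_norm \<Omega> p (\<lambda>x. w x - \<psi> x) < (\<epsilon> powr p) powr (1 / p)"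
        unfolding norm_eq[OF \<psi>] using p lt W1p_modular_nonneg by (intro powr_less_mono2) auto
      also have "\<dots> = \<epsilon>"
        using p that by (simp add: powr_powr)
      finally show ?thesis
        using \<psi>(1) by blast
    qed
    then show "w \<in> W1p_zero \<Omega> p"
      using wW by (simp add: W1p_zero_def)
  qed
qed

lemma W1p_zero_closed:
  assumes \<Omega>: "open \<Omega>" and p: "1 \<le> p" and w: "has_weak_gradient \<Omega> w g" "w \<in> Lp_space \<Omega> p" "g \<in> Lp_space \<Omega> p"
    and approx: "\<And>\<epsilon>. 0 < \<epsilon> \<Longrightarrow> \<exists>v h. v \<in> W1p_zero \<Omega> p \<and> has_weak_gradient \<Omega> v h \<and> h \<in> Lp_space \<Omega> p \<and>
      W1p_modular \<Omega> p w g v h < \<epsilon>"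
  shows "w \<in> W1p_zero \<Omega> p"
  unfolding W1p_zero_iff[OF \<Omega> p w]
proof (intro allI impI)
  fix \<epsilon> :: real assume \<epsilon>: "0 < \<epsilon>"
  \<comment> \<open>One half for each of the two approximations, divided by the constant
    \<open>2 powr p\<close> of \<open>W1p_modular_triangle\<close>.\<close>
  let ?\<delta> = "\<epsilon> / (2 powr p * 2)"
  have \<delta>: "0 < ?\<delta>"
    using \<epsilon> by simp
  obtain v h where v: "v \<in> W1p_zero \<Omega> p" "has_weak_gradient \<Omega> v h" "h \<in> Lp_space \<Omega> p"
    and lt1: "W1p_modular \<Omega> p w g v h < ?\<delta>"
    using approx[OF \<delta>] by blast
  have vL: "v \<in> Lp_space \<Omega> p"
    using v(1) by (simp add: W1p_zero_def W1p_def)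
  obtain \<psi> G where \<psi>: "\<psi> \<in> C1_compact \<Omega>" "\<And>x. GDERIV \<psi> x :> G x"
    and lt2: "W1p_modular \<Omega> p v h \<psi> G < ?\<delta>"
    using v(1) \<delta> unfolding W1p_zero_iff[OF \<Omega> p v(2) vL v(3)] by blast
  have "W1p_modular \<Omega> p w g \<psi> G \<le>
      2 powr p * (W1p_modular \<Omega> p w g v h + W1p_modular \<Omega> p v h \<psi> G)"
    using C1_compactD[OF \<Omega> \<psi>, of p] p w vL v by (intro W1p_modular_triangle) auto
  also have "\<dots> < 2 powr p * (?\<delta> + ?\<delta>)"
    using lt1 lt2 by (intro mult_strict_left_mono add_strict_mono) auto
  also have "\<dots> = \<epsilon>"
    by simp
  finally show "\<exists>\<psi> G. \<psi> \<in> C1_compact \<Omega> \<and> (\<forall>x. GDERIV \<psi> x :> G x) \<and>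
      W1p_modular \<Omega> p w g \<psi> G < \<epsilon>"
    using \<psi> by blast
qed

lemma W1p_zero_minus:
  assumes \<Omega>: "open \<Omega>" and p: "1 \<le> p" and w: "w \<in> W1p_zero \<Omega> p"
  shows "(\<lambda>x. - w x) \<in> W1p_zero \<Omega> p"
proof -
  have "w \<in> W1p \<Omega> p"
    using w by (simp add: W1p_zero_def)
  note W = W1pD[OF \<Omega> this order_trans[OF zero_le_one p]]
  let ?g = "weak_gradient \<Omega> w"
  note iff = W1p_zero_iff[OF \<Omega> p W(2,1,3)]
  note iff' = W1p_zero_iff[OF \<Omega> p has_weak_gradient_minus[OF \<Omega> W(2)] Lp_space_minus[OF W(1)] Lp_space_minus[OF W(3)]]
  show ?thesis
    unfolding iff'
  proof (intro allI impI)
    fix \<epsilon> :: real assume "0 < \<epsilon>"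
    then obtain \<psi> G where \<psi>: "\<psi> \<in> C1_compact \<Omega>" "\<And>x. GDERIV \<psi> x :> G x"
      and lt: "W1p_modular \<Omega> p w ?g \<psi> G < \<epsilon>"
      using w unfolding iff by blast
    have D: "GDERIV (\<lambda>x. - \<psi> x) x :> - G x" for x
      using \<psi>(2) by (rule GDERIV_minus)
    have "continuous_on UNIV (\<lambda>x. - G x)"
      using C1_compactD(1)[OF \<Omega> \<psi>, of 1] by (intro continuous_intros) auto
    then have "\<exists>H. (\<forall>x. GDERIV (\<lambda>x. - \<psi> x) x :> H x) \<and> continuous_on UNIV H"
      using D by (intro exI[of _ "\<lambda>x. - G x"]) simp
    then have "(\<lambda>x. - \<psi> x) \<in> C1_compact \<Omega>"
      using \<psi>(1) unfolding C1_compact_def by simp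
    moreover have "W1p_modular \<Omega> p (\<lambda>x. - w x) (\<lambda>x. - ?g x) (\<lambda>x. - \<psi> x) (\<lambda>x. - G x) = W1p_modular \<Omega> p w ?g \<psi> G"
      unfolding W1p_modular_def by (simp add: norm_minus_commute abs_minus_commute)
    ultimately show "\<exists>\<psi> G. \<psi> \<in> C1_compact \<Omega> \<and> (\<forall>x. GDERIV \<psi> x :> G x) \<and>
        W1p_modular \<Omega> p (\<lambda>x. - w x) (\<lambda>x. - ?g x) \<psi> G < \<epsilon>"
      using D lt by (intro exI[of _ "\<lambda>x. - \<psi> x"] exI[of _ "\<lambda>x. - G x"]) simp
  qed
qed

text \<open>With the same gradient \<open>?g\<close> the modular of \<open>v\<close> and
  \<open>w\<close> is 0, so closedness applies. The truncation will agree with \<phi> plus an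
  element of the space only a.e.\<close>

lemma W1p_zero_AE_cong:
  assumes \<Omega>: "open \<Omega>" and p: "1 \<le> p" and w: "w \<in> W1p_zero \<Omega> p"
    and ae: "AE x in lebesgue_on \<Omega>. w x = v x"
  shows "v \<in> W1p_zero \<Omega> p"
proof -
  have p0: "0 \<le> p"
    using p by simp
  have "w \<in> W1p \<Omega> p"
    using w by (simp add: W1p_zero_def)
  note W = W1pD[OF \<Omega> this p0]
  let ?g = "weak_gradient \<Omega> w"
  have vg: "has_weak_gradient \<Omega> v ?g"
    using has_weak_gradient_AE_cong[OF \<Omega> W(2) ae] by simp
  have vm: "v \<in> borel_measurable (lebesgue_on \<Omega>)"
    by (rule measurable_lebesgue_on_AE[OF open_sets_lebesgue[OF \<Omega>] Lp_spaceD(1)[OF W(1)] ae])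
  have "AE x in lebesgue_on \<Omega>. norm (v x) \<le> norm (w x)"
    using ae by eventually_elim simp
  then have vL: "v \<in> Lp_space \<Omega> p"
    using Lp_space_bound[OF vm W(1) p0] by simp
  show ?thesis
  proof (rule W1p_zero_closed[OF \<Omega> p vg vL W(3)])
    fix \<epsilon> :: real assume "0 < \<epsilon>"
    have "AE x in lebesgue_on \<Omega>. norm (v x - w x) powr p = 0"
      using ae by eventually_elim simp
    then have "W1p_modular \<Omega> p v ?g w ?g = 0"
      by (simp add: W1p_modular_def integral_eq_zero_AE)
    then show "\<exists>v' h. v' \<in> W1p_zero \<Omega> p \<and> has_weak_gradient \<Omega> v' h \<and> h \<in> Lp_space \<Omega> p \<and>
        W1p_modular \<Omega> p v ?g v' h < \<epsilon>"
      using w W \<open>0 < \<epsilon>\<close> by (intro exI[of _ w] exI[of _ ?g]) auto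
  qed
qed

text \<open>Extend \<open>z\<close> by 0 and mollify: for small radii the result vanishes off a
  compact subset of \<Omega>, and its gradient is the mollification of the extended
  gradient.\<close>

lemma compact_support_in_W1p_zero:
  fixes z :: "'a::euclidean_space \<Rightarrow> real"
  assumes \<Omega>: "open \<Omega>" and p: "1 \<le> p" and z: "has_weak_gradient \<Omega> z g" "z \<in> Lp_space \<Omega> p" "g \<in> Lp_space \<Omega> p"
    and S: "compact S" "S \<subseteq> \<Omega>" and z0: "\<And>x. x \<in> \<Omega> \<Longrightarrow> x \<notin> S \<Longrightarrow> z x = 0"
  shows "z \<in> W1p_zero \<Omega> p"
proof -
  note Sl = compact_sets_lebesgue[OF S(1)] and \<Omega>l = open_sets_lebesgue[OF \<Omega>]
  define f where "f x = (if x \<in> S then z x else 0)" for x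
  \<comment> \<open>Inside \<Omega>, \<open>g\<close> vanishes off \<open>S\<close> only a.e., by
    the level set lemma, and outside \<Omega> it is arbitrary; \<open>h\<close> vanishes everywhere
    off \<open>S\<close>.\<close>
  define h where "h x = (if x \<in> S then g x else 0)" for x
  have zf: "z x = f x" if "x \<in> \<Omega>" for x
    using z0[OF that] by (auto simp: f_def)
  have "AE x in lebesgue_on \<Omega>. x \<in> \<Omega>"
    by (rule AE_I2) simp
  then have gh: "AE x in lebesgue_on \<Omega>. g x = h x"
    using weak_gradient_eq_0_on_level_set[OF \<Omega> z(1)] by eventually_elim (auto simp: h_def z0)
  have zh: "has_weak_gradient \<Omega> z h"
    using has_weak_gradient_AE_cong[OF \<Omega> z(1) _ gh] by simp
  have hL: "h \<in> Lp_space \<Omega> p"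
  proof (rule Lp_space_bound[OF _ z(3)])
    show "h \<in> borel_measurable (lebesgue_on \<Omega>)"
      by (rule measurable_lebesgue_on_AE[OF \<Omega>l Lp_spaceD(1)[OF z(3)] gh])
    show "AE x in lebesgue_on \<Omega>. norm (h x) \<le> norm (g x)"
      by (simp add: h_def)
  qed (use p in simp)
  have wgS: "weak_gradient_within S z g"
    using z(1) S by (simp add: has_weak_gradient_iff_within[OF \<Omega>])
  have f1: "integrable lebesgue f"
    unfolding f_def using weak_gradient_withinD(1)[OF wgS] Sl by (subst Lebesgue_Measure.integrable_restrict_UNIV) auto
  have h1: "integrable lebesgue h"
    unfolding h_def using weak_gradient_withinD(2)[OF wgS] Sl by (subst Lebesgue_Measure.integrable_restrict_UNIV) auto
  have powr_restr: "integrable lebesgue (\<lambda>x. norm (if x \<in> S then k x else 0) powr p)" if "k \<in> Lp_space \<Omega> p"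
    for k :: "'a \<Rightarrow> 'b::euclidean_space"
  proof -
    have "integrable (lebesgue_on S) (\<lambda>x. norm (k x) powr p)"
      by (rule integrable_lebesgue_on_subset[OF Lp_spaceD(2)[OF that] S(2) Sl \<Omega>l])
    then have "integrable lebesgue (\<lambda>x. if x \<in> S then norm (k x) powr p else 0)"
      using Sl by (subst Lebesgue_Measure.integrable_restrict_UNIV)
    moreover have "(\<lambda>x. if x \<in> S then norm (k x) powr p else 0) = (\<lambda>x. norm (if x \<in> S then k x else 0) powr p)"
      by auto
    ultimately show ?thesis by simp
  qed
  have fp: "integrable lebesgue (\<lambda>x. norm (f x) powr p)" and hp: "integrable lebesgue (\<lambda>x. norm (h x) powr p)"
    using powr_restr[OF z(2)] powr_restr[OF z(3)] by (simp_all add: f_def h_def)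
  obtain e K where e: "0 < e" and K: "compact K" "K \<subseteq> \<Omega>" "\<And>x. x \<in> S \<Longrightarrow> cball x e \<subseteq> K"
    using compact_neighbourhood[OF \<Omega> S] by metis
  \<comment> \<open>Radii are at most \<open>e / 2\<close> because they are spent twice: a point
    within \<open>D n\<close> of a point within \<open>D n\<close> of \<open>S\<close> must still be
    within \<open>e\<close> of \<open>S\<close>.\<close>
  define D where "D n = e / 2 * inverse (real (Suc n))" for n
  have "inverse (real (Suc n)) \<le> 1" for n
    by (simp add: inverse_le_1_iff)
  then have D: "0 < D n" "D n \<le> e / 2" for n
    using e mult_left_mono[of "inverse (real (Suc n))" 1 "e / 2"] by (auto simp: D_def)
  have "D \<longlonglongrightarrow> e / 2 * 0"
    unfolding D_def by (intro tendsto_intros LIMSEQ_inverse_real_of_nat)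
  then have D0: "D \<longlonglongrightarrow> 0"
    by simp
  let ?F = "\<lambda>n. mollify (D n) f"
  define W where "W n x = (LINT y|lebesgue. f y *\<^sub>R moll_grad (D n) (x - y))" for n x
  have GD: "GDERIV (?F n) x :> W n x" for n x
    unfolding W_def by (rule GDERIV_mollify[OF f1 D(1)])
  have Wc: "continuous_on UNIV (W n)" for n
    unfolding W_def by (rule continuous_on_mollify_gradient[OF f1 D(1)])
  have near: "cball x (D n) \<subseteq> K" if "y \<in> S" "dist x y < D n" for x y n
  proof -
    have "cball x (D n) \<subseteq> cball y e"
    proof
      fix t assume "t \<in> cball x (D n)"
      then show "t \<in> cball y e"
        using that(2) D(2)[of n] dist_triangle[of y t x] by (simp add: dist_commute)
    qed
    then show ?thesis
      using K(3)[OF that(1)] by blast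
  qed
  \<comment> \<open>The gradient formula for mollifications asks for
    \<open>cball x (D n) \<subseteq> K\<close>, which may fail for distant \<open>x\<close>; there
    all three integrands vanish identically.\<close>
  have far: "?F n x = 0" "W n x = 0" "mollify (D n) h x = 0" if "\<not> (\<exists>y\<in>S. dist x y < D n)" for n x
  proof -
    have *: "moll (D n) (x - y) *\<^sub>R f y = 0" "f y *\<^sub>R moll_grad (D n) (x - y) = 0" "moll (D n) (x - y) *\<^sub>R h y = 0" for y
      using that moll_eq_0[of "D n" "x - y"] moll_grad_eq_0[of "D n" "x - y"] less_imp_le[OF D(1)[of n]]
      by (cases "y \<in> S"; auto simp: f_def h_def dist_norm not_less)+
    then show "?F n x = 0" "W n x = 0" "mollify (D n) h x = 0"
      by (simp_all only: mollify_def W_def * integral_zero)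
  qed
  have Weq: "W n x = mollify (D n) h x" for n x
  proof (cases "\<exists>y\<in>S. dist x y < D n")
    case False
    then show ?thesis
      by (simp add: far)
  next
    case True
    then have sub: "cball x (D n) \<subseteq> K"
      using near by blast
    have wg: "weak_gradient_within K z h"
      using zh K by (simp add: has_weak_gradient_iff_within[OF \<Omega>])
    have SK: "y \<in> K" if "y \<in> S" for y
      using K(3)[OF that] e by auto
    have "f = (\<lambda>y. if y \<in> K then z y else 0)"
    proof
      show "f y = (if y \<in> K then z y else 0)" for y
        using z0[of y] K(2) SK[of y] by (auto simp: f_def)
    qed
    moreover have "h = (\<lambda>y. if y \<in> K then h y else 0)"
      using SK by (auto simp: h_def)
    ultimately show ?thesis
      unfolding W_def using mollify_gradient_eq[OF wg K(1) D(1) sub] by simp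
  qed
  have C1: "?F n \<in> C1_compact \<Omega>" for n
  proof -
    have "{x. ?F n x \<noteq> 0} \<subseteq> K"
    proof
      fix x assume "x \<in> {x. ?F n x \<noteq> 0}"
      then have "cball x (D n) \<subseteq> K"
        using far(1) near by blast
      then show "x \<in> K"
        using D(1)[of n] by auto
    qed
    then show ?thesis
      by (rule C1_compactI[OF GD Wc K(1) _ K(2)])
  qed
  have "(\<lambda>n. LINT x|lebesgue_on \<Omega>. norm (?F n x - z x) powr p) \<longlonglongrightarrow> 0"
    by (rule integral_mollify_minus_powr_tendsto_0[OF f1 fp p D(1) D0 \<Omega>l]) (auto simp: zf)
  moreover have "(\<lambda>n. LINT x|lebesgue_on \<Omega>. norm (W n x - h x) powr p) \<longlonglongrightarrow> 0"
    by (rule integral_mollify_minus_powr_tendsto_0[OF h1 hp p D(1) D0 \<Omega>l]) (auto simp: Weq)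
  ultimately have "(\<lambda>n. (LINT x|lebesgue_on \<Omega>. norm (?F n x - z x) powr p) +
      (LINT x|lebesgue_on \<Omega>. norm (W n x - h x) powr p)) \<longlonglongrightarrow> 0 + 0"
    by (rule tendsto_add)
  then have lim: "(\<lambda>n. W1p_modular \<Omega> p z h (?F n) (W n)) \<longlonglongrightarrow> 0"
    by (simp add: W1p_modular_def norm_minus_commute abs_minus_commute)
  show ?thesis
    unfolding W1p_zero_iff[OF \<Omega> p zh z(2) hL]
  proof (intro allI impI)
    fix \<epsilon> :: real assume "0 < \<epsilon>"
    then have "\<forall>\<^sub>F n in sequentially. W1p_modular \<Omega> p z h (?F n) (W n) < \<epsilon>"
      using order_tendstoD(2)[OF lim] by blast
    then obtain n where "W1p_modular \<Omega> p z h (?F n) (W n) < \<epsilon>"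
      using eventually_happens[of _ sequentially] by auto
    then show "\<exists>\<psi> G. \<psi> \<in> C1_compact \<Omega> \<and> (\<forall>x. GDERIV \<psi> x :> G x) \<and>
        W1p_modular \<Omega> p z h \<psi> G < \<epsilon>"
      using C1 GD by blast
  qed
qed

lemma tendsto_integral_powr_comparison:
  fixes f :: "nat \<Rightarrow> 'a \<Rightarrow> 'b::euclidean_space"
  assumes [measurable]: "\<And>n. f n \<in> borel_measurable M" and p: "0 < p"
    and g: "integrable M (\<lambda>x. norm (g x) powr p)"
    and le: "\<And>n x. norm (f n x) \<le> norm (g x)"
    and lim: "AE x in M. (\<lambda>n. norm (f n x)) \<longlonglongrightarrow> 0"
  shows "(\<lambda>n. LINT x|M. norm (f n x) powr p) \<longlonglongrightarrow> 0"
proof -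
  have "(\<lambda>n. LINT x|M. norm (f n x) powr p) \<longlonglongrightarrow> (LINT x|M. 0)"
  proof (rule integral_dominated_convergence[OF _ _ g])
    show "AE x in M. (\<lambda>n. norm (f n x) powr p) \<longlonglongrightarrow> 0"
      using lim
    proof eventually_elim
      case (elim x)
      then show ?case
        using p tendsto_powr'[OF elim tendsto_const, of p] by simp
    qed
    show "AE x in M. norm (norm (f n x) powr p) \<le> norm (g x) powr p" for n
      using le p by (intro AE_I2) (auto intro: powr_mono2)
  qed auto
  then show ?thesis by simp
qed

text \<open>The work lies in the convergence of the gradients, since the set \<open>a < P n\<close>
  on which the gradient of \<open>min (P n) a\<close> switches varies with \<open>n\<close>. The
  functions themselves converge because \<open>min\<close> is 1-Lipschitz in its first
  argument.\<close>

lemma W1p_zero_min: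
  assumes \<Omega>: "open \<Omega>" and p: "1 \<le> p" and w: "w \<in> W1p_zero \<Omega> p" and a: "a \<in> W1p \<Omega> p"
    and a0: "\<And>x. 0 \<le> a x"
  shows "(\<lambda>x. min (w x) (a x)) \<in> W1p_zero \<Omega> p"
proof -
  let ?M = "lebesgue_on \<Omega>"
  have p0: "0 \<le> p" "0 < p"
    using p by auto
  have wW: "w \<in> W1p \<Omega> p"
    using w by (simp add: W1p_zero_def)
  note W = W1pD[OF \<Omega> wW p0(1)] and A = W1pD[OF \<Omega> a p0(1)]
  define gw where "gw = weak_gradient \<Omega> w"
  define ga where "ga = weak_gradient \<Omega> a"
  have wg: "has_weak_gradient \<Omega> w gw" "has_weak_gradient \<Omega> a ga"
    and L: "gw \<in> Lp_space \<Omega> p" "ga \<in> Lp_space \<Omega> p"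
    using W A by (simp_all add: gw_def ga_def)
  have "\<exists>\<psi> G. \<psi> \<in> C1_compact \<Omega> \<and> (\<forall>x. GDERIV \<psi> x :> G x) \<and>
      W1p_modular \<Omega> p w gw \<psi> G < inverse (real (Suc n))" for n
    using w unfolding W1p_zero_iff[OF \<Omega> p wg(1) W(1) L(1)] by simp
  then obtain P0 G0 where PG0: "\<And>n. P0 n \<in> C1_compact \<Omega>" "\<And>n x. GDERIV (P0 n) x :> G0 n x"
    "\<And>n. W1p_modular \<Omega> p w gw (P0 n) (G0 n) < inverse (real (Suc n))"
    by metis
  note C0 = C1_compactD[OF \<Omega> PG0(1,2) p0(2)]
  have mod0: "(\<lambda>n. W1p_modular \<Omega> p w gw (P0 n) (G0 n)) \<longlonglongrightarrow> 0"
  proof (rule tendsto_sandwich[OF _ _ tendsto_const LIMSEQ_inverse_real_of_nat])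
    show "\<forall>\<^sub>F n in sequentially. W1p_modular \<Omega> p w gw (P0 n) (G0 n) \<le> inverse (real (Suc n))"
      using PG0(3) less_imp_le by (intro always_eventually allI) blast
  qed (simp add: W1p_modular_nonneg)
  have "(\<lambda>n. LINT x|?M. norm (norm (w x - P0 n x) powr p)) \<longlonglongrightarrow> 0"
    by (rule tendsto_sandwich[OF _ _ tendsto_const mod0]) (auto simp: W1p_modular_def)
  \<comment> \<open>A.e. convergence of a subsequence is what controls the switching set
    pointwise.\<close>
  from tendsto_L1_AE_subseq[OF Lp_spaceD(2)[OF Lp_space_diff[OF W(1) C0(3) p0(1)]] this]
  obtain r :: "nat \<Rightarrow> nat" where r: "strict_mono r" "AE x in ?M. (\<lambda>n. norm (w x - P0 (r n) x) powr p) \<longlonglongrightarrow> 0"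
    by blast
  define P where "P n = P0 (r n)" for n
  define G where "G n = G0 (r n)" for n
  have PL: "P n \<in> Lp_space \<Omega> p" "G n \<in> Lp_space \<Omega> p" "has_weak_gradient \<Omega> (P n) (G n)" for n
    using C0 by (auto simp: P_def G_def)
  have mod: "(\<lambda>n. W1p_modular \<Omega> p w gw (P n) (G n)) \<longlonglongrightarrow> 0"
    using LIMSEQ_subseq_LIMSEQ[OF mod0 r(1)] by (simp add: o_def P_def G_def)
  have lim: "AE x in ?M. (\<lambda>n. P n x) \<longlonglongrightarrow> w x"
    using r(2)
  proof eventually_elim
    case (elim x)
    have "(\<lambda>n. (norm (w x - P n x) powr p) powr (1 / p)) \<longlonglongrightarrow> 0"
      using tendsto_powr'[OF elim tendsto_const, of "1 / p"] p by (simp add: P_def)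
    then have "(\<lambda>n. norm (w x - P n x)) \<longlonglongrightarrow> 0"
      using p by (simp add: powr_powr)
    then have "(\<lambda>n. w x - P n x) \<longlonglongrightarrow> 0"
      by (rule tendsto_norm_zero_cancel)
    then have "(\<lambda>n. w x - (w x - P n x)) \<longlonglongrightarrow> w x - 0"
      by (intro tendsto_intros)
    then show ?case by simp
  qed
  note [measurable] = Lp_spaceD(1)[OF W(1)] Lp_spaceD(1)[OF A(1)] Lp_spaceD(1)[OF L(1)] Lp_spaceD(1)[OF L(2)]
    Lp_spaceD(1)[OF PL(1)] Lp_spaceD(1)[OF PL(2)]
  define m where "m x = min (w x) (a x)" for x
  define H where "H x = (if a x < w x then ga x else gw x)" for x
  define mn where "mn n x = min (P n x) (a x)" for n x
  define Hn where "Hn n x = (if a x < P n x then ga x else G n x)" for n x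
  have mg: "has_weak_gradient \<Omega> m H" "has_weak_gradient \<Omega> (mn n) (Hn n)" for n
    unfolding m_def[abs_def] H_def[abs_def] mn_def[abs_def] Hn_def[abs_def]
    by (intro has_weak_gradient_min \<Omega> wg PL)+
  have HL: "H \<in> Lp_space \<Omega> p" "Hn n \<in> Lp_space \<Omega> p" for n
    unfolding H_def[abs_def] Hn_def[abs_def] by (intro Lp_space_if L PL; measurable)+
  have mL: "m \<in> Lp_space \<Omega> p"
    using W1p_min[OF \<Omega> p0(1) wW a] unfolding m_def[abs_def] by (simp add: W1p_def)
  have mnL: "mn n \<in> Lp_space \<Omega> p" for n
    using W1p_min[OF \<Omega> p0(1) W1pI[OF PL(1,2,3)] a] unfolding mn_def[abs_def] by (simp add: W1p_def)
  have mn0: "mn n \<in> W1p_zero \<Omega> p" for n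
  proof (rule compact_support_in_W1p_zero[OF \<Omega> p mg(2) mnL HL(2)])
    show "compact (closure {x. P n x \<noteq> 0})" "closure {x. P n x \<noteq> 0} \<subseteq> \<Omega>"
      using PG0(1) by (auto simp: C1_compact_def P_def)
    show "mn n x = 0" if "x \<notin> closure {x. P n x \<noteq> 0}" for x
    proof -
      have "P n x = 0"
        using that closure_subset[of "{x. P n x \<noteq> 0}"] by auto
      then show ?thesis
        using a0[of x] by (simp add: mn_def)
    qed
  qed
  \<comment> \<open>\<open>T\<close> isolates the effect of switching on \<open>a < P n\<close>
    instead of \<open>a < w\<close>, with the limiting gradients. Where
    \<open>w x \<noteq> a x\<close> the two conditions eventually agree a.e.; where
    \<open>w x = a x\<close> they need not, but \<open>ga\<close> and \<open>gw\<close> coincide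
    there a.e., so the value 0 may be prescribed.\<close>
  define T where "T n x = (if w x = a x then 0 else (if a x < P n x then ga x else gw x) - (if a x < w x then ga x else gw x))" for n x
  have [measurable]: "T n \<in> borel_measurable ?M" for n
    unfolding T_def[abs_def] by measurable
  have Tlim: "(\<lambda>n. LINT x|?M. norm (T n x) powr p) \<longlonglongrightarrow> 0"
  proof (rule tendsto_integral_powr_comparison[where g = "\<lambda>x. ga x - gw x"])
    show "integrable ?M (\<lambda>x. norm (ga x - gw x) powr p)"
      by (rule Lp_spaceD(2)[OF Lp_space_diff[OF L(2,1) p0(1)]])
    show "norm (T n x) \<le> norm (ga x - gw x)" for n x
      by (simp add: T_def norm_minus_commute)
    show "AE x in ?M. (\<lambda>n. norm (T n x)) \<longlonglongrightarrow> 0"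
      using lim
    proof eventually_elim
      case (elim x)
      consider "w x = a x" | "a x < w x" | "w x < a x"
        by linarith
      then have "\<forall>\<^sub>F n in sequentially. norm (T n x) = 0"
      proof cases
        case 1
        then show ?thesis by (simp add: T_def)
      next
        case 2
        show ?thesis
          using order_tendstoD(1)[OF elim 2] by (rule eventually_mono) (use 2 in \<open>simp add: T_def\<close>)
      next
        case 3
        show ?thesis
          using order_tendstoD(2)[OF elim 3] by (rule eventually_mono) (use 3 in \<open>simp add: T_def\<close>)
      qed
      then show ?case
        by (rule tendsto_eventually)
    qed
  qed (use p0 in auto)
  have Tint: "integrable ?M (\<lambda>x. norm (T n x) powr p)" for n
  proof (rule integrable_dominated)
    show "integrable ?M (\<lambda>x. norm (ga x - gw x) powr p)"
      by (rule Lp_spaceD(2)[OF Lp_space_diff[OF L(2,1) p0(1)]])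
    show "norm (norm (T n x) powr p) \<le> norm (ga x - gw x) powr p" for x
      using p0 by (auto simp: T_def norm_minus_commute intro!: powr_mono2)
  qed measurable
  have le1: "(LINT x|?M. norm (m x - mn n x) powr p) \<le> (LINT x|?M. norm (w x - P n x) powr p)" for n
  proof (rule integral_mono)
    show "integrable ?M (\<lambda>x. norm (m x - mn n x) powr p)" "integrable ?M (\<lambda>x. norm (w x - P n x) powr p)"
      using Lp_spaceD(2)[OF Lp_space_diff[OF mL mnL p0(1)]] Lp_spaceD(2)[OF Lp_space_diff[OF W(1) PL(1) p0(1)]] by auto
    show "norm (m x - mn n x) powr p \<le> norm (w x - P n x) powr p" for x
      using p0 by (intro powr_mono2) (auto simp: m_def mn_def min_def)
  qed
  have le2: "(LINT x|?M. norm (H x - Hn n x) powr p) \<le>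
      2 powr p * ((LINT x|?M. norm (T n x) powr p) + (LINT x|?M. norm (gw x - G n x) powr p))" for n
  proof -
    have int: "integrable ?M (\<lambda>x. norm (H x - Hn n x) powr p)" "integrable ?M (\<lambda>x. norm (gw x - G n x) powr p)"
      using Lp_spaceD(2)[OF Lp_space_diff[OF HL p0(1)]] Lp_spaceD(2)[OF Lp_space_diff[OF L(1) PL(2) p0(1)]] by auto
    have "(LINT x|?M. norm (H x - Hn n x) powr p) \<le>
        (LINT x|?M. 2 powr p * (norm (T n x) powr p + norm (gw x - G n x) powr p))"
    proof (rule integral_mono_AE)
      show "AE x in ?M. norm (H x - Hn n x) powr p \<le> 2 powr p * (norm (T n x) powr p + norm (gw x - G n x) powr p)"
        using weak_gradient_eq_on_coincidence_set[OF \<Omega> wg]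
      proof eventually_elim
        case (elim x)
        \<comment> \<open>What remains besides \<open>T\<close>: the gradient error of
          \<open>P n\<close>, present only where the minimum follows \<open>P n\<close>.\<close>
        let ?R = "if a x < P n x then 0 else gw x - G n x"
        have "H x - Hn n x = ?R - T n x"
          using elim by (auto simp: H_def Hn_def T_def)
        then have "norm (H x - Hn n x) powr p \<le> 2 powr p * (norm ?R powr p + norm (T n x) powr p)"
          using norm_diff_powr_le[OF p0(1), of ?R "T n x"] by simp
        also have "\<dots> \<le> 2 powr p * (norm (gw x - G n x) powr p + norm (T n x) powr p)"
          using p0 by (intro mult_left_mono add_right_mono powr_mono2) auto
        finally show ?case
          by (simp add: add.commute)
      qed
    qed (use int Tint in auto)
    then show ?thesis
      using int Tint by simp
  qed
  have "(\<lambda>n. 2 powr p * (W1p_modular \<Omega> p w gw (P n) (G n) + (LINT x|?M. norm (T n x) powr p))) \<longlonglongrightarrow> 2 powr p * (0 + 0)"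
    by (intro tendsto_mult_left tendsto_add mod Tlim)
  then have final: "(\<lambda>n. 2 powr p * (W1p_modular \<Omega> p w gw (P n) (G n) + (LINT x|?M. norm (T n x) powr p))) \<longlonglongrightarrow> 0"
    by simp
  have "m \<in> W1p_zero \<Omega> p"
  proof (rule W1p_zero_closed[OF \<Omega> p mg(1) mL HL(1)])
    fix \<epsilon> :: real assume "0 < \<epsilon>"
    then obtain n where n: "2 powr p * (W1p_modular \<Omega> p w gw (P n) (G n) + (LINT x|?M. norm (T n x) powr p)) < \<epsilon>"
      using eventually_happens[OF order_tendstoD(2)[OF final]] by auto
    have "1 * (LINT x|?M. norm (w x - P n x) powr p) \<le> 2 powr p * (LINT x|?M. norm (w x - P n x) powr p)"
      using p0 by (intro mult_right_mono ge_one_powr_ge_zero) auto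
    then have "W1p_modular \<Omega> p m H (mn n) (Hn n) < \<epsilon>"
      using le1[of n] le2[of n] n unfolding W1p_modular_def distrib_left by linarith
    then show "\<exists>v h. v \<in> W1p_zero \<Omega> p \<and> has_weak_gradient \<Omega> v h \<and> h \<in> Lp_space \<Omega> p \<and>
        W1p_modular \<Omega> p m H v h < \<epsilon>"
      using mn0 mg(2) HL(2) by blast
  qed
  then show ?thesis
    by (simp add: m_def[abs_def])
qed

text \<open>Duality: \<open>max w b = - min (- w) (- b)\<close>.\<close>

lemma W1p_zero_max:
  assumes \<Omega>: "open \<Omega>" and p: "1 \<le> p" and w: "w \<in> W1p_zero \<Omega> p" and b: "b \<in> W1p \<Omega> p"
    and b0: "\<And>x. b x \<le> 0"
  shows "(\<lambda>x. max (w x) (b x)) \<in> W1p_zero \<Omega> p"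
proof -
  have p0: "0 \<le> p"
    using p by simp
  have "(\<lambda>x. - min (- w x) (- b x)) \<in> W1p_zero \<Omega> p"
    using b0 by (intro W1p_zero_minus[OF \<Omega> p] W1p_zero_min[OF \<Omega> p] W1p_minus[OF \<Omega> p0 b] w) auto
  then show ?thesis
    by (simp add: minus_min_eq_max)
qed

section \<open>Measurability of Caratheodory integrands\<close>

text \<open>For simple functions the composition is a finite sum of sections
  \<open>\<lambda>x. L x t v\<close> times indicators; continuity in \<open>(t, v)\<close> carries
  measurability to the pointwise limit.\<close>

lemma caratheodory_compose_measurable:
  fixes \<xi> :: "'a::euclidean_space \<Rightarrow> 'a" and c :: "'a \<Rightarrow> real"
  assumes \<Omega>: "\<Omega> \<in> sets lebesgue" and L: "caratheodory \<Omega> L"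
    and [measurable]: "c \<in> borel_measurable (lebesgue_on \<Omega>)" "\<xi> \<in> borel_measurable (lebesgue_on \<Omega>)"
  shows "(\<lambda>x. L x (c x) (\<xi> x)) \<in> borel_measurable (lebesgue_on \<Omega>)"
proof -
  let ?M = "lebesgue_on \<Omega>"
  have meas: "(\<lambda>x. L x t v) \<in> borel_measurable ?M" for t v
    using L by (simp add: caratheodory_def)
  obtain N where N: "{x \<in> space ?M. \<not> continuous_on UNIV (\<lambda>(t, v). L x t v)} \<subseteq> N" "emeasure ?M N = 0" "N \<in> sets ?M"
    using L unfolding caratheodory_def by (auto elim: AE_E)
  \<comment> \<open>Continuity holds only a.e.; replacing the integrand by 0 on a null set makes it
    hold at every point.\<close>
  define L' where "L' x t v = (if x \<in> N then 0 else L x t v)" for x t v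
  have [measurable]: "(\<lambda>x. L' x t v) \<in> borel_measurable ?M" for t v
    unfolding L'_def using N(3) meas[of t v] by measurable
  have cont: "continuous_on UNIV (\<lambda>(t, v). L' x t v)" if "x \<in> space ?M" for x
    using N(1) that by (cases "x \<in> N") (auto simp: L'_def[abs_def])
  have "(\<lambda>x. (c x, \<xi> x)) \<in> borel_measurable ?M"
    by measurable
  then obtain s where s: "\<And>i. simple_function ?M (s i)" "\<And>x. x \<in> space ?M \<Longrightarrow> (\<lambda>i. s i x) \<longlonglongrightarrow> (c x, \<xi> x)"
    using borel_measurable_implies_sequence_metric[of "\<lambda>x. (c x, \<xi> x)" ?M 0] by metis
  have "(\<lambda>x. L' x (c x) (\<xi> x)) \<in> borel_measurable ?M"
  proof (rule borel_measurable_LIMSEQ_metric)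
    fix i
    have fin: "finite (s i ` space ?M)"
      using s(1) by (rule simple_functionD(1))
    have [measurable]: "s i -` {y} \<inter> space ?M \<in> sets ?M" for y
      using s(1) by (rule simple_functionD(2))
    have "(\<lambda>x. \<Sum>y\<in>s i ` space ?M. indicator (s i -` {y} \<inter> space ?M) x * L' x (fst y) (snd y)) \<in> borel_measurable ?M"
      by measurable
    also have "?this \<longleftrightarrow> (\<lambda>x. L' x (fst (s i x)) (snd (s i x))) \<in> borel_measurable ?M"
    proof (rule measurable_cong)
      fix x assume x: "x \<in> space ?M"
      have "(\<Sum>y\<in>s i ` space ?M. indicator (s i -` {y} \<inter> space ?M) x * L' x (fst y) (snd y)) =
          (\<Sum>y\<in>s i ` space ?M. if y = s i x then L' x (fst y) (snd y) else 0)"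
        using x by (intro sum.cong) (auto simp: indicator_def)
      then show "(\<Sum>y\<in>s i ` space ?M. indicator (s i -` {y} \<inter> space ?M) x * L' x (fst y) (snd y)) = L' x (fst (s i x)) (snd (s i x))"
        using x fin by simp
    qed
    finally show "(\<lambda>x. L' x (fst (s i x)) (snd (s i x))) \<in> borel_measurable ?M" .
  next
    fix x assume x: "x \<in> space ?M"
    show "(\<lambda>i. L' x (fst (s i x)) (snd (s i x))) \<longlonglongrightarrow> L' x (c x) (\<xi> x)"
      using continuous_on_tendsto_compose[OF cont[OF x] s(2)[OF x]] by (simp add: case_prod_unfold)
  qed
  moreover have "AE x in ?M. L' x (c x) (\<xi> x) = L x (c x) (\<xi> x)"
  proof (rule AE_I)
    show "{x \<in> space ?M. L' x (c x) (\<xi> x) \<noteq> L x (c x) (\<xi> x)} \<subseteq> N"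
      by (auto simp: L'_def)
  qed (use N in auto)
  ultimately show ?thesis
    by (rule measurable_lebesgue_on_AE[OF \<Omega>])
qed

section \<open>Truncation\<close>

text \<open>The exceptional null set depends on \<open>k\<close>; a countable union absorbs
  this.\<close>

lemma eventually_AE_imp_AE_eventually:
  assumes "\<forall>\<^sub>F k in sequentially. AE x in M. P k x"
  shows "AE x in M. \<forall>\<^sub>F k in sequentially. P k x"
proof -
  obtain N where N: "\<And>k. N \<le> k \<Longrightarrow> AE x in M. P k x"
    using assms by (auto simp: eventually_sequentially)
  have "AE x in M. N \<le> k \<longrightarrow> P k x" for k
    using N[of k] by (cases "N \<le> k") auto
  then have "AE x in M. \<forall>k. N \<le> k \<longrightarrow> P k x"
    by (subst AE_all_countable) auto
  then show ?thesis
    by eventually_elim (auto simp: eventually_sequentially)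
qed

lemma essinf_tendsto_PInfty:
  assumes "(\<lambda>k. essinf M (\<lambda>x. ereal (c k x))) \<longlonglongrightarrow> \<infinity>"
  shows "\<forall>\<^sub>F k in sequentially. AE x in M. r \<le> c k x"
proof -
  have "\<forall>\<^sub>F k in sequentially. ereal r < essinf M (\<lambda>x. ereal (c k x))"
    using assms by (rule order_tendstoD(1)) simp
  then show ?thesis
  proof eventually_elim
    case (elim k)
    \<comment> \<open>For a non-measurable function \<open>essinf\<close> has the default
      \<open>bot\<close>, that is -\<infinity>, which the strict lower bound excludes.\<close>
    then have "ereal r < Liminf (ae_filter M) (\<lambda>x. ereal (c k x))"
      by (auto simp: essinf_def bot_ereal_def split: if_splits)
    from less_LiminfD[OF this] show ?case
      by eventually_elim simp
  qed
qed

lemma esssup_tendsto_MInfty: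
  assumes "(\<lambda>k. esssup M (\<lambda>x. ereal (c k x))) \<longlonglongrightarrow> - \<infinity>"
  shows "\<forall>\<^sub>F k in sequentially. AE x in M. c k x \<le> r"
proof -
  have "\<forall>\<^sub>F k in sequentially. esssup M (\<lambda>x. ereal (c k x)) < ereal r"
    using assms by (rule order_tendstoD(2)) simp
  then show ?thesis
  proof eventually_elim
    case (elim k)
    \<comment> \<open>Here the default for a non-measurable function is \<open>top\<close>, excluded
      by the strict upper bound.\<close>
    then have "Limsup (ae_filter M) (\<lambda>x. ereal (c k x)) < ereal r"
      by (auto simp: esssup_def top_ereal_def split: if_splits)
    from Limsup_lessD[OF this] show ?case
      by eventually_elim simp
  qed
qed

text \<open>\<open>u\<close> may be unbounded, so the level to be exceeded depends on
  \<open>x\<close>; natural numbers suffice as levels, and there are countably many of them.\<close>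

lemma AE_eventually_less:
  fixes c :: "nat \<Rightarrow> 'a \<Rightarrow> real" and u :: "'a \<Rightarrow> real"
  assumes "\<And>r. \<forall>\<^sub>F k in sequentially. AE x in M. r \<le> c k x"
  shows "AE x in M. \<forall>\<^sub>F k in sequentially. u x \<le> c k x"
proof -
  have "AE x in M. \<forall>\<^sub>F k in sequentially. real j \<le> c k x" for j
    using assms by (rule eventually_AE_imp_AE_eventually)
  then have "AE x in M. \<forall>j. \<forall>\<^sub>F k in sequentially. real j \<le> c k x"
    by (subst AE_all_countable) auto
  then show ?thesis
  proof eventually_elim
    case (elim x)
    obtain j where "u x \<le> real j"
      using real_arch_simple by blast
    then show ?case
      using elim[rule_format, of j] by (auto elim: eventually_mono)
  qed
qed

text \<open>Convergence of extended integrals forces all but finitely many to be finite. For Bochner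
  integrals alone it would not, since their default value 0 hides an infinite integral.\<close>

lemma nn_integral_tendsto_0_imp:
  fixes f :: "nat \<Rightarrow> 'a \<Rightarrow> real"
  assumes [measurable]: "\<And>k. f k \<in> borel_measurable M" and nonneg: "\<And>k x. 0 \<le> f k x"
    and lim: "(\<lambda>k. \<integral>\<^sup>+x. ennreal (f k x) \<partial>M) \<longlonglongrightarrow> 0"
  shows "\<forall>\<^sub>F k in sequentially. integrable M (f k)" and "(\<lambda>k. integral\<^sup>L M (f k)) \<longlonglongrightarrow> 0"
proof -
  have "\<forall>\<^sub>F k in sequentially. (\<integral>\<^sup>+x. ennreal (f k x) \<partial>M) < \<infinity>"
    using lim by (rule order_tendstoD(2)) simp
  then show "\<forall>\<^sub>F k in sequentially. integrable M (f k)"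
    by eventually_elim (intro integrableI_nonneg, auto simp: nonneg)
  have "(\<lambda>k. enn2real (\<integral>\<^sup>+x. ennreal (f k x) \<partial>M)) \<longlonglongrightarrow> 0"
    using lim by (intro tendsto_enn2real) auto
  moreover have "integral\<^sup>L M (f k) = enn2real (\<integral>\<^sup>+x. ennreal (f k x) \<partial>M)" for k
    by (rule integral_eq_nn_integral) (auto simp: nonneg)
  ultimately show "(\<lambda>k. integral\<^sup>L M (f k)) \<longlonglongrightarrow> 0"
    by simp
qed

lemma tendsto_L1_comparison:
  fixes f :: "nat \<Rightarrow> 'a \<Rightarrow> real"
  assumes f: "\<And>k. f k \<in> borel_measurable M"
    and le: "\<forall>\<^sub>F k in sequentially. AE x in M. \<bar>f k x\<bar> \<le> C * e k x"
    and e: "\<forall>\<^sub>F k in sequentially. integrable M (e k)" "(\<lambda>k. integral\<^sup>L M (e k)) \<longlonglongrightarrow> 0"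
  shows "\<forall>\<^sub>F k in sequentially. integrable M (f k)" and "(\<lambda>k. LINT x|M. \<bar>f k x\<bar>) \<longlonglongrightarrow> 0"
proof -
  have ev: "\<forall>\<^sub>F k in sequentially. integrable M (f k) \<and> (LINT x|M. \<bar>f k x\<bar>) \<le> C * integral\<^sup>L M (e k)"
    using le e(1)
  proof eventually_elim
    case (elim k)
    have Ce: "integrable M (\<lambda>x. C * e k x)"
      using elim(2) by simp
    have int: "integrable M (f k)"
    proof (rule Bochner_Integration.integrable_bound[OF Ce f])
      show "AE x in M. norm (f k x) \<le> norm (C * e k x)"
        using elim(1) by eventually_elim simp
    qed
    have "(LINT x|M. \<bar>f k x\<bar>) \<le> (LINT x|M. C * e k x)"
      using int Ce elim(1) by (intro integral_mono_AE) auto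
    then show ?case
      using int by simp
  qed
  show "\<forall>\<^sub>F k in sequentially. integrable M (f k)"
    using ev by eventually_elim simp
  have le': "\<forall>\<^sub>F k in sequentially. (LINT x|M. \<bar>f k x\<bar>) \<le> C * integral\<^sup>L M (e k)"
    using ev by eventually_elim simp
  have lim: "(\<lambda>k. C * integral\<^sup>L M (e k)) \<longlonglongrightarrow> 0"
    using tendsto_mult_left[OF e(2), of C] by simp
  show "(\<lambda>k. LINT x|M. \<bar>f k x\<bar>) \<longlonglongrightarrow> 0"
    by (rule tendsto_sandwich[OF _ le' tendsto_const lim]) simp
qed

lemma set_nn_integral_lebesgue_on:
  assumes "\<Omega> \<in> sets lebesgue"
  shows "(\<integral>\<^sup>+x\<in>{x \<in> \<Omega>. P x}. ennreal (f x) \<partial>lebesgue) = (\<integral>\<^sup>+x. ennreal (if P x then f x else 0) \<partial>lebesgue_on \<Omega>)"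
proof -
  have "(\<integral>\<^sup>+x. ennreal (if P x then f x else 0) \<partial>lebesgue_on \<Omega>) = (\<integral>\<^sup>+x. ennreal (if P x then f x else 0) * indicator \<Omega> x \<partial>lebesgue)"
    using assms by (intro nn_integral_restrict_space) auto
  also have "\<dots> = (\<integral>\<^sup>+x\<in>{x \<in> \<Omega>. P x}. ennreal (f x) \<partial>lebesgue)"
    by (intro nn_integral_cong) (auto simp: indicator_def)
  finally show ?thesis ..
qed

lemma truncation_in_W1p_bdry:
  assumes \<Omega>: "open \<Omega>" and p: "1 \<le> p" and \<phi>: "\<phi> \<in> W1p \<Omega> p" and u: "u \<in> W1p_bdry \<Omega> p \<phi>"
    and c: "c \<in> W1p \<Omega> p" "d \<in> W1p \<Omega> p"
    and le: "AE x in lebesgue_on \<Omega>. d x \<le> \<phi> x \<and> \<phi> x \<le> c x"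
  shows "(\<lambda>x. min (c x) (max (u x) (d x))) \<in> W1p_bdry \<Omega> p \<phi>"
proof -
  have p0: "0 \<le> p"
    using p by simp
  obtain w where w: "w \<in> W1p_zero \<Omega> p" and uw: "u = (\<lambda>x. \<phi> x + w x)"
    using u by (auto simp: W1p_bdry_def)
  have zero: "(\<lambda>x. 0) \<in> W1p \<Omega> p"
    using W1p_diff[OF \<Omega> p0 \<phi> \<phi>] by simp
  \<comment> \<open>The inequalities between \<open>d\<close>, \<phi> and \<open>c\<close> hold
    a.e., while \<open>W1p_zero_min\<close> and \<open>W1p_zero_max\<close> ask for signs
    everywhere; clipping at 0 changes \<open>c - \<phi>\<close> and \<open>d - \<phi>\<close> on a
    null set of \<Omega> only.\<close>
  have ab: "(\<lambda>x. max 0 (c x - \<phi> x)) \<in> W1p \<Omega> p" "(\<lambda>x. min 0 (d x - \<phi> x)) \<in> W1p \<Omega> p"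
    by (intro W1p_max W1p_min W1p_diff \<Omega> p0 zero c \<phi>)+
  have z: "(\<lambda>x. min (max (w x) (min 0 (d x - \<phi> x))) (max 0 (c x - \<phi> x))) \<in> W1p_zero \<Omega> p"
    by (intro W1p_zero_min[OF \<Omega> p] W1p_zero_max[OF \<Omega> p] w ab) auto
  have "AE x in lebesgue_on \<Omega>. min (max (w x) (min 0 (d x - \<phi> x))) (max 0 (c x - \<phi> x)) =
      min (c x) (max (u x) (d x)) - \<phi> x"
    using le by eventually_elim (auto simp: uw min_def max_def)
  from W1p_zero_AE_cong[OF \<Omega> p z this]
  show ?thesis
    unfolding W1p_bdry_def by (intro CollectI exI[of _ "\<lambda>x. min (c x) (max (u x) (d x)) - \<phi> x"]) auto
qed

lemma truncation_in_Linfty: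
  assumes [measurable]: "u \<in> borel_measurable (lebesgue_on \<Omega>)" and c: "c \<in> Linfty \<Omega>" and d: "d \<in> Linfty \<Omega>"
  shows "(\<lambda>x. min (c x) (max (u x) (d x))) \<in> Linfty \<Omega>"
proof -
  obtain C D where CD: "AE x in lebesgue_on \<Omega>. \<bar>c x\<bar> \<le> C" "AE x in lebesgue_on \<Omega>. \<bar>d x\<bar> \<le> D"
    using c d by (auto simp: Linfty_def)
  have [measurable]: "c \<in> borel_measurable (lebesgue_on \<Omega>)" "d \<in> borel_measurable (lebesgue_on \<Omega>)"
    using c d by (auto simp: Linfty_def)
  have "AE x in lebesgue_on \<Omega>. \<bar>min (c x) (max (u x) (d x))\<bar> \<le> max C D"
    using CD by eventually_elim auto
  moreover have "(\<lambda>x. min (c x) (max (u x) (d x))) \<in> borel_measurable (lebesgue_on \<Omega>)"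
    by measurable
  ultimately show ?thesis
    unfolding Linfty_def by blast
qed

lemma W1p_tendsto_subsequence:
  assumes "W1p_tendsto \<Omega> p v u" "strict_mono r"
  shows "W1p_tendsto \<Omega> p (\<lambda>k. v (r k)) u"
  using assms LIMSEQ_subseq_LIMSEQ[of "\<lambda>k. W1p_norm \<Omega> p (\<lambda>x. v k x - u x)" 0 r]
  by (simp add: W1p_tendsto_def o_def)

lemma energy_tendsto_subsequence:
  assumes "energy_tendsto \<Omega> L v u" "strict_mono r"
  shows "energy_tendsto \<Omega> L (\<lambda>k. v (r k)) u"
  using assms eventually_subseq[OF assms(2), of "\<lambda>k. integrable (lebesgue_on \<Omega>) (lagrangian_along \<Omega> L (v k))"]
    LIMSEQ_subseq_LIMSEQ[of "\<lambda>k. LINT x|lebesgue_on \<Omega>. \<bar>lagrangian_along \<Omega> L (v k) x - lagrangian_along \<Omega> L u x\<bar>" 0 r]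
  by (simp add: energy_tendsto_def o_def)

theorem lemma2p1:
  fixes \<Omega> :: "'a::euclidean_space set"
    and p :: real
    and \<phi> u :: "'a \<Rightarrow> real"
    and L :: "'a \<Rightarrow> real \<Rightarrow> 'a \<Rightarrow> real"
    and c_plus c_minus :: "nat \<Rightarrow> 'a \<Rightarrow> real"
  assumes "open \<Omega>" and "bounded \<Omega>"
    and "1 \<le> p" and "p \<le> real DIM('a)"
    and "\<phi> \<in> W1p UNIV p \<inter> Linfty UNIV"
    and "caratheodory \<Omega> L"
    and "u \<in> admissible \<Omega> p \<phi> L"
    and "\<And>k. c_plus k \<in> W1p \<Omega> p \<inter> Linfty \<Omega>"
    and "\<And>k. c_minus k \<in> W1p \<Omega> p \<inter> Linfty \<Omega>"
    and "(\<lambda>k. essinf (lebesgue_on \<Omega>) (\<lambda>x. ereal (c_plus k x))) \<longlonglongrightarrow> \<infinity>"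
    and "(\<lambda>k. esssup (lebesgue_on \<Omega>) (\<lambda>x. ereal (c_minus k x))) \<longlonglongrightarrow> -\<infinity>"
    and "(\<lambda>k. \<integral>\<^sup>+x\<in>{x \<in> \<Omega>. u x > c_plus k x}.
            ennreal (L_bar p L x (c_plus k x) (weak_gradient \<Omega> (c_plus k) x)) \<partial>lebesgue)
          \<longlonglongrightarrow> 0"
    and "(\<lambda>k. \<integral>\<^sup>+x\<in>{x \<in> \<Omega>. u x < c_minus k x}.
            ennreal (L_bar p L x (c_minus k x) (weak_gradient \<Omega> (c_minus k) x)) \<partial>lebesgue)
          \<longlonglongrightarrow> 0"
  shows "Linfty_regular \<Omega> p \<phi> L u \<and>
    (let v = \<lambda>k x. min (c_plus k x) (max (u x) (c_minus k x)) in
       (\<forall>\<^sub>F k in sequentially. v k \<in> admissible \<Omega> p \<phi> L \<inter> Linfty \<Omega>) \<and>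
       W1p_tendsto \<Omega> p v u \<and> energy_tendsto \<Omega> L v u)"
proof -
  note \<Omega> = \<open>open \<Omega>\<close> and p = \<open>1 \<le> p\<close> and carath = \<open>caratheodory \<Omega> L\<close>
  let ?M = "lebesgue_on \<Omega>"
  have p0: "0 \<le> p" "0 < p"
    using p by auto
  note \<Omega>l = open_sets_lebesgue[OF \<Omega>]
  have \<phi>W: "\<phi> \<in> W1p \<Omega> p"
    using \<open>\<phi> \<in> W1p UNIV p \<inter> Linfty UNIV\<close> W1p_restrict[OF \<Omega> p0(1)] by blast
  have ubdry: "u \<in> W1p_bdry \<Omega> p \<phi>" and uL: "integrable ?M (lagrangian_along \<Omega> L u)"
    using \<open>u \<in> admissible \<Omega> p \<phi> L\<close> by (auto simp: admissible_def)
  have uW: "u \<in> W1p \<Omega> p"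
    using ubdry W1p_add[OF \<Omega> p0(1) \<phi>W] by (auto simp: W1p_bdry_def W1p_zero_def)
  have cW: "c_plus k \<in> W1p \<Omega> p" "c_minus k \<in> W1p \<Omega> p" and cI: "c_plus k \<in> Linfty \<Omega>" "c_minus k \<in> Linfty \<Omega>" for k
    using assms(8,9) by auto
  define v where "v = (\<lambda>k x. min (c_plus k x) (max (u x) (c_minus k x)))"
  define gu where "gu = weak_gradient \<Omega> u"
  define gp where "gp k = weak_gradient \<Omega> (c_plus k)" for k
  define gm where "gm k = weak_gradient \<Omega> (c_minus k)" for k
  note U = W1pD[OF \<Omega> uW p0(1), folded gu_def]
  note P = W1pD[OF \<Omega> cW(1) p0(1), folded gp_def] and N = W1pD[OF \<Omega> cW(2) p0(1), folded gm_def]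
  note [measurable] = Lp_spaceD(1)[OF U(1)] Lp_spaceD(1)[OF U(3)] Lp_spaceD(1)[OF P(1)] Lp_spaceD(1)[OF P(3)]
    Lp_spaceD(1)[OF N(1)] Lp_spaceD(1)[OF N(3)]
  have [measurable]: "(\<lambda>x. L x (c_plus k x) (gp k x)) \<in> borel_measurable ?M"
      "(\<lambda>x. L x (c_minus k x) (gm k x)) \<in> borel_measurable ?M"
      "(\<lambda>x. L x (u x) (gu x)) \<in> borel_measurable ?M" for k
    by (intro caratheodory_compose_measurable[OF \<Omega>l carath]; measurable)+
  have vW: "v k \<in> W1p \<Omega> p" for k
    unfolding v_def by (intro W1p_min W1p_max \<Omega> p0 cW uW)
  define gv where "gv k = weak_gradient \<Omega> (v k)" for k
  note V = W1pD[OF \<Omega> vW p0(1), folded gv_def]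
  note [measurable] = Lp_spaceD(1)[OF V(1)] Lp_spaceD(1)[OF V(3)]
  have [measurable]: "(\<lambda>x. L x (v k x) (gv k x)) \<in> borel_measurable ?M" for k
    by (intro caratheodory_compose_measurable[OF \<Omega>l carath]; measurable)
  \<comment> \<open>The strict inequalities give \<open>gu x\<close> wherever
    \<open>c_minus k x \<le> u x \<le> c_plus k x\<close>, endpoints included, in accordance with
    the strict truncation sets of the hypotheses.\<close>
  have gv_eq: "AE x in ?M. gv k x =
      (if c_plus k x < max (u x) (c_minus k x) then gp k x else if u x < c_minus k x then gm k x else gu x)" for k
    unfolding gv_def v_def min.commute[of "c_plus k _"]
    by (intro weak_gradient_eq_AE has_weak_gradient_min has_weak_gradient_max \<Omega> U P N)
  \<comment> \<open>Everything that \<open>u\<close> contributes to the errors in function, gradient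
    and energy; \<open>R k\<close> restricts it to the points where the truncation acts.\<close>
  define R0 where "R0 x = norm (u x) powr p + norm (gu x) powr p + \<bar>L x (u x) (gu x)\<bar>" for x
  define R where "R k x = (if c_plus k x < u x \<or> u x < c_minus k x then R0 x else 0)" for k x
  have Lbar0: "0 \<le> L_bar p L x t \<xi>" for x t \<xi>
    by (simp add: L_bar_def)
  have R00: "0 \<le> R0 x" for x
    by (simp add: R0_def)
  have intR0: "integrable ?M R0"
    using Lp_spaceD(2)[OF U(1)] Lp_spaceD(2)[OF U(3)] uL
    unfolding R0_def[abs_def] lagrangian_along_def[abs_def] gu_def by simp
  then have [measurable]: "R0 \<in> borel_measurable ?M"
    by auto
  note large = essinf_tendsto_PInfty[OF assms(10)] and small = esssup_tendsto_MInfty[OF assms(11)]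
  have Rlim: "(\<lambda>k. integral\<^sup>L ?M (R k)) \<longlonglongrightarrow> (LINT x|?M. 0)"
  proof (rule integral_dominated_convergence[OF _ _ intR0])
    have "AE x in ?M. \<forall>\<^sub>F k in sequentially. - u x \<le> - c_minus k x"
    proof (rule AE_eventually_less)
      show "\<forall>\<^sub>F k in sequentially. AE x in ?M. r \<le> - c_minus k x" for r
        using small[of "- r"] by (rule eventually_mono) (auto elim: eventually_mono)
    qed
    then show "AE x in ?M. (\<lambda>k. R k x) \<longlonglongrightarrow> 0"
      using AE_eventually_less[OF large, of u]
    proof eventually_elim
      case (elim x)
      have "\<forall>\<^sub>F k in sequentially. R k x = 0"
        using elim by eventually_elim (auto simp: R_def)
      then show ?case
        by (rule tendsto_eventually)
    qed
    show "AE x in ?M. norm (R k x) \<le> R0 x" for k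
      using R00 by (intro AE_I2) (simp add: R_def)
  qed (simp_all add: R_def[abs_def])
  have intR: "integrable ?M (R k)" for k
    by (rule Bochner_Integration.integrable_bound[OF intR0]) (use R00 in \<open>auto simp: R_def[abs_def]\<close>)
  define Qp where "Qp k x = (if c_plus k x < u x then L_bar p L x (c_plus k x) (gp k x) else 0)" for k x
  define Qm where "Qm k x = (if u x < c_minus k x then L_bar p L x (c_minus k x) (gm k x) else 0)" for k x
  have Qpm: "Qp k \<in> borel_measurable ?M" for k
    unfolding Qp_def[abs_def] L_bar_def by measurable
  have Qmm: "Qm k \<in> borel_measurable ?M" for k
    unfolding Qm_def[abs_def] L_bar_def by measurable
  have Q0: "0 \<le> Qp k x" "0 \<le> Qm k x" for k x
    by (simp_all add: Qp_def Qm_def Lbar0)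
  have "(\<lambda>k. \<integral>\<^sup>+x. ennreal (Qp k x) \<partial>?M) \<longlonglongrightarrow> 0" "(\<lambda>k. \<integral>\<^sup>+x. ennreal (Qm k x) \<partial>?M) \<longlonglongrightarrow> 0"
    using assms(12,13) by (simp_all only: set_nn_integral_lebesgue_on[OF \<Omega>l] Qp_def Qm_def gp_def gm_def)
  note Qlim = nn_integral_tendsto_0_imp[OF Qpm Q0(1) this(1)] nn_integral_tendsto_0_imp[OF Qmm Q0(2) this(2)]
  \<comment> \<open>A single majorant for all three errors, up to the factor \<open>2 powr p\<close>
    for the gradient.\<close>
  define E where "E k x = Qp k x + Qm k x + R k x" for k x
  have intE: "\<forall>\<^sub>F k in sequentially. integrable ?M (E k)"
    using Qlim(1,3) by eventually_elim (simp add: E_def[abs_def] intR)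
  have "\<forall>\<^sub>F k in sequentially. integral\<^sup>L ?M (Qp k) + integral\<^sup>L ?M (Qm k) + integral\<^sup>L ?M (R k) = integral\<^sup>L ?M (E k)"
    using Qlim(1,3) by eventually_elim (simp add: E_def[abs_def] intR)
  moreover have "(\<lambda>k. integral\<^sup>L ?M (Qp k) + integral\<^sup>L ?M (Qm k) + integral\<^sup>L ?M (R k)) \<longlonglongrightarrow> 0 + 0 + (LINT x|?M. 0)"
    by (intro tendsto_add Qlim Rlim)
  ultimately have Elim: "(\<lambda>k. integral\<^sup>L ?M (E k)) \<longlonglongrightarrow> 0"
    by (auto elim: Lim_transform_eventually)
  \<comment> \<open>Eventually \<open>c_minus k \<le> 0 \<le> c_plus k\<close> a.e. A truncated
    value then lies between 0 and \<open>u x\<close>, so its distance to \<open>u x\<close> is at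
    most \<open>\<bar>u x\<bar>\<close>; this matters because \<open>L_bar\<close> contains no power
    of the truncating function itself. It also makes the two truncation sets disjoint up to a null
    set.\<close>
  have bounds: "\<forall>\<^sub>F k in sequentially. AE x in ?M. norm (v k x - u x) powr p \<le> E k x \<and>
      norm (gv k x - gu x) powr p \<le> 2 powr p * E k x \<and> \<bar>L x (v k x) (gv k x) - L x (u x) (gu x)\<bar> \<le> E k x"
    using large[of 0] small[of 0]
  proof eventually_elim
    case (elim k)
    show ?case
      using elim gv_eq[of k]
    proof eventually_elim
      case (elim x)
      \<comment> \<open>Serves both truncated cases, with \<open>c\<close> and \<open>g\<close> the
        value and the gradient of the active truncating function.\<close>
      have key: "norm (c - u x) powr p \<le> e \<and> norm (g - gu x) powr p \<le> 2 powr p * e \<and>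
          \<bar>L x c g - L x (u x) (gu x)\<bar> \<le> e"
        if c: "\<bar>c - u x\<bar> \<le> \<bar>u x\<bar>" and e: "e = L_bar p L x c g + R0 x" for c g e
      proof (intro conjI)
        have "norm (c - u x) powr p \<le> norm (u x) powr p"
          using c p0 by (intro powr_mono2) auto
        also have "\<dots> \<le> e"
          by (simp add: e R0_def L_bar_def)
        finally show "norm (c - u x) powr p \<le> e" .
        have "norm (g - gu x) powr p \<le> 2 powr p * (norm g powr p + norm (gu x) powr p)"
          by (rule norm_diff_powr_le[OF p0(1)])
        also have "\<dots> \<le> 2 powr p * e"
          by (intro mult_left_mono) (auto simp: e L_bar_def R0_def)
        finally show "norm (g - gu x) powr p \<le> 2 powr p * e" .
        have "\<bar>L x c g - L x (u x) (gu x)\<bar> \<le> \<bar>L x c g\<bar> + \<bar>L x (u x) (gu x)\<bar>"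
          by (rule abs_triangle_ineq4)
        also have "\<dots> \<le> e"
          by (simp add: e L_bar_def R0_def)
        finally show "\<bar>L x c g - L x (u x) (gu x)\<bar> \<le> e" .
      qed
      consider "c_plus k x < u x" | "u x < c_minus k x" | "c_minus k x \<le> u x" "u x \<le> c_plus k x"
        by linarith
      then show ?case
      proof cases
        case 1
        then have eq: "v k x = c_plus k x" "gv k x = gp k x" "E k x = L_bar p L x (c_plus k x) (gp k x) + R0 x"
          using elim by (auto simp: v_def E_def Qp_def Qm_def R_def)
        show ?thesis
          unfolding eq(1,2) using key[OF _ eq(3)] 1 elim by auto
      next
        case 2
        then have eq: "v k x = c_minus k x" "gv k x = gm k x" "E k x = L_bar p L x (c_minus k x) (gm k x) + R0 x"
          using elim by (auto simp: v_def E_def Qp_def Qm_def R_def)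
        show ?thesis
          unfolding eq(1,2) using key[OF _ eq(3)] 2 elim by auto
      next
        case 3
        then have eq: "v k x = u x" "gv k x = gu x" "E k x = 0"
          using elim by (auto simp: v_def E_def Qp_def Qm_def R_def)
        then show ?thesis by simp
      qed
    qed
  qed
  have le1: "\<forall>\<^sub>F k in sequentially. AE x in ?M. \<bar>norm (v k x - u x) powr p\<bar> \<le> 1 * E k x"
    using bounds by (rule eventually_mono) (simp add: AE_conj_iff)
  have lim1: "(\<lambda>k. LINT x|?M. norm (v k x - u x) powr p) \<longlonglongrightarrow> 0"
    using tendsto_L1_comparison(2)[OF _ le1 intE Elim] by simp
  have le2: "\<forall>\<^sub>F k in sequentially. AE x in ?M. \<bar>norm (gv k x - gu x) powr p\<bar> \<le> 2 powr p * E k x"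
    using bounds by (rule eventually_mono) (simp add: AE_conj_iff)
  have lim2: "(\<lambda>k. LINT x|?M. norm (gv k x - gu x) powr p) \<longlonglongrightarrow> 0"
    using tendsto_L1_comparison(2)[OF _ le2 intE Elim] by simp
  have along: "lagrangian_along \<Omega> L (v k) = (\<lambda>x. L x (v k x) (gv k x))" "lagrangian_along \<Omega> L u = (\<lambda>x. L x (u x) (gu x))" for k
    by (simp_all add: lagrangian_along_def[abs_def] gv_def gu_def)
  have le3: "\<forall>\<^sub>F k in sequentially. AE x in ?M. \<bar>L x (v k x) (gv k x) - L x (u x) (gu x)\<bar> \<le> 1 * E k x"
    using bounds by (rule eventually_mono) (simp add: AE_conj_iff)
  have Ldm: "(\<lambda>x. L x (v k x) (gv k x) - L x (u x) (gu x)) \<in> borel_measurable ?M" for k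
    by measurable
  note L3 = tendsto_L1_comparison[OF Ldm le3 intE Elim]
  have intLv: "\<forall>\<^sub>F k in sequentially. integrable ?M (lagrangian_along \<Omega> L (v k))"
    using L3(1)
  proof eventually_elim
    case (elim k)
    then have "integrable ?M (\<lambda>x. (L x (v k x) (gv k x) - L x (u x) (gu x)) + L x (u x) (gu x))"
      using uL unfolding along by (intro Bochner_Integration.integrable_add) auto
    then show ?case
      by (simp add: along)
  qed
  have energy: "energy_tendsto \<Omega> L v u"
    using intLv uL L3(2) by (simp add: energy_tendsto_def along)
  have W1p: "W1p_tendsto \<Omega> p v u"
  proof -
    have "W1p_norm \<Omega> p (\<lambda>x. v k x - u x) =
        ((LINT x|?M. norm (v k x - u x) powr p) + (LINT x|?M. norm (gv k x - gu x) powr p)) powr (1 / p)" for k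
      by (rule W1p_norm_eq[OF \<Omega> has_weak_gradient_diff[OF \<Omega> V(2) U(2)]]) measurable
    \<comment> \<open>At base 0 the power is continuous along nonnegative values because the
      exponent \<open>1 / p\<close> is positive.\<close>
    moreover have "(\<lambda>k. ((LINT x|?M. norm (v k x - u x) powr p) + (LINT x|?M. norm (gv k x - gu x) powr p)) powr (1 / p))
        \<longlonglongrightarrow> (0 + 0) powr (1 / p)"
      using p0 by (intro tendsto_powr' tendsto_add lim1 lim2 tendsto_const) (auto intro!: always_eventually add_nonneg_nonneg)
    ultimately show ?thesis
      using vW uW by (simp add: W1p_tendsto_def)
  qed
  have adm: "\<forall>\<^sub>F k in sequentially. v k \<in> admissible \<Omega> p \<phi> L \<inter> Linfty \<Omega>"
  proof -
    \<comment> \<open>Keeping the boundary values requires the truncating functions to enclose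
      \<phi> a.e., which happens once they pass the levels \<open>C\<close> and
      \<open>- C\<close>.\<close>
    obtain C where "AE x in lebesgue_on UNIV. \<bar>\<phi> x\<bar> \<le> C"
      using assms(5) by (auto simp: Linfty_def)
    then have C: "AE x in ?M. \<bar>\<phi> x\<bar> \<le> C"
      by (rule AE_lebesgue_on_subset) (use \<Omega>l in auto)
    show ?thesis
      using large[of C] small[of "- C"] intLv
    proof eventually_elim
      case (elim k)
      have "AE x in ?M. c_minus k x \<le> \<phi> x \<and> \<phi> x \<le> c_plus k x"
        using elim(1,2) C by eventually_elim auto
      then have "v k \<in> W1p_bdry \<Omega> p \<phi>"
        unfolding v_def by (rule truncation_in_W1p_bdry[OF \<Omega> p \<phi>W ubdry cW])
      moreover have "v k \<in> Linfty \<Omega>"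
        unfolding v_def by (rule truncation_in_Linfty[OF _ cI]) measurable
      ultimately show ?case
        using elim(3) by (simp add: admissible_def)
    qed
  qed
  then obtain k0 where k0: "\<And>k. k0 \<le> k \<Longrightarrow> v k \<in> admissible \<Omega> p \<phi> L \<inter> Linfty \<Omega>"
    by (auto simp: eventually_sequentially)
  \<comment> \<open>\<open>Linfty_regular\<close> asks for admissibility of every term, which is
    known only from \<open>k0\<close> on; dropping the earlier terms preserves both
    convergences.\<close>
  have mono: "strict_mono (\<lambda>k. k0 + k)"
    by (simp add: strict_mono_def)
  have "Linfty_regular \<Omega> p \<phi> L u"
    unfolding Linfty_regular_def
    using k0 W1p_tendsto_subsequence[OF W1p mono] energy_tendsto_subsequence[OF energy mono]
    by (intro exI[of _ "\<lambda>k. v (k0 + k)"]) auto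
  then show ?thesis
    using adm W1p energy unfolding v_def Let_def by blast
qed

end
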